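(* Let $b\in\{N,D\}$, $\alpha\ge0$, and let $u:[0,\infty)\to\mathcal H$ be the mild solution to $du(t)=L_bu(t)\,dt+(1-L_b)^{-\alpha/2}dW(t)$ with initial value $u_0=0$. Then for all $(t,x)\in[0,\infty)\times F$ the expression $$u(t,x):=\sum_{k=1}^\infty(1+\lambda^b_k)^{-\alpha/2}X^{b,k}_t\,\phi^b_k(x)$$ is a well-defined real-valued centred Gaussian random variable (the series converging in $L^2(\mathbb P)$). There exists a constant $c_8>0$ such that for all $x\in F$, $t\in[0,\infty)$ and $n\ge0$, $$\mathbb E\left[\left(\langle u(t),f^x_n\rangle_\mu-u(t,x)\right)^2\right]\le c_8\,e^{2t}\,2^{-n}.$$
   Context: Setting. Let $M\ge2$, $I=\{1,\dots,M\}$, let $F$ be a connected compact metric space and $\psi_i:F\to F$ ($i\in I$) injective strict contractions with $F=\bigcup_i\psi_i(F)$. Let $\mathbb W_n=I^n$ ($\mathbb W_0$ contains only the empty word), $\mathbb W_*=\bigcup_{n\ge0}\mathbb W_n$, $\mathbb W=I^{\mathbb N}$. For $w=w_1\dots w_n\in\mathbb W_*$ put $\psi_w=\psi_{w_1}\circ\dots\circ\psi_{w_n}$, $F_w=\psi_w(F)$. Let $\pi:\mathbb W\to F$ be given by $\{\pi(w)\}=\bigcap_nF_{w_1\dots w_n}$. With $\sigma$ the left shift on $\mathbb W$, the post-critical set is $P=\bigcup_{n\ge1}\sigma^n\big(\pi^{-1}(\bigcup_{i\ne j}F_i\cap F_j)\big)$; assume $P$ is finite (so $(F,(\psi_i))$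 is a connected post-critically finite self-similar set). Put $F^0=\pi(P)$, $F^n=\bigcup_{w\in\mathbb W_n}\psi_w(F^0)$. Let $(A_0,\mathbf r)$ be a regular irreducible harmonic structure: $\mathbf r=(r_1,\dots,r_M)$ with all $r_i\in(0,1)$; $A_0$ is a real symmetric matrix indexed by $F^0$, non-positive definite, with non-negative off-diagonal entries and kernel exactly the constants; and, with $\mathcal E_0(f,g)=-\sum_{x,y\in F^0}f(x)A_0(x,y)g(y)$, $r_w=\prod_ir_{w_i}$ and $\mathcal E_n(f,g)=\sum_{w\in\mathbb W_n}r_w^{-1}\mathcal E_0(f\circ\psi_w|_{F^0},g\circ\psi_w|_{F^0})$ for $f,g:F^n\to\mathbb R$, one has $\mathcal E_0(f,f)=\min\{\mathcal E_1(g,g):g|_{F^0}=f\}$ for all $f$. Let $\mathcal D=\{f\in C(F):\lim_n\mathcal E_n(f|_{F^n},f|_{F^n})<\infty\}$, $\mathcal E(f,g)=\lim_n\mathcal E_n(f|_{F^n},g|_{F^n})$, $\mathcal D_0=\{f\in\mathcal D:f|_{F^0}=0\}$. Let $d_H>0$ be the unique number with $\sum_ir_i^{d_H}=1$, and $\mu$ the Borel probability measure on $F$ with $\mu(F_w)=r_w^{d_H}$ for all $w\in\mathbb W_*$. Then $(\mathcal E,\mathcal D)$ and $(\mathcal E,\mathcal D_0)$ are regular local Dirichlet forms on $\mathcal H:=L^2(F,\mu)$ (inner product $\langle\cdot,\cdot\rangle_\mu$) and on $L^2(F\setminus F^0,\mu)$ (identified with $\mathcal H$). Let $-L_N$, $-L_D$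 be the associated non-negative self-adjoint operators and $S^b_t=\exp(tL_b)$. $(\phi^b_k)_{k\ge1}$ is a complete orthonormal basis of $\mathcal H$ of eigenfunctions of $-L_b$ (continuous representatives) with eigenvalues $0\le\lambda^b_1\le\lambda^b_2\le\cdots\to\infty$. $W$ is a cylindrical Wiener process on $\mathcal H$ (identity covariance) and $X^{b,k}_t=\int_0^te^{-\lambda^b_k(t-s)}\,d\langle\phi^b_k,W(s)\rangle_\mu$, where $(\langle\phi^b_k,W\rangle_\mu)_{k\ge1}$ are independent real standard Wiener processes. The mild solution with $u_0=0$ is the predictable $\mathcal H$-valued process (unique up to versions) with $u(t)=\int_0^tS^b_{t-s}(1-L_b)^{-\alpha/2}dW(s)$ almost surely for each $t$. For $n\ge1$, $\Lambda_n=\{w=w_1\dots w_m\in\mathbb W_*:r_{w_1\dots w_{m-1}}>2^{-n}\ge r_w\}$; $\Lambda_0$ contains only the empty word. For $x\in F$, $D^0_n(x)=\bigcup\{F_w:w\in\Lambda_n,\ x\in F_w\}$ and $f^x_n=\mu(D^0_n(x))^{-1}\mathbf 1_{D^0_n(x)}\in\mathcal H$. *)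

theory Defs
  imports "HOL-Probability.Probability"
begin

section \<open>Post-critically finite self-similar sets\<close>

text \<open>
  The alphabet is \<open>{1..M}\<close>. Finite words are lists, infinite words are functions on \<open>nat\<close>, so the
  letter \<open>w\<^sub>k\<close> of an infinite word \<open>\<omega>\<close> is \<open>\<omega> (k - 1)\<close>. The space \<open>F\<close> is a subset of a metric space
  type; maps and functions on \<open>F\<close> are total functions whose values off \<open>F\<close> are irrelevant.
\<close>

definition words :: "nat \<Rightarrow> nat \<Rightarrow> nat list set" where
  "words M n = {w. length w = n \<and> set w \<subseteq> {1..M}}"

definition all_words :: "nat \<Rightarrow> nat list set" where
  "all_words M = (\<Union>n. words M n)"

definition infinite_words :: "nat \<Rightarrow> (nat \<Rightarrow> nat) set" where
  "infinite_words M = {\<omega>. range \<omega> \<subseteq> {1..M}}"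

definition word_map :: "(nat \<Rightarrow> 'a \<Rightarrow> 'a) \<Rightarrow> nat list \<Rightarrow> 'a \<Rightarrow> 'a" where
  "word_map \<psi> w = foldr (\<lambda>i g. \<psi> i \<circ> g) w id"

definition cell :: "'a set \<Rightarrow> (nat \<Rightarrow> 'a \<Rightarrow> 'a) \<Rightarrow> nat list \<Rightarrow> 'a set" where
  "cell F \<psi> w = word_map \<psi> w ` F"

definition coding_map :: "'a set \<Rightarrow> (nat \<Rightarrow> 'a \<Rightarrow> 'a) \<Rightarrow> (nat \<Rightarrow> nat) \<Rightarrow> 'a" where
  "coding_map F \<psi> \<omega> = (THE x. x \<in> (\<Inter>n. cell F \<psi> (map \<omega> [0..<n])))"

definition critical_points :: "nat \<Rightarrow> 'a set \<Rightarrow> (nat \<Rightarrow> 'a \<Rightarrow> 'a) \<Rightarrow> 'a set" where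
  "critical_points M F \<psi> = (\<Union>i\<in>{1..M}. \<Union>j\<in>{1..M} - {i}. \<psi> i ` F \<inter> \<psi> j ` F)"

definition left_shift :: "(nat \<Rightarrow> nat) \<Rightarrow> nat \<Rightarrow> nat" where
  "left_shift \<omega> = (\<lambda>k. \<omega> (Suc k))"

definition post_critical_set :: "nat \<Rightarrow> 'a set \<Rightarrow> (nat \<Rightarrow> 'a \<Rightarrow> 'a) \<Rightarrow> (nat \<Rightarrow> nat) set" where
  "post_critical_set M F \<psi> =
     (\<Union>n\<in>{1..}. (left_shift ^^ n) `
        {\<omega> \<in> infinite_words M. coding_map F \<psi> \<omega> \<in> critical_points M F \<psi>})"

definition connected_pcf_set :: "nat \<Rightarrow> 'a::metric_space set \<Rightarrow> (nat \<Rightarrow> 'a \<Rightarrow> 'a) \<Rightarrow> bool" where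
  "connected_pcf_set M F \<psi> \<longleftrightarrow>
     M \<ge> 2 \<and> compact F \<and> connected F \<and>
     (\<forall>i\<in>{1..M}. inj_on (\<psi> i) F \<and> (\<exists>c<1. c-lipschitz_on F (\<psi> i))) \<and>
     F = (\<Union>i\<in>{1..M}. \<psi> i ` F) \<and>
     finite (post_critical_set M F \<psi>)"

definition vertices0 :: "nat \<Rightarrow> 'a set \<Rightarrow> (nat \<Rightarrow> 'a \<Rightarrow> 'a) \<Rightarrow> 'a set" where
  "vertices0 M F \<psi> = coding_map F \<psi> ` post_critical_set M F \<psi>"


section \<open>Harmonic structures and the energy form\<close>

text \<open>
  The matrix \<open>A\<close> is a function of two points, of which only the values on \<open>vertices0 M F \<psi>\<close> matter.
\<close>

definition word_ratio :: "(nat \<Rightarrow> real) \<Rightarrow> nat list \<Rightarrow> real" where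
  "word_ratio r w = prod_list (map r w)"

definition energy0 :: "'a set \<Rightarrow> ('a \<Rightarrow> 'a \<Rightarrow> real) \<Rightarrow> ('a \<Rightarrow> real) \<Rightarrow> ('a \<Rightarrow> real) \<Rightarrow> real" where
  "energy0 V A f g = - (\<Sum>x\<in>V. \<Sum>y\<in>V. f x * A x y * g y)"

definition energy_n ::
    "nat \<Rightarrow> 'a set \<Rightarrow> (nat \<Rightarrow> 'a \<Rightarrow> 'a) \<Rightarrow> ('a \<Rightarrow> 'a \<Rightarrow> real) \<Rightarrow> (nat \<Rightarrow> real) \<Rightarrow> nat
      \<Rightarrow> ('a \<Rightarrow> real) \<Rightarrow> ('a \<Rightarrow> real) \<Rightarrow> real" where
  "energy_n M F \<psi> A r n f g =
     (\<Sum>w\<in>words M n. inverse (word_ratio r w) *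
        energy0 (vertices0 M F \<psi>) A (f \<circ> word_map \<psi> w) (g \<circ> word_map \<psi> w))"

definition regular_harmonic_structure ::
    "nat \<Rightarrow> 'a set \<Rightarrow> (nat \<Rightarrow> 'a \<Rightarrow> 'a) \<Rightarrow> ('a \<Rightarrow> 'a \<Rightarrow> real) \<Rightarrow> (nat \<Rightarrow> real) \<Rightarrow> bool" where
  "regular_harmonic_structure M F \<psi> A r \<longleftrightarrow>
     (let V = vertices0 M F \<psi> in
      (\<forall>i\<in>{1..M}. 0 < r i \<and> r i < 1) \<and>
      (\<forall>x\<in>V. \<forall>y\<in>V. A x y = A y x) \<and>
      (\<forall>f. (\<Sum>x\<in>V. \<Sum>y\<in>V. f x * A x y * f y) \<le> 0) \<and>
      (\<forall>x\<in>V. \<forall>y\<in>V. x \<noteq> y \<longrightarrow> A x y \<ge> 0) \<and>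
      (\<forall>f. (\<forall>x\<in>V. (\<Sum>y\<in>V. A x y * f y) = 0) \<longleftrightarrow> (\<exists>c. \<forall>x\<in>V. f x = c)) \<and>
      (\<forall>f. (\<exists>g. (\<forall>x\<in>V. g x = f x) \<and> energy_n M F \<psi> A r 1 g g = energy0 V A f f) \<and>
           (\<forall>g. (\<forall>x\<in>V. g x = f x) \<longrightarrow> energy0 V A f f \<le> energy_n M F \<psi> A r 1 g g)))"

text \<open>
  \<open>\<E>\<^sub>n(f, f)\<close> is non-decreasing in \<open>n\<close>, so the limit is finite exactly when the sequence converges.
\<close>

definition energy_domain ::
    "nat \<Rightarrow> 'a::metric_space set \<Rightarrow> (nat \<Rightarrow> 'a \<Rightarrow> 'a) \<Rightarrow> ('a \<Rightarrow> 'a \<Rightarrow> real) \<Rightarrow> (nat \<Rightarrow> real)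
      \<Rightarrow> ('a \<Rightarrow> real) set" where
  "energy_domain M F \<psi> A r =
     {f. continuous_on F f \<and> convergent (\<lambda>n. energy_n M F \<psi> A r n f f)}"

definition energy ::
    "nat \<Rightarrow> 'a set \<Rightarrow> (nat \<Rightarrow> 'a \<Rightarrow> 'a) \<Rightarrow> ('a \<Rightarrow> 'a \<Rightarrow> real) \<Rightarrow> (nat \<Rightarrow> real)
      \<Rightarrow> ('a \<Rightarrow> real) \<Rightarrow> ('a \<Rightarrow> real) \<Rightarrow> real" where
  "energy M F \<psi> A r f g = lim (\<lambda>n. energy_n M F \<psi> A r n f g)"

datatype boundary_condition = Neumann | Dirichlet

definition form_domain ::
    "boundary_condition \<Rightarrow> nat \<Rightarrow> 'a::metric_space set \<Rightarrow> (nat \<Rightarrow> 'a \<Rightarrow> 'a) \<Rightarrow> ('a \<Rightarrow> 'a \<Rightarrow> real)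
      \<Rightarrow> (nat \<Rightarrow> real) \<Rightarrow> ('a \<Rightarrow> real) set" where
  "form_domain b M F \<psi> A r =
     (case b of
        Neumann \<Rightarrow> energy_domain M F \<psi> A r
      | Dirichlet \<Rightarrow> {f \<in> energy_domain M F \<psi> A r. \<forall>x\<in>vertices0 M F \<psi>. f x = 0})"

definition self_similar_measure ::
    "nat \<Rightarrow> 'a::metric_space set \<Rightarrow> (nat \<Rightarrow> 'a \<Rightarrow> 'a) \<Rightarrow> (nat \<Rightarrow> real) \<Rightarrow> real \<Rightarrow> 'a measure \<Rightarrow> bool" where
  "self_similar_measure M F \<psi> r d \<mu> \<longleftrightarrow>
     sets \<mu> = sets (restrict_space borel F) \<and> prob_space \<mu> \<and>
     (\<forall>w\<in>all_words M. measure \<mu> (cell F \<psi> w) = word_ratio r w powr d)"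


section \<open>Square-integrable functions\<close>

text \<open>
  Elements of \<open>L\<^sup>2(N)\<close> are represented by square-integrable functions; equality in \<open>L\<^sup>2(N)\<close> is equality
  almost everywhere. \<open>l2_sq\<close> is the squared norm.
\<close>

definition l2_sq :: "'a measure \<Rightarrow> ('a \<Rightarrow> real) \<Rightarrow> ennreal" where
  "l2_sq N f = (\<integral>\<^sup>+x. ennreal ((f x)\<^sup>2) \<partial>N)"

definition L2 :: "'a measure \<Rightarrow> ('a \<Rightarrow> real) set" where
  "L2 N = {f \<in> borel_measurable N. l2_sq N f < \<infinity>}"

definition l2_inner :: "'a measure \<Rightarrow> ('a \<Rightarrow> real) \<Rightarrow> ('a \<Rightarrow> real) \<Rightarrow> real" where
  "l2_inner N f g = (\<integral>x. f x * g x \<partial>N)"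

definition l2_tendsto :: "'a measure \<Rightarrow> (nat \<Rightarrow> 'a \<Rightarrow> real) \<Rightarrow> ('a \<Rightarrow> real) \<Rightarrow> bool" where
  "l2_tendsto N s f \<longleftrightarrow> f \<in> L2 N \<and> (\<forall>n. s n \<in> L2 N) \<and> (\<lambda>n. l2_sq N (\<lambda>x. s n x - f x)) \<longlonglongrightarrow> 0"

definition l2_sums :: "'a measure \<Rightarrow> (nat \<Rightarrow> 'a \<Rightarrow> real) \<Rightarrow> ('a \<Rightarrow> real) \<Rightarrow> bool" where
  "l2_sums N s f \<longleftrightarrow> l2_tendsto N (\<lambda>n x. \<Sum>k<n. s k x) f"

definition orthonormal :: "'a measure \<Rightarrow> (nat \<Rightarrow> 'a \<Rightarrow> real) \<Rightarrow> bool" where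
  "orthonormal N e \<longleftrightarrow>
     (\<forall>k. e k \<in> L2 N) \<and> (\<forall>j k. l2_inner N (e j) (e k) = (if j = k then 1 else 0))"

definition complete_orthonormal :: "'a measure \<Rightarrow> (nat \<Rightarrow> 'a \<Rightarrow> real) \<Rightarrow> bool" where
  "complete_orthonormal N e \<longleftrightarrow>
     orthonormal N e \<and> (\<forall>f\<in>L2 N. (\<forall>k. l2_inner N f (e k) = 0) \<longrightarrow> (AE x in N. f x = 0))"

text \<open>
  Generated by the open balls, which for separable \<open>L\<^sup>2(N)\<close> is the Borel \<open>\<sigma>\<close>-algebra.
\<close>

definition l2_borel :: "'a measure \<Rightarrow> ('a \<Rightarrow> real) measure" where
  "l2_borel N =
     sigma (L2 N) {{g \<in> L2 N. l2_sq N (\<lambda>x. g x - h x) < ennreal (\<epsilon>\<^sup>2)} | h \<epsilon>. h \<in> L2 N \<and> \<epsilon> > 0}"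


section \<open>The operators associated with the form\<close>

text \<open>
  \<open>neg_laplacian b M F \<psi> A r \<mu> f g\<close> says that \<open>f\<close> is (the continuous representative of) an element
  of the domain of the non-negative self-adjoint operator \<open>- L\<^sub>b\<close> associated with the form, and
  \<open>- L\<^sub>b f = g\<close>.
\<close>

definition neg_laplacian ::
    "boundary_condition \<Rightarrow> nat \<Rightarrow> 'a::metric_space set \<Rightarrow> (nat \<Rightarrow> 'a \<Rightarrow> 'a) \<Rightarrow> ('a \<Rightarrow> 'a \<Rightarrow> real)
      \<Rightarrow> (nat \<Rightarrow> real) \<Rightarrow> 'a measure \<Rightarrow> ('a \<Rightarrow> real) \<Rightarrow> ('a \<Rightarrow> real) \<Rightarrow> bool" where
  "neg_laplacian b M F \<psi> A r \<mu> f g \<longleftrightarrow>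
     f \<in> form_domain b M F \<psi> A r \<and> g \<in> L2 \<mu> \<and>
     (\<forall>h\<in>form_domain b M F \<psi> A r. energy M F \<psi> A r f h = l2_inner \<mu> g h)"

text \<open>Eigenfunctions and eigenvalues are indexed from \<open>0\<close>.\<close>

definition eigenbasis ::
    "boundary_condition \<Rightarrow> nat \<Rightarrow> 'a::metric_space set \<Rightarrow> (nat \<Rightarrow> 'a \<Rightarrow> 'a) \<Rightarrow> ('a \<Rightarrow> 'a \<Rightarrow> real)
      \<Rightarrow> (nat \<Rightarrow> real) \<Rightarrow> 'a measure \<Rightarrow> (nat \<Rightarrow> 'a \<Rightarrow> real) \<Rightarrow> (nat \<Rightarrow> real) \<Rightarrow> bool" where
  "eigenbasis b M F \<psi> A r \<mu> \<phi> lam \<longleftrightarrow>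
     complete_orthonormal \<mu> \<phi> \<and>
     (\<forall>k. neg_laplacian b M F \<psi> A r \<mu> (\<phi> k) (\<lambda>x. lam k * \<phi> k x)) \<and>
     0 \<le> lam 0 \<and> incseq lam \<and> filterlim lam at_top sequentially"

text \<open>
  Functional calculus \<open>G(- L)\<close>, for bounded \<open>G\<close>, of a self-adjoint operator \<open>- L\<close> with a complete
  orthonormal basis \<open>\<phi>\<close> of eigenfunctions with eigenvalues \<open>lam\<close>. The result is unique up to equality
  almost everywhere.
\<close>

definition spectral_op ::
    "'a measure \<Rightarrow> (nat \<Rightarrow> 'a \<Rightarrow> real) \<Rightarrow> (nat \<Rightarrow> real) \<Rightarrow> (real \<Rightarrow> real)
      \<Rightarrow> ('a \<Rightarrow> real) \<Rightarrow> ('a \<Rightarrow> real)" where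
  "spectral_op N \<phi> lam G f = (SOME g. l2_sums N (\<lambda>k x. G (lam k) * l2_inner N (\<phi> k) f * \<phi> k x) g)"

definition semigroup_op ::
    "'a measure \<Rightarrow> (nat \<Rightarrow> 'a \<Rightarrow> real) \<Rightarrow> (nat \<Rightarrow> real) \<Rightarrow> real \<Rightarrow> ('a \<Rightarrow> real) \<Rightarrow> ('a \<Rightarrow> real)" where
  "semigroup_op N \<phi> lam t = spectral_op N \<phi> lam (\<lambda>l. exp (- l * t))"

definition bessel_op ::
    "'a measure \<Rightarrow> (nat \<Rightarrow> 'a \<Rightarrow> real) \<Rightarrow> (nat \<Rightarrow> real) \<Rightarrow> real \<Rightarrow> ('a \<Rightarrow> real) \<Rightarrow> ('a \<Rightarrow> real)" where
  "bessel_op N \<phi> lam \<alpha> = spectral_op N \<phi> lam (\<lambda>l. (1 + l) powr (- \<alpha> / 2))"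


section \<open>Wiener processes\<close>

definition centred_gaussian_var :: "'w measure \<Rightarrow> real \<Rightarrow> ('w \<Rightarrow> real) \<Rightarrow> bool" where
  "centred_gaussian_var P v Y \<longleftrightarrow>
     Y \<in> borel_measurable P \<and> v \<ge> 0 \<and>
     (if v = 0 then (AE \<omega> in P. Y \<omega> = 0) else distributed P lborel Y (normal_density 0 (sqrt v)))"

definition centred_gaussian :: "'w measure \<Rightarrow> ('w \<Rightarrow> real) \<Rightarrow> bool" where
  "centred_gaussian P Y \<longleftrightarrow> (\<exists>v. centred_gaussian_var P v Y)"

text \<open>
  Time is \<open>[0, \<infinity>)\<close>; the values of filtrations and processes at negative times are irrelevant.
\<close>

definition filtered_prob_space :: "'w measure \<Rightarrow> (real \<Rightarrow> 'w measure) \<Rightarrow> bool" where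
  "filtered_prob_space P Ft \<longleftrightarrow>
     prob_space P \<and> filtration (space P) Ft \<and> (\<forall>t. subalgebra P (Ft t))"

text \<open>
  A real Wiener process with respect to the filtration \<open>Ft\<close>, with variance \<open>v * t\<close> at time \<open>t\<close>; it is
  standard if \<open>v = 1\<close>.
\<close>

definition wiener_process ::
    "'w measure \<Rightarrow> (real \<Rightarrow> 'w measure) \<Rightarrow> real \<Rightarrow> (real \<Rightarrow> 'w \<Rightarrow> real) \<Rightarrow> bool" where
  "wiener_process P Ft v B \<longleftrightarrow>
     (\<forall>t\<ge>0. B t \<in> borel_measurable (Ft t)) \<and>
     (AE \<omega> in P. B 0 \<omega> = 0) \<and>
     (AE \<omega> in P. continuous_on {0..} (\<lambda>t. B t \<omega>)) \<and>
     (\<forall>s t. 0 \<le> s \<and> s \<le> t \<longrightarrow>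
        centred_gaussian_var P (v * (t - s)) (\<lambda>\<omega>. B t \<omega> - B s \<omega>) \<and>
        prob_space.indep_set P (sets (Ft s))
          (sets (vimage_algebra (space P) (\<lambda>\<omega>. B t \<omega> - B s \<omega>) borel)))"

text \<open>
  A cylindrical Wiener process on \<open>L\<^sup>2(N)\<close> with identity covariance. It does not take values in
  \<open>L\<^sup>2(N)\<close>; it is given by the pairings \<open>W t h = \<langle>h, W(t)\<rangle>\<close>.
\<close>

definition cylindrical_wiener ::
    "'w measure \<Rightarrow> (real \<Rightarrow> 'w measure) \<Rightarrow> 'a measure \<Rightarrow> (real \<Rightarrow> ('a \<Rightarrow> real) \<Rightarrow> 'w \<Rightarrow> real) \<Rightarrow> bool" where
  "cylindrical_wiener P Ft N W \<longleftrightarrow>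
     (\<forall>h\<in>L2 N. wiener_process P Ft (l2_inner N h h) (\<lambda>t. W t h)) \<and>
     (\<forall>t\<ge>0. \<forall>f\<in>L2 N. \<forall>g\<in>L2 N. \<forall>h\<in>L2 N. \<forall>a c.
        (AE x in N. f x = a * g x + c * h x) \<longrightarrow> (AE \<omega> in P. W t f \<omega> = a * W t g \<omega> + c * W t h \<omega>)) \<and>
     (\<forall>e. orthonormal N e \<longrightarrow>
        prob_space.indep_vars P (\<lambda>_. PiM {0..} (\<lambda>_. borel)) (\<lambda>k \<omega>. \<lambda>t\<in>{0..}. W t (e k) \<omega>)
          (UNIV :: nat set))"


section \<open>Stochastic integrals of deterministic integrands\<close>

text \<open>
  Step functions \<open>\<Sum> c 1\<^bsub>(a, b]\<^esub>\<close> on \<open>[0, t]\<close> are lists of triples \<open>(a, b, c)\<close>.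
  \<open>has_wiener_integral P B t f Y\<close> says that \<open>Y = \<integral>\<^sub>0\<^sup>t f(s) dB(s)\<close> almost surely: \<open>Y\<close> is the limit in
  \<open>L\<^sup>2(P)\<close> of the integrals of step functions converging to \<open>f\<close> in \<open>L\<^sup>2([0, t])\<close>.
\<close>

definition step_fun :: "(real \<times> real \<times> real) list \<Rightarrow> real \<Rightarrow> real" where
  "step_fun xs s = (\<Sum>(a, b, c) \<leftarrow> xs. if s \<in> {a<..b} then c else 0)"

definition step_integral ::
    "(real \<Rightarrow> 'w \<Rightarrow> real) \<Rightarrow> (real \<times> real \<times> real) list \<Rightarrow> 'w \<Rightarrow> real" where
  "step_integral B xs \<omega> = (\<Sum>(a, b, c) \<leftarrow> xs. c * (B b \<omega> - B a \<omega>))"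

definition has_wiener_integral ::
    "'w measure \<Rightarrow> (real \<Rightarrow> 'w \<Rightarrow> real) \<Rightarrow> real \<Rightarrow> (real \<Rightarrow> real) \<Rightarrow> ('w \<Rightarrow> real) \<Rightarrow> bool" where
  "has_wiener_integral P B t f Y \<longleftrightarrow>
     (\<exists>xs. (\<forall>n. \<forall>(a, b, c)\<in>set (xs n). 0 \<le> a \<and> a \<le> b \<and> b \<le> t) \<and>
        (\<lambda>n. \<integral>\<^sup>+s\<in>{0..t}. ennreal ((step_fun (xs n) s - f s)\<^sup>2) \<partial>lborel) \<longlonglongrightarrow> 0 \<and>
        l2_tendsto P (\<lambda>n. step_integral B (xs n)) Y)"

text \<open>
  The Hilbert space analogue. An elementary operator-valued integrand is a sum of terms
  \<open>1\<^bsub>(a, b]\<^esub> (g \<otimes> h)\<close>, where \<open>g \<otimes> h\<close> is the rank one operator \<open>f \<mapsto> \<langle>g, f\<rangle> h\<close>, whose integral against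
  \<open>W\<close> is \<open>(W b g - W a g) h\<close>. Finite rank operators are dense in the Hilbert--Schmidt operators, so
  these integrands are dense in \<open>L\<^sup>2\<close> of \<open>[0, t]\<close> with values in the Hilbert--Schmidt operators. The
  Hilbert--Schmidt norm does not depend on the orthonormal basis \<open>e\<close>.
\<close>

definition elem_op ::
    "'a measure \<Rightarrow> (real \<times> real \<times> ('a \<Rightarrow> real) \<times> ('a \<Rightarrow> real)) list \<Rightarrow> real
      \<Rightarrow> ('a \<Rightarrow> real) \<Rightarrow> ('a \<Rightarrow> real)" where
  "elem_op N xs s f x = (\<Sum>(a, b, g, h) \<leftarrow> xs. if s \<in> {a<..b} then l2_inner N g f * h x else 0)"

definition elem_integral ::
    "(real \<Rightarrow> ('a \<Rightarrow> real) \<Rightarrow> 'w \<Rightarrow> real) \<Rightarrow> (real \<times> real \<times> ('a \<Rightarrow> real) \<times> ('a \<Rightarrow> real)) list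
      \<Rightarrow> 'w \<Rightarrow> 'a \<Rightarrow> real" where
  "elem_integral W xs \<omega> x = (\<Sum>(a, b, g, h) \<leftarrow> xs. (W b g \<omega> - W a g \<omega>) * h x)"

definition hs_norm_sq ::
    "'a measure \<Rightarrow> (nat \<Rightarrow> 'a \<Rightarrow> real) \<Rightarrow> (('a \<Rightarrow> real) \<Rightarrow> ('a \<Rightarrow> real)) \<Rightarrow> ennreal" where
  "hs_norm_sq N e T = (\<Sum>k. l2_sq N (T (e k)))"

definition has_stochastic_integral ::
    "'w measure \<Rightarrow> 'a measure \<Rightarrow> (nat \<Rightarrow> 'a \<Rightarrow> real) \<Rightarrow> (real \<Rightarrow> ('a \<Rightarrow> real) \<Rightarrow> 'w \<Rightarrow> real)
      \<Rightarrow> real \<Rightarrow> (real \<Rightarrow> ('a \<Rightarrow> real) \<Rightarrow> ('a \<Rightarrow> real)) \<Rightarrow> ('w \<Rightarrow> 'a \<Rightarrow> real) \<Rightarrow> bool" where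
  "has_stochastic_integral P N e W t \<Phi> U \<longleftrightarrow>
     U \<in> measurable P (l2_borel N) \<and>
     (\<exists>xs. (\<forall>n. \<forall>(a, b, g, h)\<in>set (xs n). 0 \<le> a \<and> a \<le> b \<and> b \<le> t \<and> g \<in> L2 N \<and> h \<in> L2 N) \<and>
        (\<lambda>n. \<integral>\<^sup>+s\<in>{0..t}. hs_norm_sq N e (\<lambda>f x. elem_op N (xs n) s f x - \<Phi> s f x) \<partial>lborel) \<longlonglongrightarrow> 0 \<and>
        (\<lambda>n. \<integral>\<^sup>+\<omega>. l2_sq N (\<lambda>x. elem_integral W (xs n) \<omega> x - U \<omega> x) \<partial>P) \<longlonglongrightarrow> 0)"


section \<open>The mild solution\<close>

definition predictable_sigma :: "'w measure \<Rightarrow> (real \<Rightarrow> 'w measure) \<Rightarrow> (real \<times> 'w) measure" where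
  "predictable_sigma P Ft =
     sigma ({0..} \<times> space P)
       ({{0} \<times> E | E. E \<in> sets (Ft 0)} \<union>
        {{s<..t} \<times> E | s t E. 0 \<le> s \<and> s \<le> t \<and> E \<in> sets (Ft s)})"

text \<open>
  The mild solution with initial value \<open>0\<close> of \<open>du = L u dt + (1 - L)\<^bsup>-\<alpha>/2\<^esup> dW\<close>, where \<open>- L\<close> has the
  eigenbasis \<open>\<phi>\<close> with eigenvalues \<open>lam\<close>.
\<close>

definition mild_solution ::
    "'w measure \<Rightarrow> (real \<Rightarrow> 'w measure) \<Rightarrow> 'a measure \<Rightarrow> (nat \<Rightarrow> 'a \<Rightarrow> real) \<Rightarrow> (nat \<Rightarrow> real)
      \<Rightarrow> real \<Rightarrow> (real \<Rightarrow> ('a \<Rightarrow> real) \<Rightarrow> 'w \<Rightarrow> real) \<Rightarrow> (real \<Rightarrow> 'w \<Rightarrow> 'a \<Rightarrow> real) \<Rightarrow> bool" where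
  "mild_solution P Ft N \<phi> lam \<alpha> W u \<longleftrightarrow>
     (\<lambda>(t, \<omega>). u t \<omega>) \<in> measurable (predictable_sigma P Ft) (l2_borel N) \<and>
     (\<forall>t\<ge>0. has_stochastic_integral P N \<phi> W t
        (\<lambda>s. semigroup_op N \<phi> lam (t - s) \<circ> bessel_op N \<phi> lam \<alpha>) (u t))"


text \<open>
  \<open>Y\<close> is a version of \<open>u(t, x) = \<Sum>\<^sub>k (1 + \<lambda>\<^sub>k)\<^bsup>-\<alpha>/2\<^esup> X\<^sup>k\<^sub>t \<phi>\<^sub>k(x)\<close>, the series converging in \<open>L\<^sup>2(P)\<close>.
\<close>

definition is_point_value ::
    "'w measure \<Rightarrow> (nat \<Rightarrow> 'a \<Rightarrow> real) \<Rightarrow> (nat \<Rightarrow> real) \<Rightarrow> real \<Rightarrow> (nat \<Rightarrow> real \<Rightarrow> 'w \<Rightarrow> real)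
      \<Rightarrow> real \<Rightarrow> 'a \<Rightarrow> ('w \<Rightarrow> real) \<Rightarrow> bool" where
  "is_point_value P \<phi> lam \<alpha> X t x Y \<longleftrightarrow>
     l2_sums P (\<lambda>k \<omega>. (1 + lam k) powr (- \<alpha> / 2) * X k t \<omega> * \<phi> k x) Y"


section \<open>Approximations of the point evaluations\<close>

definition cut_words :: "nat \<Rightarrow> (nat \<Rightarrow> real) \<Rightarrow> nat \<Rightarrow> nat list set" where
  "cut_words M r n =
     (if n = 0 then {[]}
      else {w \<in> all_words M. w \<noteq> [] \<and> word_ratio r (butlast w) > 2 powr (- real n) \<and>
                             2 powr (- real n) \<ge> word_ratio r w})"

definition cell_nbhd ::
    "nat \<Rightarrow> 'a set \<Rightarrow> (nat \<Rightarrow> 'a \<Rightarrow> 'a) \<Rightarrow> (nat \<Rightarrow> real) \<Rightarrow> nat \<Rightarrow> 'a \<Rightarrow> 'a set" where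
  "cell_nbhd M F \<psi> r n x = \<Union> {cell F \<psi> w | w. w \<in> cut_words M r n \<and> x \<in> cell F \<psi> w}"

definition approx_delta ::
    "nat \<Rightarrow> 'a set \<Rightarrow> (nat \<Rightarrow> 'a \<Rightarrow> 'a) \<Rightarrow> (nat \<Rightarrow> real) \<Rightarrow> 'a measure \<Rightarrow> nat \<Rightarrow> 'a \<Rightarrow> 'a \<Rightarrow> real" where
  "approx_delta M F \<psi> r \<mu> n x y =
     inverse (measure \<mu> (cell_nbhd M F \<psi> r n x)) * indicator (cell_nbhd M F \<psi> r n x) y"

end

theory Submission
  imports Defs
begin
text \<open>
  Both claims reduce to one inequality for the eigenfunctions. The series for \<open>u(t, x)\<close> and the pairing
  \<open>\<langle>u(t), f\<rangle>\<close> are Wiener integrals of the integrands with coordinates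
  \<open>a\<^sub>k \<phi>\<^sub>k(x) exp (- \<lambda>\<^sub>k (t - s))\<close> and \<open>a\<^sub>k \<langle>\<phi>\<^sub>k, f\<rangle> exp (- \<lambda>\<^sub>k (t - s))\<close>, where
  \<open>a\<^sub>k = (1 + \<lambda>\<^sub>k)\<^bsup>-\<alpha>/2\<^esup> \<le> 1\<close>. By the Ito isometry the second moment of a linear combination of them is
  \<open>\<Sum> a\<^sub>k\<^sup>2 b\<^sub>k\<^sup>2 \<integral>\<^sub>0\<^sup>t exp (- 2 \<lambda>\<^sub>k (t - s)) ds\<close>, where \<open>b\<^sub>k\<close> is the value at \<open>\<phi>\<^sub>k\<close> of the corresponding linear
  functional, and this is at most \<open>exp (2 t) / 2 * \<Sum> b\<^sub>k\<^sup>2 / (1 + \<lambda>\<^sub>k)\<close> (\<open>variance_bound\<close>).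

  The last sum is the squared norm of the functional \<open>b\<close> in the dual of the form domain, whose squared norm
  is \<open>\<E> + \<parallel>\<cdot>\<parallel>\<^sup>2\<close>. So it is bounded by \<open>C\<close> as soon as \<open>b(g)\<^sup>2 \<le> C (\<E>(g, g) + \<parallel>g\<parallel>\<^sup>2)\<close> on finite combinations of
  eigenfunctions; testing with \<open>g = \<Sum> b\<^sub>k / (1 + \<lambda>\<^sub>k) \<phi>\<^sub>k\<close> shows this
  (\<open>eigenbasis_coefficient_bound\<close>). For point evaluation the constant is uniform in \<open>x\<close>, and for the
  functional \<open>g \<mapsto> \<langle>g, f\<^sub>n\<^sup>x\<rangle> - g(x)\<close> it is a multiple of \<open>2\<^sup>-\<^sup>n\<close> (\<open>point_bound\<close>, \<open>average_bound\<close>).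
  Both rest on the bound \<open>sqrt (C r\<^sub>w \<E>(g, g))\<close> for the oscillation of \<open>g\<close> on a cell \<open>F\<^sub>w\<close>
  (\<open>cell_oscillation\<close>). By self-similarity it reduces to the case of \<open>F\<close> itself (\<open>oscillation\<close>), which is
  obtained by chaining: vertices of level \<open>0\<close> are joined by edges of positive conductance, because the kernel of \<open>A\<close>
  consists of constants; cells of level \<open>1\<close> are joined because \<open>F\<close> is connected and cells meet in vertices
  only; and a point is reached along its code at a summable cost, because all \<open>r\<^sub>i < 1\<close>.

  On the probabilistic side, the relation \<open>represents\<close> links integrands and integrals. It starts from step
  functions with values in \<open>L\<^sup>2(\<mu>)\<close>, whose integrals are Gaussian with the right variance since the
  increments of \<open>W\<close> are independent of the past (\<open>stopped_wiener_gaussian\<close>), and it is closed under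
  linear combinations and \<open>L\<^sup>2\<close> limits. Parseval's identity makes the space of integrands an \<open>L\<^sup>2\<close> space of
  coordinates, in which the integrals \<open>X\<^sup>k\<^sub>t\<close>, the partial sums of the series and the pairings
  \<open>\<langle>u(t), f\<rangle>\<close> can be compared.
\<close>

section \<open>Square-integrable functions as a Hilbert space\<close>

lemma L2_iff: "f \<in> L2 N \<longleftrightarrow> f \<in> borel_measurable N \<and> integrable N (\<lambda>x. (f x)\<^sup>2)"
  unfolding L2_def l2_sq_def integrable_iff_bounded by auto

lemma L2_measurable: "f \<in> L2 N \<Longrightarrow> f \<in> borel_measurable N"
  by (simp add: L2_iff)

lemma L2_integrable_mult:
  assumes "f \<in> L2 N" "g \<in> L2 N"
  shows "integrable N (\<lambda>x. f x * g x)"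
proof (rule Bochner_Integration.integrable_bound)
  show "integrable N (\<lambda>x. (f x)\<^sup>2 + (g x)\<^sup>2)"
    using assms by (auto simp: L2_iff)
  show "(\<lambda>x. f x * g x) \<in> borel_measurable N"
    using assms by (auto simp: L2_iff)
  have "norm (f x * g x) \<le> norm ((f x)\<^sup>2 + (g x)\<^sup>2)" for x
  proof -
    have "0 \<le> (\<bar>f x\<bar> - \<bar>g x\<bar>)\<^sup>2" by simp
    then have "2 * (\<bar>f x\<bar> * \<bar>g x\<bar>) \<le> (f x)\<^sup>2 + (g x)\<^sup>2"
      by (simp add: power2_diff)
    moreover have "0 \<le> \<bar>f x\<bar> * \<bar>g x\<bar>" by simp
    ultimately show ?thesis unfolding real_norm_def abs_mult by linarith
  qed
  then show "AE x in N. norm (f x * g x) \<le> norm ((f x)\<^sup>2 + (g x)\<^sup>2)" by simp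
qed

lemma L2_cmult: "f \<in> L2 N \<Longrightarrow> (\<lambda>x. c * f x) \<in> L2 N"
  by (auto simp: L2_iff power_mult_distrib)

lemma L2_add:
  assumes "f \<in> L2 N" "g \<in> L2 N"
  shows "(\<lambda>x. f x + g x) \<in> L2 N"
proof -
  have "integrable N (\<lambda>x. (f x)\<^sup>2 + 2 * (f x * g x) + (g x)\<^sup>2)"
    using assms L2_integrable_mult[OF assms] by (auto simp: L2_iff)
  then show ?thesis using assms by (auto simp: L2_iff power2_sum algebra_simps)
qed

lemma L2_diff: "f \<in> L2 N \<Longrightarrow> g \<in> L2 N \<Longrightarrow> (\<lambda>x. f x - g x) \<in> L2 N"
  using L2_add[of f N "\<lambda>x. -1 * g x"] L2_cmult[of g N "-1"] by simp

lemma L2_zero: "(\<lambda>x. 0) \<in> L2 N"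
  by (simp add: L2_iff)

lemma L2_sum: "(\<And>i. i \<in> I \<Longrightarrow> f i \<in> L2 N) \<Longrightarrow> (\<lambda>x. \<Sum>i\<in>I. f i x) \<in> L2 N"
  by (induction I rule: infinite_finite_induct) (simp_all add: L2_zero L2_add)

abbreviation l2_dist_sq :: "'a measure \<Rightarrow> ('a \<Rightarrow> real) \<Rightarrow> ('a \<Rightarrow> real) \<Rightarrow> real" where
  "l2_dist_sq N f g \<equiv> l2_inner N (\<lambda>x. f x - g x) (\<lambda>x. f x - g x)"

lemma L2_cong_AE:
  assumes "f \<in> L2 N" "g \<in> borel_measurable N" "AE x in N. f x = g x"
  shows "g \<in> L2 N"
proof -
  have "integrable N (\<lambda>x. (g x)\<^sup>2) \<longleftrightarrow> integrable N (\<lambda>x. (f x)\<^sup>2)"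
    using assms by (intro integrable_cong_AE) (auto simp: L2_iff)
  then show ?thesis using assms by (simp add: L2_iff)
qed

lemma l2_inner_nonneg: "0 \<le> l2_inner N f f"
  by (simp add: l2_inner_def)

lemma l2_inner_commute: "l2_inner N f g = l2_inner N g f"
  by (simp add: l2_inner_def mult.commute)

lemma l2_inner_cong_AE:
  "AE x in N. f x = f' x \<Longrightarrow> f \<in> borel_measurable N \<Longrightarrow> f' \<in> borel_measurable N \<Longrightarrow>
   g \<in> borel_measurable N \<Longrightarrow> l2_inner N f g = l2_inner N f' g"
  unfolding l2_inner_def by (intro integral_cong_AE) auto

lemma l2_sq_eq: "f \<in> L2 N \<Longrightarrow> l2_sq N f = ennreal (l2_inner N f f)"
  unfolding l2_sq_def l2_inner_def
  by (subst nn_integral_eq_integral) (auto simp: L2_iff power2_eq_square)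

lemma l2_inner_cmult_left: "l2_inner N (\<lambda>x. c * f x) g = c * l2_inner N f g"
  by (simp add: l2_inner_def mult.assoc)

lemma l2_inner_add_left:
  "f \<in> L2 N \<Longrightarrow> g \<in> L2 N \<Longrightarrow> h \<in> L2 N \<Longrightarrow>
   l2_inner N (\<lambda>x. f x + g x) h = l2_inner N f h + l2_inner N g h"
  unfolding l2_inner_def
  by (subst Bochner_Integration.integral_add[symmetric])
     (auto simp: L2_integrable_mult distrib_right)

lemma l2_inner_diff_left:
  "f \<in> L2 N \<Longrightarrow> g \<in> L2 N \<Longrightarrow> h \<in> L2 N \<Longrightarrow>
   l2_inner N (\<lambda>x. f x - g x) h = l2_inner N f h - l2_inner N g h"
  unfolding l2_inner_def
  by (subst Bochner_Integration.integral_diff[symmetric])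
     (auto simp: L2_integrable_mult left_diff_distrib)

lemma l2_inner_sum_left:
  "(\<And>i. i \<in> I \<Longrightarrow> f i \<in> L2 N) \<Longrightarrow> h \<in> L2 N \<Longrightarrow>
   l2_inner N (\<lambda>x. \<Sum>i\<in>I. f i x) h = (\<Sum>i\<in>I. l2_inner N (f i) h)"
proof (induction I rule: infinite_finite_induct)
  case (insert i I)
  then show ?case using l2_inner_add_left[of "f i" N "\<lambda>x. \<Sum>i\<in>I. f i x" h] by (simp add: L2_sum)
qed (simp_all add: l2_inner_def)

lemma l2_inner_cmult_right: "l2_inner N g (\<lambda>x. c * f x) = c * l2_inner N g f"
  by (subst (1 2) l2_inner_commute) (rule l2_inner_cmult_left)

lemma l2_inner_diff_right:
  "f \<in> L2 N \<Longrightarrow> g \<in> L2 N \<Longrightarrow> h \<in> L2 N \<Longrightarrow>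
   l2_inner N h (\<lambda>x. f x - g x) = l2_inner N h f - l2_inner N h g"
  by (subst (1 2 3) l2_inner_commute) (rule l2_inner_diff_left)

lemma l2_inner_sum_right:
  "(\<And>i. i \<in> I \<Longrightarrow> f i \<in> L2 N) \<Longrightarrow> h \<in> L2 N \<Longrightarrow>
   l2_inner N h (\<lambda>x. \<Sum>i\<in>I. f i x) = (\<Sum>i\<in>I. l2_inner N h (f i))"
  by (subst (1 2) l2_inner_commute) (rule l2_inner_sum_left)

lemma l2_Cauchy_Schwarz:
  assumes f: "f \<in> L2 N" and g: "g \<in> L2 N"
  shows "(l2_inner N f g)\<^sup>2 \<le> l2_inner N f f * l2_inner N g g"
proof -
  let ?B = "l2_inner N f g" and ?G = "l2_inner N g g" and ?F = "l2_inner N f f"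
  have quad: "0 \<le> p\<^sup>2 * ?F - 2 * p * q * ?B + q\<^sup>2 * ?G" for p q
  proof -
    have "0 \<le> l2_inner N (\<lambda>x. p * f x - q * g x) (\<lambda>x. p * f x - q * g x)"
      by (rule l2_inner_nonneg)
    also have "\<dots> = p * (p * ?F) - p * (q * ?B) - (q * (p * l2_inner N g f) - q * (q * ?G))"
      by (simp only: l2_inner_diff_left l2_inner_diff_right L2_cmult L2_diff f g
          l2_inner_cmult_left l2_inner_cmult_right right_diff_distrib)
    finally show ?thesis using l2_inner_commute[of N g f]
      by (simp add: power2_eq_square algebra_simps)
  qed
  show ?thesis
  proof (cases "?G = 0")
    case False
    then have "0 < ?G" using l2_inner_nonneg[of N g] by simp
    have "0 \<le> ?G * (?G * ?F - ?B\<^sup>2)"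
      using quad[of ?G ?B] by (simp add: power2_eq_square algebra_simps)
    then show ?thesis using \<open>0 < ?G\<close> by (simp add: zero_le_mult_iff mult.commute)
  next
    case True
    \<comment> \<open>The quadratic form is nonnegative in every direction, so a nonzero \<open>?B\<close> would make it negative far out.\<close>
    have "?B = 0"
    proof (rule ccontr)
      assume "?B \<noteq> 0"
      then show False
        using quad[of 1 "(?F + 1) / (2 * ?B)"] True l2_inner_nonneg[of N f]
        by (simp add: field_simps)
    qed
    then show ?thesis using True by simp
  qed
qed

text \<open>
  The parallelogram law replaces the triangle inequality, so that the squared distance \<open>l2_dist_sq\<close> can be
  used throughout instead of a norm.
\<close>

lemma l2_inner_diff_self_le:
  assumes "f \<in> L2 N" "g \<in> L2 N" "h \<in> L2 N"
  shows "l2_dist_sq N f h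
    \<le> 2 * l2_dist_sq N f g + 2 * l2_dist_sq N g h"
proof -
  let ?a = "\<lambda>x. f x - g x" and ?b = "\<lambda>x. g x - h x"
  have ab: "?a \<in> L2 N" "?b \<in> L2 N" using assms by (auto intro: L2_diff)
  have "(f x - h x)\<^sup>2 \<le> 2 * (?a x)\<^sup>2 + 2 * (?b x)\<^sup>2" for x
  proof -
    have "0 \<le> (?a x - ?b x)\<^sup>2" by simp
    then show ?thesis by (simp add: power2_eq_square algebra_simps)
  qed
  moreover have "integrable N (\<lambda>x. 2 * (?a x)\<^sup>2 + 2 * (?b x)\<^sup>2)" "integrable N (\<lambda>x. (f x - h x)\<^sup>2)"
    using ab assms(1,3) L2_diff[of f N h] by (auto simp: L2_iff)
  ultimately have "(\<integral>x. (f x - h x)\<^sup>2 \<partial>N) \<le> (\<integral>x. 2 * (?a x)\<^sup>2 + 2 * (?b x)\<^sup>2 \<partial>N)"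
    by (intro integral_mono) auto
  also have "\<dots> = 2 * (\<integral>x. (?a x)\<^sup>2 \<partial>N) + 2 * (\<integral>x. (?b x)\<^sup>2 \<partial>N)"
    using ab by (subst Bochner_Integration.integral_add) (auto simp: L2_iff)
  finally show ?thesis by (simp add: l2_inner_def power2_eq_square)
qed

lemma l2_inner_self_eq_0:
  assumes "f \<in> L2 N" "l2_inner N f f = 0"
  shows "AE x in N. f x = 0"
proof -
  have "integrable N (\<lambda>x. (f x)\<^sup>2)" "(\<integral>x. (f x)\<^sup>2 \<partial>N) = 0"
    using assms by (auto simp: L2_iff l2_inner_def power2_eq_square)
  then have "AE x in N. (f x)\<^sup>2 = 0"
    by (subst (asm) integral_nonneg_eq_0_iff_AE) auto
  then show ?thesis by simp
qed

lemma l2_tendsto_iff: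
  "l2_tendsto N s f \<longleftrightarrow> f \<in> L2 N \<and> (\<forall>n. s n \<in> L2 N) \<and>
     (\<lambda>n. l2_dist_sq N (s n) f) \<longlonglongrightarrow> 0"
proof -
  have "(\<lambda>n. l2_sq N (\<lambda>x. s n x - f x)) \<longlonglongrightarrow> 0 \<longleftrightarrow>
        (\<lambda>n. l2_dist_sq N (s n) f) \<longlonglongrightarrow> 0"
    if "f \<in> L2 N" "\<forall>n. s n \<in> L2 N"
  proof -
    have "(\<lambda>n. l2_sq N (\<lambda>x. s n x - f x)) =
          (\<lambda>n. ennreal (l2_dist_sq N (s n) f))"
      using that by (intro ext l2_sq_eq L2_diff) auto
    then show ?thesis
      using tendsto_ennreal_iff[of "\<lambda>n. l2_dist_sq N (s n) f" sequentially 0]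
      by (simp add: l2_inner_nonneg)
  qed
  then show ?thesis unfolding l2_tendsto_def by auto
qed

text \<open>
  A measurable limit of square-integrable functions is square-integrable, being the difference of some
  \<open>s n\<close> and a function of finite norm.
\<close>

lemma l2_tendstoI:
  assumes s: "\<And>n. s n \<in> L2 N" and f: "f \<in> borel_measurable N"
    and lim: "(\<lambda>n. l2_sq N (\<lambda>x. s n x - f x)) \<longlonglongrightarrow> 0"
  shows "l2_tendsto N s f"
proof -
  have "eventually (\<lambda>n. l2_sq N (\<lambda>x. s n x - f x) < 1) sequentially"
    using lim by (rule order_tendstoD) simp
  then obtain n where "l2_sq N (\<lambda>x. s n x - f x) < 1" by (auto simp: eventually_sequentially)
  then have "l2_sq N (\<lambda>x. s n x - f x) < \<infinity>" by (rule order_less_trans) simp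
  then have "(\<lambda>x. s n x - f x) \<in> L2 N"
    using f s[THEN L2_measurable] by (simp add: L2_def)
  from L2_diff[OF s[of n] this] have "f \<in> L2 N" by simp
  then show ?thesis using s lim by (simp add: l2_tendsto_def)
qed

lemma l2_inner_tendsto_0:
  assumes "\<And>n. a n \<in> L2 N" "\<And>n. b n \<in> L2 N"
    and a: "(\<lambda>n. l2_inner N (a n) (a n)) \<longlonglongrightarrow> 0"
    and b: "(\<lambda>n. l2_inner N (b n) (b n)) \<longlonglongrightarrow> B"
  shows "(\<lambda>n. l2_inner N (a n) (b n)) \<longlonglongrightarrow> 0"
proof -
  have "(\<lambda>n. (l2_inner N (a n) (b n))\<^sup>2) \<longlonglongrightarrow> 0"
  proof (rule tendsto_sandwich[OF _ _ tendsto_const])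
    show "(\<lambda>n. l2_inner N (a n) (a n) * l2_inner N (b n) (b n)) \<longlonglongrightarrow> 0"
      using tendsto_mult[OF a b] by simp
  qed (auto intro!: always_eventually l2_Cauchy_Schwarz assms)
  then have "(\<lambda>n. sqrt ((l2_inner N (a n) (b n))\<^sup>2)) \<longlonglongrightarrow> sqrt 0"
    by (rule tendsto_real_sqrt)
  then show ?thesis by (simp add: tendsto_rabs_zero_iff)
qed

lemma l2_tendsto_inner:
  assumes s: "l2_tendsto N s f" and s': "l2_tendsto N s' g"
  shows "(\<lambda>n. l2_inner N (s n) (s' n)) \<longlonglongrightarrow> l2_inner N f g"
proof -
  let ?a = "\<lambda>n x. s n x - f x" and ?b = "\<lambda>n x. s' n x - g x"
  have m: "f \<in> L2 N" "g \<in> L2 N" "\<And>n. s n \<in> L2 N" "\<And>n. s' n \<in> L2 N"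
    using assms by (auto simp: l2_tendsto_iff)
  have a: "(\<lambda>n. l2_inner N (?a n) (?a n)) \<longlonglongrightarrow> 0" and b: "(\<lambda>n. l2_inner N (?b n) (?b n)) \<longlonglongrightarrow> 0"
    using assms by (auto simp: l2_tendsto_iff)
  have eq: "l2_inner N (s n) (s' n) =
      l2_inner N f g + l2_inner N (?a n) (?b n) + l2_inner N (?a n) g + l2_inner N (?b n) f" for n
    using m l2_inner_commute[of N f g] l2_inner_commute[of N "s' n" f]
    by (simp add: l2_inner_diff_left l2_inner_diff_right L2_diff)
  have "(\<lambda>n. l2_inner N f g + l2_inner N (?a n) (?b n) + l2_inner N (?a n) g + l2_inner N (?b n) f)
      \<longlonglongrightarrow> l2_inner N f g + 0 + 0 + 0"
    by (intro tendsto_add tendsto_const l2_inner_tendsto_0[OF _ _ a b]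
        l2_inner_tendsto_0[OF _ _ a tendsto_const] l2_inner_tendsto_0[OF _ _ b tendsto_const])
       (auto intro: L2_diff m)
  then show ?thesis unfolding eq by simp
qed

lemma l2_tendsto_const: "f \<in> L2 N \<Longrightarrow> l2_tendsto N (\<lambda>n. f) f"
  by (simp add: l2_tendsto_iff l2_inner_def)

lemma l2_tendsto_add:
  assumes s: "l2_tendsto N s f" and s': "l2_tendsto N s' g"
  shows "l2_tendsto N (\<lambda>n x. s n x + s' n x) (\<lambda>x. f x + g x)"
proof -
  let ?a = "\<lambda>n x. s n x - f x" and ?b = "\<lambda>n x. s' n x - g x"
  let ?c = "\<lambda>n x. s n x + s' n x - (f x + g x)"
  have m: "f \<in> L2 N" "g \<in> L2 N" "\<And>n. s n \<in> L2 N" "\<And>n. s' n \<in> L2 N"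
    using assms by (auto simp: l2_tendsto_iff)
  have a: "(\<lambda>n. l2_inner N (?a n) (?a n)) \<longlonglongrightarrow> 0" and b: "(\<lambda>n. l2_inner N (?b n) (?b n)) \<longlonglongrightarrow> 0"
    using assms by (auto simp: l2_tendsto_iff)
  have le: "l2_inner N (?c n) (?c n) \<le> 2 * l2_inner N (?a n) (?a n) + 2 * l2_inner N (?b n) (?b n)" for n
    using l2_inner_diff_self_le[of "?a n" N "\<lambda>x. 0" "\<lambda>x. - ?b n x"] L2_diff[OF m(3) m(1), of n]
      L2_cmult[OF L2_diff[OF m(4) m(2)], of "-1" n]
    by (simp add: L2_zero algebra_simps)
  have "(\<lambda>n. l2_inner N (?c n) (?c n)) \<longlonglongrightarrow> 0"
  proof (rule tendsto_sandwich[OF _ _ tendsto_const])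
    show "(\<lambda>n. 2 * l2_inner N (?a n) (?a n) + 2 * l2_inner N (?b n) (?b n)) \<longlonglongrightarrow> 0"
      using tendsto_add[OF tendsto_mult[OF tendsto_const[of 2] a] tendsto_mult[OF tendsto_const[of 2] b]] by simp
  qed (auto intro!: always_eventually l2_inner_nonneg le)
  then show ?thesis using m by (simp add: l2_tendsto_iff L2_add)
qed

lemma l2_tendsto_cmult:
  assumes s: "l2_tendsto N s f"
  shows "l2_tendsto N (\<lambda>n x. c * s n x) (\<lambda>x. c * f x)"
proof -
  have "l2_inner N (\<lambda>x. c * s n x - c * f x) (\<lambda>x. c * s n x - c * f x)
      = c * (c * l2_dist_sq N (s n) f)" for n
    by (simp add: right_diff_distrib[symmetric] l2_inner_cmult_left l2_inner_cmult_right)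
  moreover have "(\<lambda>n. c * (c * l2_dist_sq N (s n) f)) \<longlonglongrightarrow> c * (c * 0)"
    using s by (intro tendsto_intros) (auto simp: l2_tendsto_iff)
  ultimately show ?thesis using s by (simp add: l2_tendsto_iff L2_cmult)
qed

lemma l2_tendsto_diff:
  assumes "l2_tendsto N s f" "l2_tendsto N s' g"
  shows "l2_tendsto N (\<lambda>n x. s n x - s' n x) (\<lambda>x. f x - g x)"
  using l2_tendsto_add[OF assms(1) l2_tendsto_cmult[OF assms(2), of "-1"]] by simp

lemma l2_tendsto_unique:
  assumes "l2_tendsto N s f" "l2_tendsto N s g"
  shows "AE x in N. f x = g x"
proof -
  let ?d = "\<lambda>x. f x - g x"
  have d: "l2_tendsto N (\<lambda>n x. 0) ?d"
    using l2_tendsto_diff[OF assms] by simp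
  have "(\<lambda>n. l2_inner N (\<lambda>x. 0) (\<lambda>x. 0)) \<longlonglongrightarrow> l2_inner N ?d ?d"
    by (rule l2_tendsto_inner[OF d d])
  then have "l2_inner N ?d ?d = 0" by (simp add: l2_inner_def LIMSEQ_const_iff)
  then show ?thesis using l2_inner_self_eq_0[of ?d N] d by (simp add: l2_tendsto_iff)
qed

lemma (in prob_space) l1_le_l2:
  assumes "f \<in> L2 M"
  shows "integrable M f" "(\<integral>x. \<bar>f x\<bar> \<partial>M) \<le> sqrt (l2_inner M f f)"
proof -
  have one: "(\<lambda>x. 1) \<in> L2 M" by (simp add: L2_iff)
  show f: "integrable M f" using L2_integrable_mult[OF assms one] by simp
  have abs: "(\<lambda>x. \<bar>f x\<bar>) \<in> L2 M" using assms by (auto simp: L2_iff)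
  have "(l2_inner M (\<lambda>x. \<bar>f x\<bar>) (\<lambda>x. 1))\<^sup>2 \<le> l2_inner M f f * 1"
    using l2_Cauchy_Schwarz[OF abs one] by (simp add: l2_inner_def prob_space)
  then show "(\<integral>x. \<bar>f x\<bar> \<partial>M) \<le> sqrt (l2_inner M f f)"
    by (intro real_le_rsqrt) (simp add: l2_inner_def)
qed

text \<open>
  On a probability space a fast subsequence has summable increments in \<open>L\<^sup>1\<close>, hence converges almost
  everywhere; Fatou's lemma then bounds the \<open>L\<^sup>2\<close> distance of the whole sequence to that limit.
\<close>

theorem (in prob_space) Riesz_Fischer:
  assumes s: "\<And>n. s n \<in> L2 M"
    and Cauchy: "\<And>e. e > 0 \<Longrightarrow>
      \<exists>n0. \<forall>m\<ge>n0. \<forall>n\<ge>n0. l2_dist_sq M (s m) (s n) < e"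
  shows "\<exists>f. l2_tendsto M s f"
proof -
  let ?q = "\<lambda>m n. l2_dist_sq M (s m) (s n)"
  have sm[measurable]: "s n \<in> borel_measurable M" for n using s by (rule L2_measurable)
  \<comment> \<open>The square makes the increments of the subsequence at most \<open>(1/2)^k\<close> in \<open>L\<^sup>2\<close>.\<close>
  have "\<forall>k. \<exists>n0. \<forall>m\<ge>n0. \<forall>n\<ge>n0. ?q m n < ((1/2)^k)\<^sup>2"
    by (intro allI Cauchy) simp
  then obtain N where N: "\<And>k m n. m \<ge> N k \<Longrightarrow> n \<ge> N k \<Longrightarrow> ?q m n < ((1/2)^k)\<^sup>2"
    by metis
  define r where "r k = (\<Sum>i\<le>k. N i) + k" for k
  have r: "r k \<ge> N k" "r (Suc k) \<ge> r k" "r k \<ge> k" for k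
    by (auto simp: r_def lessThan_Suc_atMost[symmetric])
  define d where "d k x = s (r (Suc k)) x - s (r k) x" for k x
  have dL: "d k \<in> L2 M" for k unfolding d_def by (intro L2_diff s)
  have dm[measurable]: "d k \<in> borel_measurable M" for k using dL by (rule L2_measurable)
  have "(\<integral>x. \<bar>d k x\<bar> \<partial>M) \<le> (1/2)^k" for k
  proof -
    have "(\<integral>x. \<bar>d k x\<bar> \<partial>M) \<le> sqrt (?q (r (Suc k)) (r k))"
      using l1_le_l2(2)[OF dL[of k]] unfolding d_def by simp
    also have "\<dots> \<le> sqrt (((1/2)^k)\<^sup>2)"
      using N[of k "r (Suc k)" "r k"] r[of k] by (intro real_sqrt_le_mono) auto
    finally show ?thesis by simp
  qed
  then have "(\<integral>\<^sup>+x. ennreal \<bar>d k x\<bar> \<partial>M) \<le> ennreal ((1/2)^k)" for k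
    using l1_le_l2(1)[OF dL[of k]] by (subst nn_integral_eq_integral) (auto intro!: ennreal_leI)
  then have "(\<Sum>k. \<integral>\<^sup>+x. ennreal \<bar>d k x\<bar> \<partial>M) \<le> (\<Sum>k. ennreal ((1/2)^k))"
    by (intro suminf_le) auto
  also have "\<dots> < \<infinity>" by (subst suminf_ennreal2) (auto simp: summable_geometric)
  finally have "(\<integral>\<^sup>+x. (\<Sum>k. ennreal \<bar>d k x\<bar>) \<partial>M) \<noteq> \<infinity>"
    by (subst nn_integral_suminf) auto
  then have "AE x in M. (\<Sum>k. ennreal \<bar>d k x\<bar>) \<noteq> \<infinity>"
    by (intro nn_integral_noteq_infinite) auto
  then have conv: "AE x in M. convergent (\<lambda>k. s (r k) x)"
  proof eventually_elim
    case (elim x)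
    then have "summable (\<lambda>k. \<bar>d k x\<bar>)" by (intro summable_suminf_not_top) auto
    then have "summable (\<lambda>k. d k x)" by (rule summable_rabs_cancel)
    then have "convergent (\<lambda>n. \<Sum>k<n. d k x)" by (simp add: summable_iff_convergent)
    moreover have "(\<Sum>k<n. d k x) = s (r n) x - s (r 0) x" for n
      unfolding d_def by (rule sum_lessThan_telescope)
    ultimately have "convergent (\<lambda>n. s (r n) x - s (r 0) x)" by simp
    from convergent_add[OF this convergent_const[of "s (r 0) x"]] show ?case by simp
  qed
  define f where "f x = lim (\<lambda>k. s (r k) x)" for x
  have fm[measurable]: "f \<in> borel_measurable M" unfolding f_def by measurable
  have bound: "l2_sq M (\<lambda>x. s m x - f x) \<le> ennreal e"
    if m: "m \<ge> n0" and n0: "\<And>m n. m \<ge> n0 \<Longrightarrow> n \<ge> n0 \<Longrightarrow> ?q m n < e" for m e n0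
  proof -
    have "l2_sq M (\<lambda>x. s m x - f x) = (\<integral>\<^sup>+x. liminf (\<lambda>k. ennreal ((s m x - s (r k) x)\<^sup>2)) \<partial>M)"
      unfolding l2_sq_def
    proof (rule nn_integral_cong_AE)
      show "AE x in M. ennreal ((s m x - f x)\<^sup>2) = liminf (\<lambda>k. ennreal ((s m x - s (r k) x)\<^sup>2))"
        using conv
      proof eventually_elim
        case (elim x)
        then have "(\<lambda>k. s (r k) x) \<longlonglongrightarrow> f x" unfolding f_def by (simp add: convergent_LIMSEQ_iff)
        then have "(\<lambda>k. ennreal ((s m x - s (r k) x)\<^sup>2)) \<longlonglongrightarrow> ennreal ((s m x - f x)\<^sup>2)"
          by (intro tendsto_ennrealI tendsto_intros)
        then show ?case by (rule lim_imp_Liminf[symmetric, rotated]) simp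
      qed
    qed
    also have "\<dots> \<le> liminf (\<lambda>k. \<integral>\<^sup>+x. ennreal ((s m x - s (r k) x)\<^sup>2) \<partial>M)"
      by (intro nn_integral_liminf) measurable
    also have "\<dots> \<le> limsup (\<lambda>k. \<integral>\<^sup>+x. ennreal ((s m x - s (r k) x)\<^sup>2) \<partial>M)"
      by (rule Liminf_le_Limsup) simp
    also have "\<dots> \<le> ennreal e"
    proof (rule Limsup_bounded)
      show "eventually (\<lambda>k. (\<integral>\<^sup>+x. ennreal ((s m x - s (r k) x)\<^sup>2) \<partial>M) \<le> ennreal e) sequentially"
        using eventually_ge_at_top[of n0]
      proof eventually_elim
        case (elim k)
        have "(\<integral>\<^sup>+x. ennreal ((s m x - s (r k) x)\<^sup>2) \<partial>M) = ennreal (?q m (r k))"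
          using l2_sq_eq[OF L2_diff[OF s s], of m "r k"] by (simp add: l2_sq_def)
        also have "\<dots> \<le> ennreal e"
          using n0[of m "r k"] m elim r(3)[of k] by (intro ennreal_leI) auto
        finally show ?case .
      qed
    qed
    finally show ?thesis .
  qed
  have "(\<lambda>n. l2_sq M (\<lambda>x. s n x - f x)) \<longlonglongrightarrow> 0"
  proof (rule order_tendstoI)
    fix a :: ennreal assume "0 < a"
    have "\<exists>e>0. ennreal e < a"
    proof (cases a)
      case (real c)
      then show ?thesis using \<open>0 < a\<close>
        by (intro exI[of _ "c / 2"]) (auto simp: ennreal_less_iff)
    next
      case top
      then show ?thesis by (intro exI[of _ 1]) simp
    qed
    then obtain e where e: "0 < e" "ennreal e < a" by blast
    obtain n0 where "\<forall>m\<ge>n0. \<forall>n\<ge>n0. ?q m n < e" using Cauchy[OF e(1)] by blast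
    then have "l2_sq M (\<lambda>x. s m x - f x) \<le> ennreal e" if "m \<ge> n0" for m
      using bound[OF that] by blast
    then show "eventually (\<lambda>n. l2_sq M (\<lambda>x. s n x - f x) < a) sequentially"
      using e(2) unfolding eventually_sequentially by (meson order_le_less_trans)
  qed simp
  then have "l2_tendsto M s f" by (intro l2_tendstoI s fm)
  then show ?thesis by blast
qed

lemma L2_orthonormal: "orthonormal N e \<Longrightarrow> e k \<in> L2 N"
  by (simp add: orthonormal_def)

lemma l2_inner_orthonormal_sum:
  assumes e: "orthonormal N e" and "finite I" "finite J"
  shows "l2_inner N (\<lambda>x. \<Sum>i\<in>I. c i * e i x) (\<lambda>x. \<Sum>j\<in>J. d j * e j x) = (\<Sum>i\<in>I \<inter> J. c i * d i)"
proof -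
  have eL: "e k \<in> L2 N" for k using e by (rule L2_orthonormal)
  have "l2_inner N (\<lambda>x. \<Sum>i\<in>I. c i * e i x) (\<lambda>x. \<Sum>j\<in>J. d j * e j x)
      = (\<Sum>i\<in>I. \<Sum>j\<in>J. c i * (d j * l2_inner N (e i) (e j)))"
    using eL by (simp add: l2_inner_sum_left l2_inner_sum_right L2_sum L2_cmult
        l2_inner_cmult_left l2_inner_cmult_right sum_distrib_left)
  also have "\<dots> = (\<Sum>i\<in>I. \<Sum>j\<in>J. if j = i then c i * d j else 0)"
    using e by (intro sum.cong refl) (auto simp: orthonormal_def)
  also have "\<dots> = (\<Sum>i\<in>I. if i \<in> J then c i * d i else 0)"
    using \<open>finite J\<close> by (simp add: sum.delta')
  also have "\<dots> = (\<Sum>i\<in>I \<inter> J. c i * d i)"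
    using \<open>finite I\<close> by (simp add: sum.inter_restrict)
  finally show ?thesis .
qed

lemma l2_inner_orthonormal_coeff:
  assumes e: "orthonormal N e" and "finite I"
  shows "l2_inner N (\<lambda>x. \<Sum>i\<in>I. c i * e i x) (e j) = (if j \<in> I then c j else 0)"
  using l2_inner_orthonormal_sum[OF e \<open>finite I\<close>, of "{j}" c "\<lambda>_. 1"] by (simp add: Int_insert_right)

lemma l2_inner_expansion_residual:
  assumes e: "orthonormal N e" and f: "f \<in> L2 N" and "finite I"
  defines "r \<equiv> (\<lambda>x. f x - (\<Sum>i\<in>I. l2_inner N f (e i) * e i x))"
  shows "l2_inner N r r = l2_inner N f f - (\<Sum>i\<in>I. (l2_inner N f (e i))\<^sup>2)"
proof -
  let ?p = "\<lambda>x. \<Sum>i\<in>I. l2_inner N f (e i) * e i x"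
  have eL: "e k \<in> L2 N" for k using e by (rule L2_orthonormal)
  have pL: "?p \<in> L2 N" by (intro L2_sum L2_cmult eL)
  have pf: "l2_inner N ?p f = (\<Sum>i\<in>I. (l2_inner N f (e i))\<^sup>2)"
    by (simp add: l2_inner_sum_left L2_cmult eL f l2_inner_cmult_left power2_eq_square)
       (simp add: l2_inner_commute)
  have pp: "l2_inner N ?p ?p = (\<Sum>i\<in>I. (l2_inner N f (e i))\<^sup>2)"
    using l2_inner_orthonormal_sum[OF e \<open>finite I\<close> \<open>finite I\<close>] by (simp add: power2_eq_square)
  show ?thesis unfolding r_def
    using pf pp l2_inner_commute[of N f ?p]
    by (simp only: l2_inner_diff_left l2_inner_diff_right f pL L2_diff)
qed

lemma Bessel:
  assumes e: "orthonormal N e" and f: "f \<in> L2 N"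
  shows "summable (\<lambda>i. (l2_inner N f (e i))\<^sup>2)" "(\<Sum>i. (l2_inner N f (e i))\<^sup>2) \<le> l2_inner N f f"
proof -
  have le: "(\<Sum>i<n. (l2_inner N f (e i))\<^sup>2) \<le> l2_inner N f f" for n
    using l2_inner_expansion_residual[OF e f, of "{..<n}"]
      l2_inner_nonneg[of N "\<lambda>x. f x - (\<Sum>i<n. l2_inner N f (e i) * e i x)"] by simp
  then show s: "summable (\<lambda>i. (l2_inner N f (e i))\<^sup>2)"
    by (intro summableI_nonneg_bounded[where x="l2_inner N f f"]) auto
  show "(\<Sum>i. (l2_inner N f (e i))\<^sup>2) \<le> l2_inner N f f"
    by (intro suminf_le_const s le)
qed

text \<open>
  Completeness of the system is only given as triviality of its orthogonal complement. By Bessel's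
  inequality and the theorem of Riesz and Fischer the expansion of \<open>f\<close> has a limit \<open>g\<close>, and \<open>f - g\<close> is
  orthogonal to every \<open>e k\<close>.
\<close>

theorem (in prob_space) Parseval:
  assumes e: "complete_orthonormal M e" and f: "f \<in> L2 M"
  shows "(\<lambda>i. (l2_inner M f (e i))\<^sup>2) sums l2_inner M f f"
proof -
  have o: "orthonormal M e" using e by (simp add: complete_orthonormal_def)
  have eL: "e k \<in> L2 M" for k using o by (rule L2_orthonormal)
  let ?c = "\<lambda>i. l2_inner M f (e i)"
  define s where "s n x = (\<Sum>i<n. ?c i * e i x)" for n x
  have sL: "s n \<in> L2 M" for n unfolding s_def by (intro L2_sum L2_cmult eL)
  have diff: "l2_dist_sq M (s m) (s n) = (\<Sum>i\<in>{n..<m}. (?c i)\<^sup>2)"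
    if "n \<le> m" for m n
  proof -
    have "s m x - s n x = (\<Sum>i\<in>{n..<m}. ?c i * e i x)" for x
      unfolding s_def using sum.atLeastLessThan_concat[of 0 n m "\<lambda>i. ?c i * e i x"] that
      by (simp add: atLeast0LessThan)
    then show ?thesis
      using l2_inner_orthonormal_sum[OF o, of "{n..<m}" "{n..<m}" ?c ?c] by (simp add: power2_eq_square)
  qed
  have "\<exists>g. l2_tendsto M s g"
  proof (rule Riesz_Fischer[OF sL])
    fix r :: real assume "r > 0"
    then obtain n0 where n0: "\<And>m n. m \<ge> n0 \<Longrightarrow> norm (\<Sum>i\<in>{m..<n}. (?c i)\<^sup>2) < r"
      using Bessel(1)[OF o f] unfolding summable_Cauchy by blast
    have "l2_dist_sq M (s m) (s n) < r" if "m \<ge> n0" "n \<ge> n0" for m n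
    proof (cases "n \<le> m")
      case True
      then show ?thesis using diff[OF True] n0[OF that(2), of m] by simp
    next
      case False
      have "l2_dist_sq M (s m) (s n)
          = l2_dist_sq M (s n) (s m)"
        unfolding l2_inner_def by (intro Bochner_Integration.integral_cong refl) (simp add: algebra_simps)
      then show ?thesis using False diff[of m n] n0[OF that(1), of n] by simp
    qed
    then show "\<exists>n0. \<forall>m\<ge>n0. \<forall>n\<ge>n0. l2_dist_sq M (s m) (s n) < r"
      by blast
  qed
  then obtain g where g: "l2_tendsto M s g" by blast
  have gL: "g \<in> L2 M" using g by (simp add: l2_tendsto_iff)
  have "l2_inner M g (e k) = ?c k" for k
  proof (rule LIMSEQ_unique[OF l2_tendsto_inner[OF g l2_tendsto_const[OF eL]]])
    show "(\<lambda>n. l2_inner M (s n) (e k)) \<longlonglongrightarrow> ?c k"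
    proof (rule tendsto_eventually)
      show "eventually (\<lambda>n. l2_inner M (s n) (e k) = ?c k) sequentially"
        using eventually_gt_at_top[of k]
      proof eventually_elim
        case (elim n)
        then show ?case unfolding s_def
          using l2_inner_orthonormal_coeff[OF o, of "{..<n}" ?c k] by simp
      qed
    qed
  qed
  then have "\<forall>k. l2_inner M (\<lambda>x. f x - g x) (e k) = 0"
    by (simp add: l2_inner_diff_left f gL eL)
  then have ae: "AE x in M. f x - g x = 0"
    using e L2_diff[OF f gL] unfolding complete_orthonormal_def by blast
  have "l2_inner M (\<lambda>x. s n x) (\<lambda>x. s n x) = (\<Sum>i<n. (?c i)\<^sup>2)" for n
    unfolding s_def using l2_inner_orthonormal_sum[OF o, of "{..<n}" "{..<n}" ?c ?c]
    by (simp add: power2_eq_square)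
  then have "(\<lambda>n. \<Sum>i<n. (?c i)\<^sup>2) \<longlonglongrightarrow> l2_inner M g g"
    using l2_tendsto_inner[OF g g] by simp
  moreover have "l2_inner M g g = l2_inner M f f"
    unfolding l2_inner_def using ae f gL by (intro integral_cong_AE) (auto simp: L2_iff)
  ultimately show ?thesis by (simp add: sums_def)
qed

section \<open>Centred Gaussian variables\<close>

context prob_space
begin

lemma char_distr_eq:
  assumes "Y \<in> borel_measurable M"
  shows "char (distr M borel Y) u = (CLINT \<omega>|M. iexp (u * Y \<omega>))"
  using assms by (simp add: char_def integral_distr)

lemma char_centred_gaussian:
  assumes "centred_gaussian_var M v Y"
  shows "char (distr M borel Y) u = of_real (exp (- (v * u\<^sup>2 / 2)))"
proof (cases "v = 0")
  case True
  have Y: "Y \<in> borel_measurable M" "AE \<omega> in M. Y \<omega> = 0"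
    using assms True by (auto simp: centred_gaussian_var_def)
  then have "(CLINT \<omega>|M. iexp (u * Y \<omega>)) = (CLINT \<omega>|M. 1)"
    by (intro integral_cong_AE) auto
  then show ?thesis using Y True by (simp add: char_distr_eq prob_space)
next
  case False
  then have v: "v > 0" "Y \<in> borel_measurable M"
    and D: "distributed M lborel Y (normal_density 0 (sqrt v))"
    using assms by (auto simp: centred_gaussian_var_def)
  let ?Z = "\<lambda>\<omega>. (Y \<omega> - 0) / sqrt v"
  have Z: "distributed M lborel ?Z std_normal_density"
    using D normal_standard_normal_convert[of "sqrt v" Y 0] v by simp
  have "char (distr M borel Y) u = (CLINT \<omega>|M. iexp ((u * sqrt v) * ?Z \<omega>))"
    using v by (simp add: char_distr_eq)
  also have "\<dots> = char (distr M borel ?Z) (u * sqrt v)"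
    using v by (subst char_distr_eq) auto
  also have "distr M borel ?Z = distr M lborel ?Z"
    by (intro distr_cong) auto
  also have "\<dots> = std_normal_distribution"
    using distributed_distr_eq_density[OF Z] by simp
  also have "char std_normal_distribution (u * sqrt v) = of_real (exp (- (v * u\<^sup>2 / 2)))"
    using v by (simp add: char_std_normal_distribution power_mult_distrib mult.commute)
  finally show ?thesis .
qed

text \<open>
  By the uniqueness theorem of Levy it suffices to compare with one variable of the right law; for
  \<open>v > 0\<close> this is the identity on the normal distribution itself.
\<close>

lemma centred_gaussian_var_if_char:
  assumes Y: "Y \<in> borel_measurable M" and v: "v \<ge> 0"
    and char: "\<And>u. char (distr M borel Y) u = of_real (exp (- (v * u\<^sup>2 / 2)))"
  shows "centred_gaussian_var M v Y"
proof (cases "v = 0")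
  case True
  have "distr M borel Y = distr M borel (\<lambda>_. 0 :: real)"
  proof (rule Levy_uniqueness)
    show "char (distr M borel Y) = char (distr M borel (\<lambda>_. 0))"
      using char True by (auto simp: char_distr_eq prob_space simp del: distr_const)
  qed (use Y in \<open>auto simp del: distr_const\<close>)
  moreover have "AE x in distr M borel (\<lambda>_. 0 :: real). x = 0"
    by (subst AE_distr_iff) auto
  ultimately have "AE x in distr M borel Y. x = 0" by (simp only:)
  then have "AE \<omega> in M. Y \<omega> = 0" using Y by (subst (asm) AE_distr_iff) auto
  then show ?thesis using Y True by (simp add: centred_gaussian_var_def)
next
  case False
  then have "v > 0" using v by simp
  let ?n = "density lborel (normal_density 0 (sqrt v))"
  interpret n: prob_space ?n using \<open>v > 0\<close> by (intro prob_space_normal_density) simp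
  have id: "distr ?n borel (\<lambda>x. x) = ?n" by (rule distr_id2) simp
  have rd: "real_distribution ?n" using n.real_distribution_distr[of "\<lambda>x. x"] id by simp
  have "distr ?n lborel (\<lambda>x. x) = ?n" by (rule distr_id2) simp
  then have "distributed ?n lborel (\<lambda>x. x) (normal_density 0 (sqrt v))"
    by (simp add: distributed_def)
  then have "centred_gaussian_var ?n v (\<lambda>x. x)"
    using \<open>v > 0\<close> by (simp add: centred_gaussian_var_def)
  from n.char_centred_gaussian[OF this] id
  have "char ?n u = of_real (exp (- (v * u\<^sup>2 / 2)))" for u by simp
  then have "distr M borel Y = ?n"
    using char Y rd by (intro Levy_uniqueness) auto
  moreover have "distr M lborel Y = distr M borel Y" by (intro distr_cong) auto
  ultimately show ?thesis using Y \<open>v > 0\<close>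
    by (simp add: centred_gaussian_var_def distributed_def)
qed

lemma centred_gaussian_second_moment:
  assumes "centred_gaussian_var M v Y"
  shows "Y \<in> L2 M" "l2_inner M Y Y = v"
proof -
  have "Y \<in> L2 M \<and> l2_inner M Y Y = v"
  proof (cases "v = 0")
    case True
    then have Y: "Y \<in> borel_measurable M" and ae: "AE \<omega> in M. Y \<omega> = 0"
      using assms by (auto simp: centred_gaussian_var_def)
    have "Y \<in> L2 M" using ae by (intro L2_cong_AE[OF L2_zero Y]) auto
    moreover have "l2_inner M Y Y = l2_inner M (\<lambda>_. 0) Y"
      using ae Y by (intro l2_inner_cong_AE) auto
    ultimately show ?thesis using True by (simp add: l2_inner_def)
  next
    case False
    then have v: "v > 0" "Y \<in> borel_measurable M"
      and D: "distributed M lborel Y (normal_density 0 (sqrt v))"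
      using assms by (auto simp: centred_gaussian_var_def)
    have "integrable M (\<lambda>\<omega>. (Y \<omega>)\<^sup>2)"
      using distributed_integrable[OF D, of "\<lambda>x. x\<^sup>2"] integrable_normal_moment[of "sqrt v" 0 2] v
      by simp
    moreover have "expectation (\<lambda>\<omega>. (Y \<omega>)\<^sup>2) = v"
      using normal_distributed_variance[OF _ D] normal_distributed_expectation[OF _ D] v by simp
    ultimately show ?thesis using v by (simp add: L2_iff l2_inner_def power2_eq_square)
  qed
  then show "Y \<in> L2 M" "l2_inner M Y Y = v" by auto
qed

lemma centred_gaussian_var_cong_AE:
  assumes "centred_gaussian_var M v Y" "Z \<in> borel_measurable M" "AE \<omega> in M. Y \<omega> = Z \<omega>"
  shows "centred_gaussian_var M v Z"
proof (rule centred_gaussian_var_if_char)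
  have Y: "Y \<in> borel_measurable M" and "v \<ge> 0" using assms by (auto simp: centred_gaussian_var_def)
  then show "v \<ge> 0" by simp
  fix u
  have "char (distr M borel Z) u = char (distr M borel Y) u"
    using Y assms(2,3) by (simp add: char_distr_eq, intro integral_cong_AE) auto
  then show "char (distr M borel Z) u = of_real (exp (- (v * u\<^sup>2 / 2)))"
    using char_centred_gaussian[OF assms(1)] by simp
qed fact

lemma centred_gaussian_add_indep:
  assumes Y: "centred_gaussian_var M v Y" and Z: "centred_gaussian_var M w Z"
    and indep: "indep_var borel Y borel Z"
  shows "centred_gaussian_var M (v + w) (\<lambda>\<omega>. Y \<omega> + Z \<omega>)"
proof (rule centred_gaussian_var_if_char)
  show "(\<lambda>\<omega>. Y \<omega> + Z \<omega>) \<in> borel_measurable M" "v + w \<ge> 0"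
    using Y Z by (auto simp: centred_gaussian_var_def)
  fix u
  show "char (distr M borel (\<lambda>\<omega>. Y \<omega> + Z \<omega>)) u = of_real (exp (- ((v + w) * u\<^sup>2 / 2)))"
    unfolding char_distr_add[OF indep] char_centred_gaussian[OF Y] char_centred_gaussian[OF Z]
    by (simp add: exp_add[symmetric] of_real_mult[symmetric] add_divide_distrib distrib_right
        del: of_real_mult of_real_exp)
qed

lemma norm_iexp_diff_le: "norm (iexp a - iexp b) \<le> \<bar>a - b\<bar>"
proof -
  have "iexp a - iexp b = iexp b * (iexp (a - b) - 1)"
    by (simp add: exp_add[symmetric] algebra_simps)
  then have "norm (iexp a - iexp b) = norm (iexp (a - b) - 1)"
    by (simp add: norm_mult)
  also have "\<dots> \<le> \<bar>a - b\<bar>" using iexp_approx1[of "a - b" 0] by simp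
  finally show ?thesis .
qed

text \<open>
  Convergence in \<open>L\<^sup>2\<close> implies convergence of the variances and, because \<open>x \<mapsto> exp (i u x)\<close> is Lipschitz,
  of the characteristic functions.
\<close>

lemma centred_gaussian_l2_limit:
  assumes lim: "l2_tendsto M Y Z" and Y: "\<And>n. centred_gaussian_var M (v n) (Y n)"
  shows "centred_gaussian_var M (l2_inner M Z Z) Z"
proof (rule centred_gaussian_var_if_char)
  have L: "Z \<in> L2 M" "\<And>n. Y n \<in> L2 M" using lim by (auto simp: l2_tendsto_iff)
  then have m[measurable]: "Z \<in> borel_measurable M" "\<And>n. Y n \<in> borel_measurable M"
    by (auto intro: L2_measurable)
  show "Z \<in> borel_measurable M" "l2_inner M Z Z \<ge> 0" by (auto intro: l2_inner_nonneg)
  fix u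
  have "v \<longlonglongrightarrow> l2_inner M Z Z"
    using l2_tendsto_inner[OF lim lim] by (simp add: centred_gaussian_second_moment(2)[OF Y])
  then have "(\<lambda>n. char (distr M borel (Y n)) u) \<longlonglongrightarrow> of_real (exp (- (l2_inner M Z Z * u\<^sup>2 / 2)))"
    unfolding char_centred_gaussian[OF Y] by (intro tendsto_intros) auto
  moreover have "(\<lambda>n. char (distr M borel (Y n)) u) \<longlonglongrightarrow> char (distr M borel Z) u"
  proof (rule Lim_transform[OF tendsto_const], rule Lim_null_comparison)
    let ?e = "\<lambda>n. l2_dist_sq M (Y n) Z"
    have "norm (char (distr M borel Z) u - char (distr M borel (Y n)) u) \<le> \<bar>u\<bar> * sqrt (?e n)" for n
    proof -
      have i: "integrable M (\<lambda>\<omega>. iexp (u * Z \<omega>))" "integrable M (\<lambda>\<omega>. iexp (u * Y n \<omega>))"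
        by (auto intro!: integrable_const_bound[where B=1])
      have YZ: "(\<lambda>\<omega>. Y n \<omega> - Z \<omega>) \<in> L2 M" by (intro L2_diff L)
      have "char (distr M borel Z) u - char (distr M borel (Y n)) u
          = (CLINT \<omega>|M. iexp (u * Z \<omega>) - iexp (u * Y n \<omega>))"
        using i by (simp add: char_distr_eq)
      also have "norm \<dots> \<le> (\<integral>\<omega>. norm (iexp (u * Z \<omega>) - iexp (u * Y n \<omega>)) \<partial>M)"
        by (rule integral_norm_bound)
      also have "\<dots> \<le> (\<integral>\<omega>. \<bar>u\<bar> * \<bar>Y n \<omega> - Z \<omega>\<bar> \<partial>M)"
      proof (rule integral_mono)
        show "integrable M (\<lambda>\<omega>. norm (iexp (u * Z \<omega>) - iexp (u * Y n \<omega>)))"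
          by (intro integrable_norm Bochner_Integration.integrable_diff i)
        show "integrable M (\<lambda>\<omega>. \<bar>u\<bar> * \<bar>Y n \<omega> - Z \<omega>\<bar>)"
          using l1_le_l2(1)[OF YZ] by simp
        show "norm (iexp (u * Z \<omega>) - iexp (u * Y n \<omega>)) \<le> \<bar>u\<bar> * \<bar>Y n \<omega> - Z \<omega>\<bar>" for \<omega>
          using norm_iexp_diff_le[of "u * Z \<omega>" "u * Y n \<omega>"]
          by (simp add: right_diff_distrib[symmetric] abs_mult abs_minus_commute)
      qed
      also have "\<dots> \<le> \<bar>u\<bar> * sqrt (?e n)"
        using l1_le_l2(2)[OF YZ] by (simp add: mult_left_mono)
      finally show ?thesis .
    qed
    then show "eventually (\<lambda>n. norm (char (distr M borel (Y n)) u - char (distr M borel Z) u)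
        \<le> \<bar>u\<bar> * sqrt (?e n)) sequentially" by (simp add: norm_minus_commute)
    have "(\<lambda>n. \<bar>u\<bar> * sqrt (?e n)) \<longlonglongrightarrow> \<bar>u\<bar> * sqrt 0"
      using lim by (intro tendsto_intros) (auto simp: l2_tendsto_iff)
    then show "(\<lambda>n. \<bar>u\<bar> * sqrt (?e n)) \<longlonglongrightarrow> 0" by simp
  qed
  ultimately show "char (distr M borel Z) u = of_real (exp (- (l2_inner M Z Z * u\<^sup>2 / 2)))"
    using LIMSEQ_unique by blast
qed

end

section \<open>Step integrals against the cylindrical Wiener process\<close>

type_synonym 'a step = "(real \<times> real \<times> real \<times> ('a \<Rightarrow> real)) list"

text \<open>
  A list of quadruples \<open>(a, b, c, g)\<close> stands for the \<open>L\<^sup>2\<close>-valued step function \<open>\<Sum> c 1\<^bsub>(a, b]\<^esub> g\<close>. The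
  scalar \<open>c\<close> is kept apart from \<open>g\<close> because \<open>W t (c g) = c W t g\<close> holds only almost surely.
\<close>

definition step_vec :: "'a step \<Rightarrow> real \<Rightarrow> 'a \<Rightarrow> real" where
  "step_vec xs r y = (\<Sum>(a, b, c, g) \<leftarrow> xs. if r \<in> {a<..b} then c * g y else 0)"

definition step_wiener :: "(real \<Rightarrow> ('a \<Rightarrow> real) \<Rightarrow> 'w \<Rightarrow> real) \<Rightarrow> 'a step \<Rightarrow> 'w \<Rightarrow> real" where
  "step_wiener W xs \<omega> = (\<Sum>(a, b, c, g) \<leftarrow> xs. c * (W b g \<omega> - W a g \<omega>))"

definition stopped_wiener ::
    "(real \<Rightarrow> ('a \<Rightarrow> real) \<Rightarrow> 'w \<Rightarrow> real) \<Rightarrow> real \<Rightarrow> 'a step \<Rightarrow> 'w \<Rightarrow> real" where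
  "stopped_wiener W s xs \<omega> = (\<Sum>(a, b, c, g) \<leftarrow> xs. c * (W (min b s) g \<omega> - W (min a s) g \<omega>))"

definition valid_step :: "'a measure \<Rightarrow> real \<Rightarrow> 'a step \<Rightarrow> bool" where
  "valid_step N t xs \<longleftrightarrow> (\<forall>(a, b, c, g) \<in> set xs. 0 \<le> a \<and> a \<le> b \<and> b \<le> t \<and> g \<in> L2 N)"

definition step_scale :: "real \<Rightarrow> 'a step \<Rightarrow> 'a step" where
  "step_scale k xs = map (\<lambda>(a, b, c, g). (a, b, k * c, g)) xs"

lemma valid_step_Nil: "valid_step N t []"
  by (simp add: valid_step_def)

lemma valid_step_Cons:
  "valid_step N t ((a, b, c, g) # xs) \<longleftrightarrow> 0 \<le> a \<and> a \<le> b \<and> b \<le> t \<and> g \<in> L2 N \<and> valid_step N t xs"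
  by (auto simp: valid_step_def)

lemma valid_step_append: "valid_step N t (xs @ ys) \<longleftrightarrow> valid_step N t xs \<and> valid_step N t ys"
  unfolding valid_step_def set_append by blast

lemma valid_step_scale: "valid_step N t xs \<Longrightarrow> valid_step N t (step_scale k xs)"
  by (auto simp: valid_step_def step_scale_def)

lemma step_wiener_append: "step_wiener W (xs @ ys) \<omega> = step_wiener W xs \<omega> + step_wiener W ys \<omega>"
  by (simp add: step_wiener_def)

lemma step_wiener_scale: "step_wiener W (step_scale k xs) \<omega> = k * step_wiener W xs \<omega>"
  by (induction xs) (auto simp: step_wiener_def step_scale_def algebra_simps)

lemma step_vec_append: "step_vec (xs @ ys) r y = step_vec xs r y + step_vec ys r y"
  by (simp add: step_vec_def)

lemma step_vec_scale: "step_vec (step_scale k xs) r y = k * step_vec xs r y"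
  by (induction xs) (auto simp: step_vec_def step_scale_def algebra_simps)

lemma stopped_wiener_Cons:
  "stopped_wiener W s ((a, b, c, g) # xs) \<omega> =
     c * (W (min b s) g \<omega> - W (min a s) g \<omega>) + stopped_wiener W s xs \<omega>"
  by (simp add: stopped_wiener_def)

lemma step_wiener_Cons:
  "step_wiener W ((a, b, c, g) # xs) \<omega> = c * (W b g \<omega> - W a g \<omega>) + step_wiener W xs \<omega>"
  by (simp add: step_wiener_def)

lemma step_vec_Cons:
  "step_vec ((a, b, c, g) # xs) r = (\<lambda>y. (if r \<in> {a<..b} then c else 0) * g y + step_vec xs r y)"
  by (auto simp: step_vec_def)

lemma step_vec_L2: "valid_step N t xs \<Longrightarrow> step_vec xs r \<in> L2 N"
proof (induction xs)
  case Nil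
  then show ?case using L2_zero by (simp add: step_vec_def[abs_def])
next
  case (Cons x xs)
  obtain a b c g where x: "x = (a, b, c, g)" by (cases x) auto
  show ?case unfolding x step_vec_Cons
    using Cons x by (intro L2_add L2_cmult) (auto simp: valid_step_Cons)
qed

lemma step_vec_pair_measurable:
  "valid_step N t xs \<Longrightarrow> (\<lambda>(r, y). step_vec xs r y) \<in> borel_measurable (lborel \<Otimes>\<^sub>M N)"
proof (induction xs)
  case Nil
  then show ?case by (simp add: step_vec_def)
next
  case (Cons x xs)
  obtain a b c g where x: "x = (a, b, c, g)" by (cases x) auto
  have [measurable]: "g \<in> borel_measurable N"
    using Cons x by (auto simp: valid_step_Cons intro: L2_measurable)
  have [measurable]: "(\<lambda>(r, y). step_vec xs r y) \<in> borel_measurable (lborel \<Otimes>\<^sub>M N)"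
    using Cons x by (auto simp: valid_step_Cons)
  show ?case unfolding x step_vec_Cons by measurable
qed

lemma (in prob_space) l2_sq_step_vec_measurable:
  assumes "valid_step M t xs"
  shows "(\<lambda>r. l2_sq M (step_vec xs r)) \<in> borel_measurable lborel"
proof -
  have [measurable]: "(\<lambda>(r, y). step_vec xs r y) \<in> borel_measurable (lborel \<Otimes>\<^sub>M M)"
    by (rule step_vec_pair_measurable[OF assms])
  have "(\<lambda>(r, y). ennreal ((step_vec xs r y)\<^sup>2)) \<in> borel_measurable (lborel \<Otimes>\<^sub>M M)"
    by measurable
  then show ?thesis unfolding l2_sq_def by (rule borel_measurable_nn_integral)
qed

lemma filtered_prob_spaceD:
  assumes "filtered_prob_space P Ft"
  shows "prob_space P" "space (Ft t) = space P" "sets (Ft t) \<subseteq> sets P"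
    "s \<le> t \<Longrightarrow> sets (Ft s) \<subseteq> sets (Ft t)"
  using assms unfolding filtered_prob_space_def filtration_def subalgebra_def by blast+

lemma measurable_filtered_mono:
  assumes F: "filtered_prob_space P Ft" and "s \<le> t" "f \<in> borel_measurable (Ft s)"
  shows "f \<in> borel_measurable (Ft t)"
  using assms(3) filtered_prob_spaceD(2)[OF F, of s] filtered_prob_spaceD(2)[OF F, of t]
    filtered_prob_spaceD(4)[OF F \<open>s \<le> t\<close>] measurable_mono[of borel borel "Ft s" "Ft t"]
  by auto

lemma measurable_filtered_P:
  assumes F: "filtered_prob_space P Ft" and "f \<in> borel_measurable (Ft s)"
  shows "f \<in> borel_measurable P"
  using assms(2) filtered_prob_spaceD(2,3)[OF F, of s] measurable_mono[of borel borel "Ft s" P]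
  by auto

lemma cylindrical_wienerD:
  assumes W: "cylindrical_wiener P Ft N W" and h: "h \<in> L2 N"
  shows "t \<ge> 0 \<Longrightarrow> W t h \<in> borel_measurable (Ft t)"
    "0 \<le> s \<Longrightarrow> s \<le> t \<Longrightarrow> centred_gaussian_var P (l2_inner N h h * (t - s)) (\<lambda>\<omega>. W t h \<omega> - W s h \<omega>)"
    "0 \<le> s \<Longrightarrow> s \<le> t \<Longrightarrow> prob_space.indep_set P (sets (Ft s))
       (sets (vimage_algebra (space P) (\<lambda>\<omega>. W t h \<omega> - W s h \<omega>) borel))"
  using assms unfolding cylindrical_wiener_def wiener_process_def by blast+

lemma cylindrical_wiener_linear:
  assumes W: "cylindrical_wiener P Ft N W" and t: "t \<ge> 0" and g: "g \<in> L2 N" and h: "h \<in> L2 N"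
  shows "AE \<omega> in P. W t (\<lambda>y. a * g y + c * h y) \<omega> = a * W t g \<omega> + c * W t h \<omega>"
proof -
  have "(\<lambda>y. a * g y + c * h y) \<in> L2 N" using g h by (intro L2_add L2_cmult)
  moreover have "AE y in N. a * g y + c * h y = a * g y + c * h y" by simp
  ultimately show ?thesis
    using W[unfolded cylindrical_wiener_def, THEN conjunct2, THEN conjunct1, rule_format, OF t _ g h]
    by blast
qed

text \<open>
  Linearity of \<open>W t\<close> holds only almost surely for each linear relation, so it extends to finite
  combinations but not to all of them simultaneously.
\<close>

lemma cylindrical_wiener_list_sum:
  assumes W: "cylindrical_wiener P Ft N W" and t: "t \<ge> 0"
  shows "\<forall>(c, g) \<in> set xs. g \<in> L2 N \<Longrightarrow>
    (\<lambda>y. \<Sum>(c, g) \<leftarrow> xs. c * g y) \<in> L2 N \<and>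
    (AE \<omega> in P. W t (\<lambda>y. \<Sum>(c, g) \<leftarrow> xs. c * g y) \<omega> = (\<Sum>(c, g) \<leftarrow> xs. c * W t g \<omega>))"
proof (induction xs)
  case Nil
  show ?case using cylindrical_wiener_linear[OF W t L2_zero L2_zero, of 0 0] by (simp add: L2_zero)
next
  case (Cons x xs)
  obtain c g where x: "x = (c, g)" by (cases x) auto
  let ?G = "\<lambda>y. \<Sum>(c, g) \<leftarrow> xs. c * g y"
  have g: "g \<in> L2 N" and G: "?G \<in> L2 N"
    and IH: "AE \<omega> in P. W t ?G \<omega> = (\<Sum>(c, g) \<leftarrow> xs. c * W t g \<omega>)"
    using Cons x by auto
  have "AE \<omega> in P. W t (\<lambda>y. c * g y + 1 * ?G y) \<omega> = c * W t g \<omega> + 1 * W t ?G \<omega>"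
    by (rule cylindrical_wiener_linear[OF W t g G])
  then have "AE \<omega> in P. W t (\<lambda>y. c * g y + ?G y) \<omega> = c * W t g \<omega> + (\<Sum>(c, g) \<leftarrow> xs. c * W t g \<omega>)"
    using IH by eventually_elim simp
  moreover have "(\<lambda>y. c * g y + ?G y) \<in> L2 N" by (intro L2_add L2_cmult g G)
  ultimately show ?case unfolding x by simp
qed

lemma stopped_wiener_adapted:
  assumes F: "filtered_prob_space P Ft" and W: "cylindrical_wiener P Ft N W"
    and "valid_step N t xs" "s \<ge> 0"
  shows "stopped_wiener W s xs \<in> borel_measurable (Ft s)"
  using assms(3)
proof (induction xs)
  case Nil
  then show ?case by (simp add: stopped_wiener_def[abs_def])
next
  case (Cons x xs)
  obtain a b c g where x: "x = (a, b, c, g)" by (cases x) auto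
  have v: "0 \<le> a" "a \<le> b" "g \<in> L2 N" using Cons x by (auto simp: valid_step_Cons)
  have m: "W (min r s) g \<in> borel_measurable (Ft s)" if "r \<ge> 0" for r
    using that \<open>s \<ge> 0\<close> v
    by (intro measurable_filtered_mono[OF F _ cylindrical_wienerD(1)[OF W]]) auto
  have "stopped_wiener W s xs \<in> borel_measurable (Ft s)"
    using Cons x by (auto simp: valid_step_Cons)
  have "(\<lambda>\<omega>. c * (W (min b s) g \<omega> - W (min a s) g \<omega>) + stopped_wiener W s xs \<omega>)
      \<in> borel_measurable (Ft s)"
    using m[of a] m[of b] v \<open>stopped_wiener W s xs \<in> _\<close> by (intro borel_measurable_add borel_measurable_times
        borel_measurable_diff borel_measurable_const) auto
  then show ?case unfolding x stopped_wiener_Cons[abs_def] .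
qed

text \<open>
  Between consecutive jump times \<open>s < s'\<close> the step function is a constant vector \<open>H\<close>, so the stopped
  integral grows by \<open>W s' H - W s H\<close>.
\<close>

lemma stopped_wiener_increment:
  fixes N :: "'a measure"
  assumes F: "filtered_prob_space P Ft" and W: "cylindrical_wiener P Ft N W"
    and xs: "valid_step N t xs" and s: "0 \<le> s" "s < s'"
    and gap: "\<forall>(a, b, c, g) \<in> set xs. a \<notin> {s<..<s'} \<and> b \<notin> {s<..<s'}"
  shows "\<exists>H \<in> L2 N. (\<forall>r\<in>{s<..s'}. step_vec xs r = H) \<and>
    (AE \<omega> in P. stopped_wiener W s' xs \<omega> = stopped_wiener W s xs \<omega> + (W s' H \<omega> - W s H \<omega>))"
proof -
  define L where "L = map (\<lambda>(a, b, c, g). (if a \<le> s \<and> s' \<le> b then c else 0 :: real, g :: 'a \<Rightarrow> real))"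
  have L_Cons: "L ((a, b, c, g) # xs) = (if a \<le> s \<and> s' \<le> b then c else 0, g) # L xs" for a b c g xs
    by (simp add: L_def)
  define H where "H y = (\<Sum>(c, g) \<leftarrow> L xs. c * g y)" for y
  have L: "\<forall>(c, g) \<in> set (L xs). g \<in> L2 N" using xs by (auto simp: valid_step_def L_def)
  note lin = cylindrical_wiener_list_sum[OF W _ L, folded H_def[abs_def]]
  have "step_vec xs r = H" if r: "r \<in> {s<..s'}" for r
  proof
    fix y
    show "step_vec xs r y = H y"
      using gap unfolding H_def
    proof (induction xs)
      case (Cons x xs)
      obtain a b c g where x: "x = (a, b, c, g)" by (cases x) auto
      have "r \<in> {a<..b} \<longleftrightarrow> a \<le> s \<and> s' \<le> b" using Cons.prems r x by auto
      then show ?case using Cons unfolding x by (auto simp: step_vec_Cons L_Cons)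
    qed (simp add: step_vec_def L_def)
  qed
  moreover have "stopped_wiener W s' xs \<omega> = stopped_wiener W s xs \<omega> +
      ((\<Sum>(c, g) \<leftarrow> L xs. c * W s' g \<omega>) - (\<Sum>(c, g) \<leftarrow> L xs. c * W s g \<omega>))" for \<omega>
    using gap xs
  proof (induction xs)
    case (Cons x xs)
    obtain a b c g where x: "x = (a, b, c, g)" by (cases x) auto
    have IH: "stopped_wiener W s' xs \<omega> = stopped_wiener W s xs \<omega> +
      ((\<Sum>(c, g) \<leftarrow> L xs. c * W s' g \<omega>)
       - (\<Sum>(c, g) \<leftarrow> L xs. c * W s g \<omega>))"
      using Cons x by (auto simp: valid_step_Cons)
    have gp: "a \<le> s \<or> s' \<le> a" "b \<le> s \<or> s' \<le> b" and ab: "a \<le> b"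
      using Cons.prems x by (auto simp: valid_step_Cons)
    consider "a \<le> s" "s' \<le> b" | "b \<le> s" | "s' \<le> a" using gp by blast
    then show ?case
    proof cases
      case 1
      then have m: "min b s' = s'" "min a s' = a" "min b s = s" "min a s = a" using s by auto
      show ?thesis unfolding x stopped_wiener_Cons IH m using 1 by (simp add: L_Cons right_diff_distrib)
    next
      case 2
      then have m: "min b s' = b" "min a s' = a" "min b s = b" "min a s = a" and "\<not> s' \<le> b"
        using s ab by auto
      then show ?thesis unfolding x stopped_wiener_Cons IH m by (simp add: L_Cons)
    next
      case 3
      then have m: "min b s' = s'" "min a s' = s'" "min b s = s" "min a s = s" and "\<not> a \<le> s"
        using s ab by auto
      then show ?thesis unfolding x stopped_wiener_Cons IH m by (simp add: L_Cons)
    qed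
  qed (simp add: stopped_wiener_def L_def)
  moreover have "AE \<omega> in P. W s' H \<omega> = (\<Sum>(c, g) \<leftarrow> L xs. c * W s' g \<omega>)"
    "AE \<omega> in P. W s H \<omega> = (\<Sum>(c, g) \<leftarrow> L xs. c * W s g \<omega>)"
    using lin[of s'] lin[of s] s by auto
  ultimately have "\<forall>r\<in>{s<..s'}. step_vec xs r = H"
    "AE \<omega> in P. stopped_wiener W s' xs \<omega> = stopped_wiener W s xs \<omega> + (W s' H \<omega> - W s H \<omega>)"
    by auto
  moreover have "H \<in> L2 N" using lin[of 0] by simp
  ultimately show ?thesis by blast
qed

lemma (in prob_space) indep_var_adapted_increment:
  assumes F: "filtered_prob_space M Ft" and Y: "Y \<in> borel_measurable (Ft s)"
    and D: "D \<in> borel_measurable M"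
    and indep: "indep_set (sets (Ft s)) (sets (vimage_algebra (space M) D borel))"
  shows "indep_var borel Y borel D"
proof -
  have "sigma_sets (space M) {Y -` A \<inter> space M |A. A \<in> sets borel} \<subseteq> sets (Ft s)"
  proof -
    have "{Y -` A \<inter> space M |A. A \<in> sets borel} \<subseteq> sets (Ft s)"
      using measurable_sets[OF Y] filtered_prob_spaceD(2)[OF F] by auto
    from sets.sigma_sets_subset[OF this] show ?thesis
      using filtered_prob_spaceD(2)[OF F, of s] by simp
  qed
  moreover have "indep_sets (case_bool (sets (Ft s)) (sigma_sets (space M) {D -` A \<inter> space M |A. A \<in> sets borel})) UNIV"
    using indep by (simp only: indep_set_def sets_vimage_algebra)
  ultimately have "indep_sets (case_bool (sigma_sets (space M) {Y -` A \<inter> space M |A. A \<in> sets borel})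
      (sigma_sets (space M) {D -` A \<inter> space M |A. A \<in> sets borel})) UNIV"
    by (elim indep_sets_mono_sets) (simp add: bool.case_eq_if)
  then show ?thesis
    unfolding indep_var_eq indep_set_def
    by (intro conjI D measurable_filtered_P[OF F Y])
qed

text \<open>
  The Ito isometry together with Gaussianity. The induction is on the number of jump times before
  \<open>s\<close>: the integral up to the last jump time is independent of the increment after it.
\<close>

lemma stopped_wiener_gaussian:
  assumes F: "filtered_prob_space P Ft" and N: "prob_space N" and W: "cylindrical_wiener P Ft N W"
    and xs: "valid_step N t xs" and s: "s \<ge> 0"
  shows "\<exists>v. (\<integral>\<^sup>+r\<in>{0..s}. l2_sq N (step_vec xs r) \<partial>lborel) = ennreal v \<and>
    centred_gaussian_var P v (stopped_wiener W s xs)"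
proof -
  interpret P: prob_space P by (rule filtered_prob_spaceD(1)[OF F])
  interpret N: prob_space N by fact
  define T where "T = insert 0 ((\<lambda>(a, b, c, g). a) ` set xs \<union> (\<lambda>(a, b, c, g). b) ` set xs)"
  have T: "finite T" "0 \<in> T" "\<And>s. s \<in> T \<Longrightarrow> s \<ge> 0"
    using xs by (auto simp: T_def valid_step_def)
  have [measurable]: "(\<lambda>r. l2_sq N (step_vec xs r)) \<in> borel_measurable lborel"
    by (rule N.l2_sq_step_vec_measurable[OF xs])
  let ?V = "\<lambda>s. \<integral>\<^sup>+r\<in>{0..s}. l2_sq N (step_vec xs r) \<partial>lborel"
  show ?thesis using s
  proof (induction "card {e\<in>T. e < s}" arbitrary: s rule: less_induct)
    case (less s)
    show ?case
    proof (cases "s = 0")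
      case True
      have "?V s = 0"
        using True nn_integral_null_set[of "{0}" lborel] by simp
      moreover have "stopped_wiener W s xs = (\<lambda>\<omega>. 0)"
      proof
        fix \<omega>
        show "stopped_wiener W s xs \<omega> = 0"
          using xs unfolding True
        proof (induction xs)
          case (Cons x xs)
          obtain a b c g where x: "x = (a, b, c, g)" by (cases x) auto
          have "min b 0 = 0" "min a 0 = 0" using Cons.prems by (auto simp: x valid_step_Cons)
          then show ?case
            using Cons.IH Cons.prems by (simp add: stopped_wiener_Cons x valid_step_Cons)
        qed (simp add: stopped_wiener_def)
      qed
      ultimately show ?thesis by (intro exI[of _ 0]) (simp add: centred_gaussian_var_def)
    next
      case False
      let ?E = "{e\<in>T. e < s}"
      define q where "q = Max ?E"
      have E: "finite ?E" "?E \<noteq> {}" using T False less.prems by auto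
      then have "q \<in> ?E" unfolding q_def by (rule Max_in)
      then have q: "q \<in> T" "q < s" "0 \<le> q" using T by auto
      have "{e\<in>T. e < q} \<subset> ?E" using q by auto
      then have "card {e\<in>T. e < q} < card ?E" using E by (intro psubset_card_mono)
      from less.hyps[OF this q(3)] obtain v where
        v: "?V q = ennreal v"
          "centred_gaussian_var P v (stopped_wiener W q xs)" by blast
      have noT: "e \<notin> {q<..<s}" if "e \<in> T" for e
      proof
        assume e: "e \<in> {q<..<s}"
        then have "e \<le> q" unfolding q_def using E(1) that by (intro Max_ge) auto
        then show False using e by simp
      qed
      have "\<forall>(a, b, c, g) \<in> set xs. a \<notin> {q<..<s} \<and> b \<notin> {q<..<s}"
      proof (intro ballI, clarify, intro conjI)
        fix a b c g assume x: "(a, b, c, g) \<in> set xs"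
        have "a \<in> T" "b \<in> T"
          using imageI[OF x, of "\<lambda>(a, b, c, g). a"] imageI[OF x, of "\<lambda>(a, b, c, g). b"]
          by (simp_all add: T_def)
        from noT[OF this(1)] noT[OF this(2)] show "a \<notin> {q<..<s}" "b \<notin> {q<..<s}" .
      qed
      from stopped_wiener_increment[OF F W xs q(3,2) this] obtain H where
        H: "H \<in> L2 N" "\<And>r. r\<in>{q<..s} \<Longrightarrow> step_vec xs r = H" and
        inc: "AE \<omega> in P. stopped_wiener W s xs \<omega> = stopped_wiener W q xs \<omega> + (W s H \<omega> - W q H \<omega>)"
        by blast
      let ?D = "\<lambda>\<omega>. W s H \<omega> - W q H \<omega>" and ?w = "l2_inner N H H * (s - q)"
      have D: "centred_gaussian_var P ?w ?D"
        using q by (intro cylindrical_wienerD(2)[OF W H(1)]) auto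
      have "P.indep_var borel (stopped_wiener W q xs) borel ?D"
      proof (rule P.indep_var_adapted_increment[OF F])
        show "stopped_wiener W q xs \<in> borel_measurable (Ft q)"
          by (rule stopped_wiener_adapted[OF F W xs q(3)])
        show "?D \<in> borel_measurable P" using D by (simp add: centred_gaussian_var_def)
        show "P.indep_set (sets (Ft q)) (sets (vimage_algebra (space P) ?D borel))"
          using q by (intro cylindrical_wienerD(3)[OF W H(1)]) auto
      qed
      then have "centred_gaussian_var P (v + ?w) (\<lambda>\<omega>. stopped_wiener W q xs \<omega> + ?D \<omega>)"
        by (rule P.centred_gaussian_add_indep[OF v(2) D])
      then have "centred_gaussian_var P (v + ?w) (stopped_wiener W s xs)"
      proof (rule P.centred_gaussian_var_cong_AE)
        show "stopped_wiener W s xs \<in> borel_measurable P"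
          by (rule measurable_filtered_P[OF F stopped_wiener_adapted[OF F W xs less.prems]])
        show "AE \<omega> in P. stopped_wiener W q xs \<omega> + ?D \<omega> = stopped_wiener W s xs \<omega>"
          using inc by eventually_elim (rule sym)
      qed
      moreover have "?V s = ennreal (v + ?w)"
      proof -
        have "?V s
          = (\<integral>\<^sup>+r. l2_sq N (step_vec xs r) * indicator {0..q} r + l2_sq N (step_vec xs r) * indicator {q<..s} r \<partial>lborel)"
          using q by (intro nn_integral_cong) (auto split: split_indicator)
        also have "\<dots> = ennreal v + (\<integral>\<^sup>+r. l2_sq N (step_vec xs r) * indicator {q<..s} r \<partial>lborel)"
          by (subst nn_integral_add) (auto simp: v)
        also have "(\<integral>\<^sup>+r. l2_sq N (step_vec xs r) * indicator {q<..s} r \<partial>lborel)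
          = (\<integral>\<^sup>+r. ennreal (l2_inner N H H) * indicator {q<..s} r \<partial>lborel)"
          by (intro nn_integral_cong) (auto simp: H l2_sq_eq split: split_indicator)
        also have "\<dots> = ennreal ?w"
          using q by (simp add: nn_integral_cmult_indicator ennreal_mult[symmetric] l2_inner_nonneg)
        also have "ennreal v + ennreal ?w = ennreal (v + ?w)"
          using v(2) q by (subst ennreal_plus) (auto simp: centred_gaussian_var_def l2_inner_nonneg)
        finally show ?thesis .
      qed
      ultimately show ?thesis by (intro exI[of _ "v + ?w"] conjI)
    qed
  qed
qed

lemma stopped_wiener_eq: "valid_step N t xs \<Longrightarrow> stopped_wiener W t xs = step_wiener W xs"
proof
  fix \<omega> assume "valid_step N t xs"
  then show "stopped_wiener W t xs \<omega> = step_wiener W xs \<omega>"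
  proof (induction xs)
    case (Cons x xs)
    obtain a b c g where x: "x = (a, b, c, g)" by (cases x) auto
    have "min b t = b" "min a t = a" using Cons.prems by (auto simp: x valid_step_Cons)
    then show ?case
      using Cons.IH Cons.prems
      by (simp add: stopped_wiener_Cons step_wiener_Cons x valid_step_Cons)
  qed (simp add: stopped_wiener_def step_wiener_def)
qed

section \<open>Stochastic integrals in coordinates\<close>

definition coord_space :: "real \<Rightarrow> (nat \<times> real) measure" where
  "coord_space t = count_space UNIV \<Otimes>\<^sub>M restrict_space lborel {0..t}"

lemma coord_space_measurable:
  fixes f :: "nat \<times> real \<Rightarrow> 'b::topological_space"
  assumes "\<And>j. (\<lambda>s. f (j, s)) \<in> borel_measurable borel"
  shows "f \<in> borel_measurable (coord_space t)"
  unfolding coord_space_def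
proof (rule measurable_pair_measure_countable1)
  fix j :: nat
  have "(\<lambda>s. f (j, s)) \<in> borel_measurable lborel" using assms[of j] by simp
  then show "(\<lambda>s. f (j, s)) \<in> borel_measurable (restrict_space lborel {0..t})"
    by (rule measurable_restrict_space1)
qed simp

lemma sigma_finite_restrict_lborel: "sigma_finite_measure (restrict_space lborel {0..t::real})"
proof -
  have "finite_measure (restrict_space lborel {0..t::real})"
    by (intro finite_measure_restrict_space finite_measureI)
       (simp_all add: space_restrict_space emeasure_restrict_space emeasure_lborel_Icc_eq)
  then show ?thesis by (simp add: finite_measure_def)
qed

lemma nn_integral_coord_space:
  fixes f :: "nat \<times> real \<Rightarrow> ennreal"
  assumes f: "\<And>j. (\<lambda>s. f (j, s)) \<in> borel_measurable borel"
  shows "(\<integral>\<^sup>+z. f z \<partial>coord_space t) = (\<Sum>j. \<integral>\<^sup>+s\<in>{0..t}. f (j, s) \<partial>lborel)"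
    and "(\<integral>\<^sup>+z. f z \<partial>coord_space t) = (\<integral>\<^sup>+s\<in>{0..t}. (\<Sum>j. f (j, s)) \<partial>lborel)"
proof -
  interpret R: sigma_finite_measure "restrict_space lborel {0..t::real}"
    by (rule sigma_finite_restrict_lborel)
  have "f \<in> borel_measurable (count_space UNIV \<Otimes>\<^sub>M restrict_space lborel {0..t})"
    using coord_space_measurable[OF f] by (simp add: coord_space_def)
  from R.nn_integral_fst[OF this]
  show 1: "(\<integral>\<^sup>+z. f z \<partial>coord_space t) = (\<Sum>j. \<integral>\<^sup>+s\<in>{0..t}. f (j, s) \<partial>lborel)"
    by (simp add: coord_space_def nn_integral_count_space_nat nn_integral_restrict_space)
  have [measurable]: "(\<lambda>s. f (j, s)) \<in> borel_measurable borel" for j by (rule f)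
  have "(\<Sum>j. \<integral>\<^sup>+s\<in>{0..t}. f (j, s) \<partial>lborel) = (\<integral>\<^sup>+s. (\<Sum>j. f (j, s) * indicator {0..t} s) \<partial>lborel)"
    by (intro nn_integral_suminf[symmetric]) measurable
  then show "(\<integral>\<^sup>+z. f z \<partial>coord_space t) = (\<integral>\<^sup>+s\<in>{0..t}. (\<Sum>j. f (j, s)) \<partial>lborel)"
    unfolding 1 by simp
qed

lemma l2_sq_coord_space:
  fixes c :: "nat \<times> real \<Rightarrow> real"
  assumes c: "\<And>j. (\<lambda>s. c (j, s)) \<in> borel_measurable borel"
  shows "l2_sq (coord_space t) c = (\<Sum>j. \<integral>\<^sup>+s\<in>{0..t}. ennreal ((c (j, s))\<^sup>2) \<partial>lborel)"
    and "l2_sq (coord_space t) c = (\<integral>\<^sup>+s\<in>{0..t}. (\<Sum>j. ennreal ((c (j, s))\<^sup>2)) \<partial>lborel)"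
proof -
  have "(\<lambda>s. ennreal ((c (j, s))\<^sup>2)) \<in> borel_measurable borel" for j
    using c[of j] by measurable
  note nn_integral_coord_space[where f="\<lambda>z. ennreal ((c z)\<^sup>2)", OF this]
  then show "l2_sq (coord_space t) c = (\<Sum>j. \<integral>\<^sup>+s\<in>{0..t}. ennreal ((c (j, s))\<^sup>2) \<partial>lborel)"
    and "l2_sq (coord_space t) c = (\<integral>\<^sup>+s\<in>{0..t}. (\<Sum>j. ennreal ((c (j, s))\<^sup>2)) \<partial>lborel)"
    unfolding l2_sq_def by auto
qed

text \<open>
  Dominated convergence, with \<open>c\<^sup>2\<close> as the dominating function.
\<close>

lemma l2_tendsto_truncate:
  assumes c: "c \<in> L2 (coord_space t)"
  shows "l2_tendsto (coord_space t) (\<lambda>K (j, s). if j < K then c (j, s) else 0) c"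
proof (rule l2_tendstoI)
  let ?n = "coord_space t"
  let ?c = "\<lambda>K (j, s). if j < K then c (j, s) else 0 :: real"
  have [measurable]: "c \<in> borel_measurable ?n" using c by (rule L2_measurable)
  show "c \<in> borel_measurable ?n" by measurable
  have [measurable]: "fst \<in> measurable ?n (count_space UNIV)"
    unfolding coord_space_def by measurable
  have ceq: "?c K = (\<lambda>z. if fst z < K then c z else 0)" for K by auto
  have m[measurable]: "?c K \<in> borel_measurable ?n" for K unfolding ceq by measurable
  have fin: "(\<integral>\<^sup>+z. ennreal ((c z)\<^sup>2) \<partial>?n) < \<infinity>" using c by (simp add: L2_def l2_sq_def)
  show "?c K \<in> L2 ?n" for K
  proof -
    have "l2_sq ?n (?c K) \<le> (\<integral>\<^sup>+z. ennreal ((c z)\<^sup>2) \<partial>?n)"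
      unfolding l2_sq_def by (intro nn_integral_mono) auto
    then show ?thesis using m fin by (simp add: L2_def order_le_less_trans)
  qed
  have "(\<lambda>K. \<integral>\<^sup>+z. ennreal ((?c K z - c z)\<^sup>2) \<partial>?n) \<longlonglongrightarrow> (\<integral>\<^sup>+z. 0 \<partial>?n)"
  proof (rule nn_integral_dominated_convergence[where w="\<lambda>z. ennreal ((c z)\<^sup>2)"])
    show "AE z in ?n. (\<lambda>K. ennreal ((?c K z - c z)\<^sup>2)) \<longlonglongrightarrow> 0"
    proof (rule AE_I2)
      fix z :: "nat \<times> real"
      have "eventually (\<lambda>K. ennreal ((?c K z - c z)\<^sup>2) = 0) sequentially"
        using eventually_gt_at_top[of "fst z"] by eventually_elim (auto split: prod.split)
      then show "(\<lambda>K. ennreal ((?c K z - c z)\<^sup>2)) \<longlonglongrightarrow> 0" by (rule tendsto_eventually)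
    qed
  qed (use fin in \<open>auto intro!: AE_I2\<close>)
  then show "(\<lambda>K. l2_sq ?n (\<lambda>z. ?c K z - c z)) \<longlonglongrightarrow> 0" by (simp add: l2_sq_def)
qed

locale wiener_setting = P: prob_space P + N: prob_space N
  for P :: "'w measure" and N :: "'a measure" +
  fixes Ft :: "real \<Rightarrow> 'w measure" and W :: "real \<Rightarrow> ('a \<Rightarrow> real) \<Rightarrow> 'w \<Rightarrow> real"
    and e :: "nat \<Rightarrow> 'a \<Rightarrow> real" and t :: real
  assumes filtered: "filtered_prob_space P Ft"
    and cylindrical: "cylindrical_wiener P Ft N W"
    and basis: "complete_orthonormal N e"
    and t_nonneg: "0 \<le> t"
begin

abbreviation "\<nu> \<equiv> coord_space t"

definition coord :: "'a step \<Rightarrow> nat \<times> real \<Rightarrow> real" where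
  "coord xs = (\<lambda>(j, s). l2_inner N (step_vec xs s) (e j))"

lemma ortho: "orthonormal N e" using basis by (simp add: complete_orthonormal_def)

lemma eL: "e k \<in> L2 N" using ortho by (rule L2_orthonormal)

lemma inner_step_vec_Cons:
  assumes "valid_step N t ((a, b, c, g) # xs)" "f \<in> L2 N"
  shows "l2_inner N (step_vec ((a, b, c, g) # xs) s) f =
    (if s \<in> {a<..b} then c else 0) * l2_inner N g f + l2_inner N (step_vec xs s) f"
  using assms unfolding step_vec_Cons valid_step_Cons
  by (subst l2_inner_add_left) (auto intro: L2_cmult step_vec_L2 simp: l2_inner_cmult_left L2_zero l2_inner_def[of N "\<lambda>_. 0"])

lemma inner_step_vec_Nil: "l2_inner N (step_vec [] s) f = 0"
  by (simp add: step_vec_def l2_inner_def)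

lemma inner_step_vec_measurable:
  "valid_step N t xs \<Longrightarrow> f \<in> L2 N \<Longrightarrow> (\<lambda>s. l2_inner N (step_vec xs s) f) \<in> borel_measurable borel"
proof (induction xs)
  case Nil
  then show ?case by (simp add: inner_step_vec_Nil)
next
  case (Cons x xs)
  obtain a b c g where x: "x = (a, b, c, g)" by (cases x) auto
  have "(\<lambda>s. l2_inner N (step_vec xs s) f) \<in> borel_measurable borel"
    using Cons x by (simp add: valid_step_Cons)
  then have "(\<lambda>s. (if s \<in> {a<..b} then c else 0) * l2_inner N g f + l2_inner N (step_vec xs s) f)
      \<in> borel_measurable borel" by measurable
  then show ?case using Cons.prems unfolding x by (simp only: inner_step_vec_Cons)
qed

lemma coord_component_measurable:
  "valid_step N t xs \<Longrightarrow> (\<lambda>s. coord xs (j, s)) \<in> borel_measurable borel"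
  unfolding coord_def using inner_step_vec_measurable[OF _ eL] by simp

text \<open>
  Parseval's identity turns the norm of the step function in \<open>L\<^sup>2([0, t]; L\<^sup>2(N))\<close> into the norm of
  its coordinates, so that all later limits can be taken in one scalar \<open>L\<^sup>2\<close> space.
\<close>

lemma step_wiener_isometry:
  assumes xs: "valid_step N t xs"
  shows "coord xs \<in> L2 \<nu>"
    and "centred_gaussian_var P (l2_inner \<nu> (coord xs) (coord xs)) (step_wiener W xs)"
proof -
  obtain v where v: "(\<integral>\<^sup>+r\<in>{0..t}. l2_sq N (step_vec xs r) \<partial>lborel) = ennreal v"
    and G: "centred_gaussian_var P v (step_wiener W xs)"
    using stopped_wiener_gaussian[OF filtered N.prob_space_axioms cylindrical xs t_nonneg]
    unfolding stopped_wiener_eq[OF xs] by blast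
  have "(\<Sum>j. ennreal ((coord xs (j, s))\<^sup>2)) = l2_sq N (step_vec xs s)" for s
  proof -
    have L: "step_vec xs s \<in> L2 N" by (rule step_vec_L2[OF xs])
    note P = N.Parseval[OF basis L]
    have "(\<Sum>j. ennreal ((l2_inner N (step_vec xs s) (e j))\<^sup>2)) = ennreal (l2_inner N (step_vec xs s) (step_vec xs s))"
      by (rule suminf_ennreal_eq[OF _ P]) simp
    then show ?thesis by (simp add: coord_def l2_sq_eq[OF L])
  qed
  then have sq: "l2_sq \<nu> (coord xs) = ennreal v"
    using l2_sq_coord_space(2)[OF coord_component_measurable[OF xs], of t] v by simp
  show L: "coord xs \<in> L2 \<nu>"
    using sq coord_space_measurable[OF coord_component_measurable[OF xs]] by (simp add: L2_def)
  have "0 \<le> v" using G by (simp add: centred_gaussian_var_def)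
  then have "l2_inner \<nu> (coord xs) (coord xs) = v"
    using sq l2_sq_eq[OF L] by (simp add: l2_inner_nonneg)
  then show "centred_gaussian_var P (l2_inner \<nu> (coord xs) (coord xs)) (step_wiener W xs)"
    using G by simp
qed

lemma step_wiener_L2: "valid_step N t xs \<Longrightarrow> step_wiener W xs \<in> L2 P"
  using P.centred_gaussian_second_moment(1) step_wiener_isometry(2) by blast

lemma coord_append:
  "valid_step N t xs \<Longrightarrow> valid_step N t ys \<Longrightarrow> coord (xs @ ys) = (\<lambda>z. coord xs z + coord ys z)"
  by (auto simp: coord_def step_vec_append[abs_def] fun_eq_iff intro!: l2_inner_add_left step_vec_L2 eL)

lemma coord_scale: "coord (step_scale k xs) = (\<lambda>z. k * coord xs z)"
  by (auto simp: coord_def step_vec_scale[abs_def] l2_inner_cmult_left)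

text \<open>
  \<open>represents c Y\<close>: the Wiener integral over \<open>[0, t]\<close> of the integrand with \<open>j\<close>th coordinate
  \<open>s \<mapsto> c (j, s)\<close> is \<open>Y\<close>.
\<close>

definition represents :: "(nat \<times> real \<Rightarrow> real) \<Rightarrow> ('w \<Rightarrow> real) \<Rightarrow> bool" where
  "represents c Y \<longleftrightarrow> (\<exists>xs. (\<forall>n. valid_step N t (xs n)) \<and>
     l2_tendsto \<nu> (\<lambda>n. coord (xs n)) c \<and> l2_tendsto P (\<lambda>n. step_wiener W (xs n)) Y)"

lemma represents_L2: "represents c Y \<Longrightarrow> c \<in> L2 \<nu>" "represents c Y \<Longrightarrow> Y \<in> L2 P"
  by (auto simp: represents_def l2_tendsto_iff)

lemma represents_gaussian:
  assumes "represents c Y"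
  shows "centred_gaussian_var P (l2_inner \<nu> c c) Y" "l2_inner P Y Y = l2_inner \<nu> c c"
proof -
  obtain xs where xs: "\<And>n. valid_step N t (xs n)" "l2_tendsto \<nu> (\<lambda>n. coord (xs n)) c"
    "l2_tendsto P (\<lambda>n. step_wiener W (xs n)) Y"
    using assms by (auto simp: represents_def)
  note G = step_wiener_isometry(2)[OF xs(1)]
  have "(\<lambda>n. l2_inner P (step_wiener W (xs n)) (step_wiener W (xs n))) \<longlonglongrightarrow> l2_inner \<nu> c c"
    unfolding P.centred_gaussian_second_moment(2)[OF G] by (rule l2_tendsto_inner[OF xs(2,2)])
  then show "l2_inner P Y Y = l2_inner \<nu> c c"
    using LIMSEQ_unique l2_tendsto_inner[OF xs(3,3)] by blast
  then show "centred_gaussian_var P (l2_inner \<nu> c c) Y"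
    using P.centred_gaussian_l2_limit[OF xs(3) G] by simp
qed

lemma represents_add:
  assumes "represents c Y" "represents c' Y'"
  shows "represents (\<lambda>z. c z + c' z) (\<lambda>\<omega>. Y \<omega> + Y' \<omega>)"
proof -
  obtain xs where xs: "\<And>n. valid_step N t (xs n)" "l2_tendsto \<nu> (\<lambda>n. coord (xs n)) c"
    "l2_tendsto P (\<lambda>n. step_wiener W (xs n)) Y"
    using assms by (auto simp: represents_def)
  obtain ys where ys: "\<And>n. valid_step N t (ys n)" "l2_tendsto \<nu> (\<lambda>n. coord (ys n)) c'"
    "l2_tendsto P (\<lambda>n. step_wiener W (ys n)) Y'"
    using assms by (auto simp: represents_def)
  have "l2_tendsto \<nu> (\<lambda>n. coord (xs n @ ys n)) (\<lambda>z. c z + c' z)"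
    using l2_tendsto_add[OF xs(2) ys(2)] by (simp add: coord_append xs ys)
  moreover have "l2_tendsto P (\<lambda>n. step_wiener W (xs n @ ys n)) (\<lambda>\<omega>. Y \<omega> + Y' \<omega>)"
    using l2_tendsto_add[OF xs(3) ys(3)] by (simp add: step_wiener_append[abs_def])
  ultimately show ?thesis unfolding represents_def using xs ys
    by (intro exI[of _ "\<lambda>n. xs n @ ys n"]) (simp add: valid_step_append)
qed

lemma represents_cmult:
  assumes "represents c Y"
  shows "represents (\<lambda>z. k * c z) (\<lambda>\<omega>. k * Y \<omega>)"
proof -
  obtain xs where xs: "\<And>n. valid_step N t (xs n)" "l2_tendsto \<nu> (\<lambda>n. coord (xs n)) c"
    "l2_tendsto P (\<lambda>n. step_wiener W (xs n)) Y"
    using assms by (auto simp: represents_def)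
  have "l2_tendsto \<nu> (\<lambda>n. coord (step_scale k (xs n))) (\<lambda>z. k * c z)"
    using l2_tendsto_cmult[OF xs(2)] by (simp add: coord_scale)
  moreover have "l2_tendsto P (\<lambda>n. step_wiener W (step_scale k (xs n))) (\<lambda>\<omega>. k * Y \<omega>)"
    using l2_tendsto_cmult[OF xs(3)] by (simp add: step_wiener_scale[abs_def])
  ultimately show ?thesis unfolding represents_def using xs
    by (intro exI[of _ "\<lambda>n. step_scale k (xs n)"]) (simp add: valid_step_scale)
qed

lemma represents_diff:
  assumes "represents c Y" "represents c' Y'"
  shows "represents (\<lambda>z. c z - c' z) (\<lambda>\<omega>. Y \<omega> - Y' \<omega>)"
  using represents_add[OF assms(1) represents_cmult[OF assms(2), of "-1"]] by simp

lemma represents_zero: "represents (\<lambda>_. 0) (\<lambda>_. 0)"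
proof -
  have "coord [] = (\<lambda>_. 0)" "step_wiener W [] = (\<lambda>_. 0)"
    by (auto simp: coord_def inner_step_vec_Nil step_wiener_def fun_eq_iff)
  then show ?thesis unfolding represents_def
    by (intro exI[of _ "\<lambda>_. []"]) (simp add: valid_step_Nil l2_tendsto_const L2_zero)
qed

lemma represents_sum:
  fixes K :: nat
  assumes "\<And>k. represents (c k) (Y k)"
  shows "represents (\<lambda>z. \<Sum>k<K. c k z) (\<lambda>\<omega>. \<Sum>k<K. Y k \<omega>)"
  by (induction K) (simp_all add: represents_zero represents_add assms)

text \<open>
  A diagonal choice: the \<open>K\<close>th step function approximates both the integrand and the integral of the
  \<open>K\<close>th pair up to \<open>1 / Suc K\<close>.
\<close>

lemma represents_limit:
  assumes R: "\<And>K. represents (c K) (Y K)" and c: "l2_tendsto \<nu> c c'" and Y: "l2_tendsto P Y Y'"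
  shows "represents c' Y'"
proof -
  have "\<forall>K. \<exists>xs. (valid_step N t xs \<and> l2_dist_sq \<nu> (coord xs) (c K) < 1 / Suc K \<and> l2_dist_sq P (step_wiener W xs) (Y K) < 1 / Suc K)"
  proof
    fix K
    obtain xs where xs: "\<And>n. valid_step N t (xs n)" "l2_tendsto \<nu> (\<lambda>n. coord (xs n)) (c K)"
      "l2_tendsto P (\<lambda>n. step_wiener W (xs n)) (Y K)"
      using R[of K] by (auto simp: represents_def)
    have "eventually (\<lambda>n. l2_dist_sq \<nu> (coord (xs n)) (c K) < 1 / Suc K) sequentially"
      using xs(2) unfolding l2_tendsto_iff by (intro order_tendstoD(2)[of _ 0]) auto
    moreover have "eventually (\<lambda>n. l2_dist_sq P (step_wiener W (xs n)) (Y K) < 1 / Suc K) sequentially"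
      using xs(3) unfolding l2_tendsto_iff by (intro order_tendstoD(2)[of _ 0]) auto
    ultimately have "eventually (\<lambda>n. l2_dist_sq \<nu> (coord (xs n)) (c K) < 1 / Suc K \<and>
        l2_dist_sq P (step_wiener W (xs n)) (Y K) < 1 / Suc K) sequentially"
      by (rule eventually_conj)
    then obtain n where "l2_dist_sq \<nu> (coord (xs n)) (c K) < 1 / Suc K \<and> l2_dist_sq P (step_wiener W (xs n)) (Y K) < 1 / Suc K"
      unfolding eventually_sequentially by blast
    then show "\<exists>xs. (valid_step N t xs \<and> l2_dist_sq \<nu> (coord xs) (c K) < 1 / Suc K \<and> l2_dist_sq P (step_wiener W xs) (Y K) < 1 / Suc K)"
      using xs(1)[of n] by (intro exI[of _ "xs n"] conjI) simp_all
  qed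
  from choice[OF this]
  obtain xs where xs: "\<And>K. valid_step N t (xs K)"
    "\<And>K. l2_dist_sq \<nu> (coord (xs K)) (c K) < 1 / Suc K" "\<And>K. l2_dist_sq P (step_wiener W (xs K)) (Y K) < 1 / Suc K"
    by blast
  have close: "l2_tendsto M f g'"
    if f: "\<And>K. f K \<in> L2 M" and g: "l2_tendsto M g g'" and fg: "\<And>K. l2_dist_sq M (f K) (g K) < 1 / Suc K"
    for M :: "'c measure" and f g g'
  proof -
    have L: "\<And>K. g K \<in> L2 M" "g' \<in> L2 M" and lim: "(\<lambda>K. l2_dist_sq M (g K) g') \<longlonglongrightarrow> 0"
      using g by (auto simp: l2_tendsto_iff)
    have "(\<lambda>K. l2_dist_sq M (f K) g') \<longlonglongrightarrow> 0"
    proof (rule tendsto_sandwich[OF _ _ tendsto_const])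
      have "(\<lambda>K. 2 * (1 / real (Suc K)) + 2 * l2_dist_sq M (g K) g') \<longlonglongrightarrow> 2 * 0 + 2 * 0"
        by (intro tendsto_intros lim LIMSEQ_Suc[OF lim_1_over_n])
      then show "(\<lambda>K. 2 * (1 / real (Suc K)) + 2 * l2_dist_sq M (g K) g') \<longlonglongrightarrow> 0" by simp
      have "l2_dist_sq M (f K) g' \<le> 2 * (1 / real (Suc K)) + 2 * l2_dist_sq M (g K) g'" for K
        using l2_inner_diff_self_le[OF f L(1) L(2), of K K] fg[of K] by simp
      then show "eventually (\<lambda>K. l2_dist_sq M (f K) g' \<le> 2 * (1 / real (Suc K)) + 2 * l2_dist_sq M (g K) g') sequentially"
        by simp
    qed (auto intro!: always_eventually l2_inner_nonneg)
    then show ?thesis using f L by (simp add: l2_tendsto_iff)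
  qed
  show ?thesis unfolding represents_def
    using close[OF step_wiener_isometry(1)[OF xs(1)] c xs(2)]
      close[OF step_wiener_L2[OF xs(1)] Y xs(3)] xs(1) by (intro exI[of _ xs]) simp
qed

text \<open>
  By the isometry the integrals form a Cauchy sequence as soon as the integrands do.
\<close>

lemma represents_convergent:
  assumes R: "\<And>K. represents (c K) (Y K)" and c: "l2_tendsto \<nu> c c'"
  shows "\<exists>Y'. l2_tendsto P Y Y'"
proof (rule P.Riesz_Fischer)
  show "Y n \<in> L2 P" for n using R by (rule represents_L2)
  have L: "\<And>K. c K \<in> L2 \<nu>" "c' \<in> L2 \<nu>" and lim: "(\<lambda>K. l2_dist_sq \<nu> (c K) c') \<longlonglongrightarrow> 0"
    using c by (auto simp: l2_tendsto_iff)
  fix \<epsilon> :: real assume "\<epsilon> > 0"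
  then have "eventually (\<lambda>K. l2_dist_sq \<nu> (c K) c' < \<epsilon> / 4) sequentially"
    using lim by (intro order_tendstoD(2)[of _ 0]) auto
  then obtain n0 where n0: "\<And>K. K \<ge> n0 \<Longrightarrow> l2_dist_sq \<nu> (c K) c' < \<epsilon> / 4"
    by (auto simp: eventually_sequentially)
  have "l2_dist_sq P (Y m) (Y n) < \<epsilon>" if "m \<ge> n0" "n \<ge> n0" for m n
  proof -
    have "l2_dist_sq P (Y m) (Y n) = l2_dist_sq \<nu> (c m) (c n)"
      by (rule represents_gaussian(2)[OF represents_diff[OF R R]])
    also have "\<dots> \<le> 2 * l2_dist_sq \<nu> (c m) c' + 2 * l2_dist_sq \<nu> c' (c n)"
      by (rule l2_inner_diff_self_le[OF L(1,2,1)])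
    also have "l2_dist_sq \<nu> c' (c n) = l2_dist_sq \<nu> (c n) c'"
      unfolding l2_inner_def by (intro Bochner_Integration.integral_cong refl) (simp add: algebra_simps)
    also have "2 * l2_dist_sq \<nu> (c m) c' + 2 * l2_dist_sq \<nu> (c n) c' < \<epsilon>" using n0[OF that(1)] n0[OF that(2)] by simp
    finally show ?thesis .
  qed
  then show "\<exists>n0. \<forall>m\<ge>n0. \<forall>n\<ge>n0. l2_dist_sq P (Y m) (Y n) < \<epsilon>"
    by blast
qed

lemma represents_wiener_integral:
  assumes Y: "has_wiener_integral P (\<lambda>s. W s (e k)) t f Y" and f: "f \<in> borel_measurable borel"
  shows "represents (\<lambda>(j, s). if j = k then f s else 0) Y"
proof -
  let ?c = "\<lambda>(j, s). if j = k then f s else 0 :: real"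
  obtain xs where xs: "\<And>n. \<forall>(a, b, c)\<in>set (xs n). 0 \<le> a \<and> a \<le> b \<and> b \<le> t"
    and lim: "(\<lambda>n. \<integral>\<^sup>+s\<in>{0..t}. ennreal ((step_fun (xs n) s - f s)\<^sup>2) \<partial>lborel) \<longlonglongrightarrow> 0"
    and Y: "l2_tendsto P (\<lambda>n. step_integral (\<lambda>s. W s (e k)) (xs n)) Y"
    using Y unfolding has_wiener_integral_def by blast
  let ?I = "\<lambda>n. \<integral>\<^sup>+s\<in>{0..t}. ennreal ((step_fun (xs n) s - f s)\<^sup>2) \<partial>lborel"
  define ys where "ys n = map (\<lambda>(a, b, c). (a, b, c, e k)) (xs n)" for n
  have valid: "valid_step N t (ys n)" for n
    using xs[of n] by (auto simp: ys_def valid_step_def eL)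
  have sw: "step_wiener W (ys n) = step_integral (\<lambda>s. W s (e k)) (xs n)" for n
    unfolding ys_def step_wiener_def step_integral_def
    by (intro ext arg_cong[where f=sum_list]) (auto simp: o_def case_prod_beta')
  have vec: "step_vec (ys n) s y = step_fun (xs n) s * e k y" for n s y
  proof -
    have "step_vec (map (\<lambda>(a, b, c). (a, b, c, e k)) l) s y = step_fun l s * e k y" for l
      by (induction l) (auto simp: step_vec_def step_fun_def distrib_right)
    then show ?thesis by (simp add: ys_def)
  qed
  have co: "coord (ys n) (j, s) = (if j = k then step_fun (xs n) s else 0)" for n j s
    using ortho unfolding coord_def vec[abs_def]
    by (simp add: l2_inner_cmult_left orthonormal_def)
  have "l2_sq \<nu> (\<lambda>z. coord (ys n) z - ?c z) = ?I n" for n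
  proof -
    have "(\<lambda>s. coord (ys n) (j, s) - ?c (j, s)) \<in> borel_measurable borel" for j
      using coord_component_measurable[OF valid[of n], of j] f by simp
    from l2_sq_coord_space(1)[where c="\<lambda>z. coord (ys n) z - ?c z", OF this, of t]
    have "l2_sq \<nu> (\<lambda>z. coord (ys n) z - ?c z)
      = (\<Sum>j. \<integral>\<^sup>+s\<in>{0..t}. ennreal ((coord (ys n) (j, s) - ?c (j, s))\<^sup>2) \<partial>lborel)" .
    also have "\<dots> = (\<Sum>j. if j = k then ?I n else 0)"
    proof (rule suminf_cong)
      fix j
      show "(\<integral>\<^sup>+s\<in>{0..t}. ennreal ((coord (ys n) (j, s) - ?c (j, s))\<^sup>2) \<partial>lborel) =
        (if j = k then ?I n else 0)"
        by (cases "j = k") (simp_all add: co)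
    qed
    also have "\<dots> = ?I n"
      by (subst suminf_finite[of "{k}"]) auto
    finally show ?thesis .
  qed
  then have "l2_tendsto \<nu> (\<lambda>n. coord (ys n)) ?c"
    using lim f by (intro l2_tendstoI step_wiener_isometry(1) valid coord_space_measurable) auto
  then show ?thesis unfolding represents_def using valid Y sw by (intro exI[of _ ys]) simp
qed

end

lemma space_l2_borel: "space (l2_borel N) = L2 N"
  by (simp add: l2_borel_def space_measure_of_conv)

text \<open>
  The generating balls determine the distances \<open>\<parallel>g - h\<parallel>\<close>, and polarization recovers the inner
  products from them.
\<close>

lemma l2_inner_l2_borel_measurable:
  assumes f: "f \<in> L2 N"
  shows "(\<lambda>g. l2_inner N g f) \<in> borel_measurable (l2_borel N)"
proof -
  have d: "(\<lambda>g. l2_dist_sq N g h) \<in> borel_measurable (l2_borel N)" if h: "h \<in> L2 N" for h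
    unfolding borel_measurable_iff_less
  proof
    fix a :: real
    show "{g \<in> space (l2_borel N). l2_dist_sq N g h < a} \<in> sets (l2_borel N)"
    proof (cases "a > 0")
      case False
      then have "\<not> l2_dist_sq N g h < a" for g using l2_inner_nonneg[of N "\<lambda>x. g x - h x"] by linarith
      then have "{g \<in> space (l2_borel N). l2_dist_sq N g h < a} = {}" by blast
      then show ?thesis by (simp only: sets.empty_sets)
    next
      case True
      let ?B = "{g \<in> L2 N. l2_sq N (\<lambda>x. g x - h x) < ennreal ((sqrt a)\<^sup>2)}"
      have "l2_sq N (\<lambda>x. g x - h x) < ennreal ((sqrt a)\<^sup>2) \<longleftrightarrow> l2_dist_sq N g h < a" if "g \<in> L2 N" for g
        using True l2_sq_eq[OF L2_diff[OF that h]] l2_inner_nonneg[of N "\<lambda>x. g x - h x"]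
        by (simp add: ennreal_less_iff)
      then have "{g \<in> space (l2_borel N). l2_dist_sq N g h < a} = ?B"
        unfolding space_l2_borel by blast
      moreover have "?B \<in> {{g \<in> L2 N. l2_sq N (\<lambda>x. g x - h x) < ennreal (\<epsilon>\<^sup>2)} | h \<epsilon>. h \<in> L2 N \<and> \<epsilon> > 0}"
        using h True by (intro CollectI exI[of _ h] exI[of _ "sqrt a"]) simp
      then have "?B \<in> sets (l2_borel N)"
        unfolding l2_borel_def by (intro in_measure_of) auto
      ultimately show ?thesis by simp
    qed
  qed
  \<comment> \<open>\<open>\<langle>g, f\<rangle> = (\<parallel>g + f\<parallel>\<^sup>2 - \<parallel>g - f\<parallel>\<^sup>2) / 4\<close>\<close>
  have f': "(\<lambda>x. -1 * f x) \<in> L2 N" using f by (rule L2_cmult)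
  have "(\<lambda>g. (l2_dist_sq N g (\<lambda>x. -1 * f x) - l2_dist_sq N g f) / 4) \<in> borel_measurable (l2_borel N)"
    using d[OF f] d[OF f'] by measurable
  moreover have "(l2_dist_sq N g (\<lambda>x. -1 * f x) - l2_dist_sq N g f) / 4 = l2_inner N g f" if g: "g \<in> L2 N" for g
  proof -
    have "l2_dist_sq N g (\<lambda>x. -1 * f x) = l2_inner N g g - -1 * l2_inner N g f
        - -1 * (l2_inner N f g - -1 * l2_inner N f f)"
      using f f' g
      by (simp only: l2_inner_diff_left l2_inner_diff_right L2_diff l2_inner_cmult_left l2_inner_cmult_right)
    moreover have "l2_dist_sq N g f = l2_inner N g g - l2_inner N g f - (l2_inner N f g - l2_inner N f f)"
      using f g by (simp only: l2_inner_diff_left l2_inner_diff_right L2_diff)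
    moreover note l2_inner_commute[of N f g]
    ultimately show ?thesis by simp
  qed
  ultimately show ?thesis
    by (subst measurable_cong[where g="\<lambda>g. (l2_dist_sq N g (\<lambda>x. -1 * f x) - l2_dist_sq N g f) / 4"])
       (auto simp: space_l2_borel)
qed

lemma elem_op_Cons:
  "elem_op N ((a, b, g, h) # xs) s v =
     (\<lambda>x. (if s \<in> {a<..b} then l2_inner N g v else 0) * h x + elem_op N xs s v x)"
  by (auto simp: elem_op_def)

lemma elem_integral_Cons:
  "elem_integral W ((a, b, g, h) # xs) \<omega> = (\<lambda>x. (W b g \<omega> - W a g \<omega>) * h x + elem_integral W xs \<omega> x)"
  by (auto simp: elem_integral_def)

context wiener_setting
begin

text \<open>
  Pairing an elementary \<open>L\<^sup>2\<close>-valued integral with \<open>f\<close> moves the scalars \<open>\<langle>h, f\<rangle>\<close> into the integrand; on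
  the level of integrands this is the adjoint applied to \<open>f\<close>.
\<close>

definition pairing_step :: "('a \<Rightarrow> real) \<Rightarrow> (real \<times> real \<times> ('a \<Rightarrow> real) \<times> ('a \<Rightarrow> real)) list \<Rightarrow> 'a step" where
  "pairing_step f xs = map (\<lambda>(a, b, g, h). (a, b, l2_inner N h f, g)) xs"

lemma pairing_step_integral:
  assumes "\<forall>(a, b, g, h)\<in>set xs. 0 \<le> a \<and> a \<le> b \<and> b \<le> t \<and> g \<in> L2 N \<and> h \<in> L2 N" and f: "f \<in> L2 N"
  shows "valid_step N t (pairing_step f xs) \<and> elem_integral W xs \<omega> \<in> L2 N \<and>
    l2_inner N (elem_integral W xs \<omega>) f = step_wiener W (pairing_step f xs) \<omega>"
  using assms(1)
proof (induction xs)
  case Nil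
  show ?case by (simp add: pairing_step_def valid_step_Nil step_wiener_def elem_integral_def L2_zero l2_inner_def)
next
  case (Cons x xs)
  obtain a b g h where x: "x = (a, b, g, h)" by (cases x) auto
  have v: "0 \<le> a" "a \<le> b" "b \<le> t" "g \<in> L2 N" "h \<in> L2 N" using Cons.prems x by auto
  have IH: "valid_step N t (pairing_step f xs)" "elem_integral W xs \<omega> \<in> L2 N"
    "l2_inner N (elem_integral W xs \<omega>) f = step_wiener W (pairing_step f xs) \<omega>"
    using Cons by auto
  have p: "pairing_step f (x # xs) = (a, b, l2_inner N h f, g) # pairing_step f xs"
    by (simp add: pairing_step_def x)
  show ?case
    unfolding p unfolding x elem_integral_Cons step_wiener_Cons valid_step_Cons
    using v IH f by (simp add: l2_inner_add_left L2_cmult L2_add l2_inner_cmult_left)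
qed

lemma pairing_step_vec:
  assumes "\<forall>(a, b, g, h)\<in>set xs. 0 \<le> a \<and> a \<le> b \<and> b \<le> t \<and> g \<in> L2 N \<and> h \<in> L2 N"
    and f: "f \<in> L2 N" and v: "v \<in> L2 N"
  shows "elem_op N xs s v \<in> L2 N \<and>
    l2_inner N (step_vec (pairing_step f xs) s) v = l2_inner N (elem_op N xs s v) f"
  using assms(1)
proof (induction xs)
  case Nil
  show ?case by (simp add: pairing_step_def step_vec_def elem_op_def L2_zero l2_inner_def)
next
  case (Cons x xs)
  obtain a b g h where x: "x = (a, b, g, h)" by (cases x) auto
  have w: "g \<in> L2 N" "h \<in> L2 N" using Cons.prems x by auto
  have IH: "elem_op N xs s v \<in> L2 N"
    "l2_inner N (step_vec (pairing_step f xs) s) v = l2_inner N (elem_op N xs s v) f"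
    using Cons by auto
  have p: "pairing_step f (x # xs) = (a, b, l2_inner N h f, g) # pairing_step f xs"
    by (simp add: pairing_step_def x)
  have "valid_step N t (pairing_step f (x # xs))"
    using pairing_step_integral[OF Cons.prems f] by blast
  then have "l2_inner N (step_vec (pairing_step f (x # xs)) s) v =
      (if s \<in> {a<..b} then l2_inner N h f else 0) * l2_inner N g v + l2_inner N (elem_op N xs s v) f"
    unfolding p using IH v by (subst inner_step_vec_Cons) auto
  moreover have "l2_inner N (elem_op N (x # xs) s v) f =
      (if s \<in> {a<..b} then l2_inner N g v else 0) * l2_inner N h f + l2_inner N (elem_op N xs s v) f"
    unfolding x elem_op_Cons using w IH f by (simp only: l2_inner_add_left L2_cmult l2_inner_cmult_left)
  moreover have "elem_op N (x # xs) s v \<in> L2 N"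
    unfolding x elem_op_Cons using w IH by (intro L2_add L2_cmult)
  ultimately show ?case by auto
qed

text \<open>
  The distance of the paired integrands is at most \<open>\<parallel>f\<parallel>\<close> times the Hilbert--Schmidt distance. Restricting
  to \<open>\<parallel>f\<parallel> \<le> 1\<close> avoids pulling a constant out of the integral of the Hilbert--Schmidt distance, whose
  measurability in \<open>s\<close> is not known; the general case follows by scaling.
\<close>

lemma represents_stochastic_integral_unit:
  assumes U: "has_stochastic_integral P N e W t \<Phi> U"
    and f: "f \<in> L2 N" and f1: "l2_inner N f f \<le> 1"
    and d: "\<And>j. d j \<in> borel_measurable borel"
    and \<Phi>: "\<And>j s. s \<in> {0..t} \<Longrightarrow> AE x in N. \<Phi> s (e j) x = d j s * e j x"
  shows "represents (\<lambda>(j, s). d j s * l2_inner N (e j) f) (\<lambda>\<omega>. l2_inner N (U \<omega>) f)"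
proof -
  let ?c = "\<lambda>(j, s). d j s * l2_inner N (e j) f"
  have Um: "U \<in> measurable P (l2_borel N)" using U by (simp add: has_stochastic_integral_def)
  obtain xs where xs: "\<And>n. \<forall>(a, b, g, h)\<in>set (xs n). 0 \<le> a \<and> a \<le> b \<and> b \<le> t \<and> g \<in> L2 N \<and> h \<in> L2 N"
    and limT: "(\<lambda>n. \<integral>\<^sup>+s\<in>{0..t}. hs_norm_sq N e (\<lambda>f x. elem_op N (xs n) s f x - \<Phi> s f x) \<partial>lborel) \<longlonglongrightarrow> 0"
    and limU: "(\<lambda>n. \<integral>\<^sup>+\<omega>. l2_sq N (\<lambda>x. elem_integral W (xs n) \<omega> x - U \<omega> x) \<partial>P) \<longlonglongrightarrow> 0"
    using U unfolding has_stochastic_integral_def by blast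
  let ?H = "\<lambda>n. \<integral>\<^sup>+s\<in>{0..t}. hs_norm_sq N e (\<lambda>f x. elem_op N (xs n) s f x - \<Phi> s f x) \<partial>lborel"
    and ?G = "\<lambda>n. \<integral>\<^sup>+\<omega>. l2_sq N (\<lambda>x. elem_integral W (xs n) \<omega> x - U \<omega> x) \<partial>P"
  define ys where "ys n = pairing_step f (xs n)" for n
  have valid: "valid_step N t (ys n)" for n
    using pairing_step_integral[OF xs f] by (simp add: ys_def)
  have CS: "ennreal ((l2_inner N v f)\<^sup>2) \<le> l2_sq N v" if v: "v \<in> L2 N" for v
  proof -
    have "(l2_inner N v f)\<^sup>2 \<le> l2_inner N v v * 1"
      using l2_Cauchy_Schwarz[OF v f] mult_left_mono[OF f1 l2_inner_nonneg[of N v]] by simp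
    then show ?thesis unfolding l2_sq_eq[OF v] by (intro ennreal_leI) simp
  qed
  have "l2_tendsto \<nu> (\<lambda>n. coord (ys n)) ?c"
  proof (rule l2_tendstoI)
    show "coord (ys n) \<in> L2 \<nu>" for n by (rule step_wiener_isometry(1)[OF valid])
    show "?c \<in> borel_measurable \<nu>"
      using d by (intro coord_space_measurable) simp
    show "(\<lambda>n. l2_sq \<nu> (\<lambda>z. coord (ys n) z - ?c z)) \<longlonglongrightarrow> 0"
    proof (rule tendsto_sandwich[OF _ _ tendsto_const limT])
      have "l2_sq \<nu> (\<lambda>z. coord (ys n) z - ?c z) \<le>
        ?H n" for n
      proof -
        have "(\<lambda>s. coord (ys n) (j, s) - ?c (j, s)) \<in> borel_measurable borel" for j
          using coord_component_measurable[OF valid[of n], of j] d[of j] by simp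
        from l2_sq_coord_space(2)[where c="\<lambda>z. coord (ys n) z - ?c z", OF this, of t]
        have "l2_sq \<nu> (\<lambda>z. coord (ys n) z - ?c z)
          = (\<integral>\<^sup>+s\<in>{0..t}. (\<Sum>j. ennreal ((coord (ys n) (j, s) - ?c (j, s))\<^sup>2)) \<partial>lborel)" .
        also have "\<dots> \<le> ?H n"
        proof (rule nn_integral_mono)
          fix s :: real
          have "ennreal ((coord (ys n) (j, s) - ?c (j, s))\<^sup>2)
              \<le> l2_sq N (\<lambda>x. elem_op N (xs n) s (e j) x - \<Phi> s (e j) x)" if s: "s \<in> {0..t}" for j
          proof -
            let ?v = "\<lambda>x. elem_op N (xs n) s (e j) x - d j s * e j x"
            have T: "elem_op N (xs n) s (e j) \<in> L2 N"
              "l2_inner N (step_vec (ys n) s) (e j) = l2_inner N (elem_op N (xs n) s (e j)) f"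
              using pairing_step_vec[OF xs f eL] unfolding ys_def by auto
            have v: "?v \<in> L2 N" by (intro L2_diff T L2_cmult eL)
            have "coord (ys n) (j, s) - ?c (j, s) = l2_inner N ?v f"
              using T by (simp add: coord_def l2_inner_diff_left L2_cmult eL f l2_inner_cmult_left)
            moreover have "l2_sq N (\<lambda>x. elem_op N (xs n) s (e j) x - \<Phi> s (e j) x) = l2_sq N ?v"
              unfolding l2_sq_def
            proof (rule nn_integral_cong_AE)
              show "AE x in N. ennreal ((elem_op N (xs n) s (e j) x - \<Phi> s (e j) x)\<^sup>2) = ennreal ((?v x)\<^sup>2)"
                using \<Phi>[OF s, of j] by eventually_elim simp
            qed
            ultimately show ?thesis using CS[OF v] by simp
          qed
          then show "(\<Sum>j. ennreal ((coord (ys n) (j, s) - ?c (j, s))\<^sup>2)) * indicator {0..t} s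
              \<le> hs_norm_sq N e (\<lambda>f x. elem_op N (xs n) s f x - \<Phi> s f x) * indicator {0..t} s"
            unfolding hs_norm_sq_def by (cases "s \<in> {0..t}") (auto intro!: suminf_le)
        qed
        finally show ?thesis .
      qed
      then show "eventually (\<lambda>n. l2_sq \<nu> (\<lambda>z. coord (ys n) z - ?c z) \<le>
        ?H n) sequentially"
        by simp
    qed simp
  qed
  moreover have "l2_tendsto P (\<lambda>n. step_wiener W (ys n)) (\<lambda>\<omega>. l2_inner N (U \<omega>) f)"
  proof (rule l2_tendstoI)
    show "step_wiener W (ys n) \<in> L2 P" for n by (rule step_wiener_L2[OF valid])
    show "(\<lambda>\<omega>. l2_inner N (U \<omega>) f) \<in> borel_measurable P"
      by (rule measurable_compose[OF Um l2_inner_l2_borel_measurable[OF f]])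
    show "(\<lambda>n. l2_sq P (\<lambda>\<omega>. step_wiener W (ys n) \<omega> - l2_inner N (U \<omega>) f)) \<longlonglongrightarrow> 0"
    proof (rule tendsto_sandwich[OF _ _ tendsto_const limU])
      have "l2_sq P (\<lambda>\<omega>. step_wiener W (ys n) \<omega> - l2_inner N (U \<omega>) f)
        \<le> ?G n" for n
        unfolding l2_sq_def[of P]
      proof (rule nn_integral_mono)
        fix \<omega> assume "\<omega> \<in> space P"
        then have UL: "U \<omega> \<in> L2 N" using measurable_space[OF Um] by (simp add: space_l2_borel)
        have I: "elem_integral W (xs n) \<omega> \<in> L2 N"
          "l2_inner N (elem_integral W (xs n) \<omega>) f = step_wiener W (ys n) \<omega>"
          using pairing_step_integral[OF xs f] by (auto simp: ys_def)
        show "ennreal ((step_wiener W (ys n) \<omega> - l2_inner N (U \<omega>) f)\<^sup>2)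
            \<le> l2_sq N (\<lambda>x. elem_integral W (xs n) \<omega> x - U \<omega> x)"
          using CS[OF L2_diff[OF I(1) UL]] I UL f by (simp add: l2_inner_diff_left)
      qed
      then show "eventually (\<lambda>n. l2_sq P (\<lambda>\<omega>. step_wiener W (ys n) \<omega> - l2_inner N (U \<omega>) f)
        \<le> ?G n) sequentially" by simp
    qed simp
  qed
  ultimately show ?thesis unfolding represents_def using valid by (intro exI[of _ ys]) simp
qed

lemma represents_stochastic_integral:
  assumes U: "has_stochastic_integral P N e W t \<Phi> U"
    and f: "f \<in> L2 N"
    and d: "\<And>j. d j \<in> borel_measurable borel"
    and \<Phi>: "\<And>j s. s \<in> {0..t} \<Longrightarrow> AE x in N. \<Phi> s (e j) x = d j s * e j x"
  shows "represents (\<lambda>(j, s). d j s * l2_inner N (e j) f) (\<lambda>\<omega>. l2_inner N (U \<omega>) f)"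
proof -
  \<comment> \<open>Adding \<open>1\<close> keeps the scaling factor positive also when \<open>f\<close> vanishes.\<close>
  let ?k = "sqrt (l2_inner N f f) + 1"
  let ?f = "\<lambda>x. inverse ?k * f x"
  have k: "?k \<ge> 1" using l2_inner_nonneg[of N f] by simp
  have "l2_inner N f f \<le> ?k * ?k"
    using l2_inner_nonneg[of N f] real_sqrt_ge_zero[OF l2_inner_nonneg[of N f]]
    by (simp add: algebra_simps)
  moreover have "inverse k * (inverse k * x) \<le> 1" if "x \<le> k * k" "k \<ge> 1" for k x :: real
    using that by (simp add: field_simps)
  ultimately have "l2_inner N ?f ?f \<le> 1"
    using k by (simp only: l2_inner_cmult_left l2_inner_cmult_right)
  from represents_cmult[OF represents_stochastic_integral_unit[where f="?f", OF U L2_cmult[OF f] this d \<Phi>], of ?k]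
  have "represents (\<lambda>z. ?k * (case z of (j, s) \<Rightarrow> d j s * l2_inner N (e j) ?f)) (\<lambda>\<omega>. ?k * l2_inner N (U \<omega>) ?f)"
    by simp
  moreover have "?k * (inverse ?k * y) = y" for y
  proof -
    have "?k \<noteq> 0" using k by linarith
    from right_inverse[OF this] show ?thesis by (simp only: mult.assoc[symmetric] mult_1_left)
  qed
  then have "?k * (case z of (j, s) \<Rightarrow> d j s * l2_inner N (e j) ?f) = (case z of (j, s) \<Rightarrow> d j s * l2_inner N (e j) f)"
    "?k * l2_inner N (U \<omega>) ?f = l2_inner N (U \<omega>) f" for z \<omega>
    by (auto simp only: l2_inner_cmult_right mult.left_commute[of ?k] split: prod.split)
  ultimately show ?thesis by (simp only:)
qed

text \<open>
  The partial sums represent the truncated integrand, so convergence of the series in \<open>L\<^sup>2(P)\<close> reduces to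
  square-integrability of its integrand.
\<close>

lemma series_represents:
  assumes X: "\<And>k. has_wiener_integral P (\<lambda>s. W s (e k)) t (g k) (X k)"
    and g: "\<And>k. g k \<in> borel_measurable borel"
    and c: "(\<lambda>(j, s). \<beta> j * g j s) \<in> L2 \<nu>"
  shows "\<exists>Y. l2_sums P (\<lambda>k \<omega>. \<beta> k * X k \<omega>) Y"
    and "l2_sums P (\<lambda>k \<omega>. \<beta> k * X k \<omega>) Y \<Longrightarrow> represents (\<lambda>(j, s). \<beta> j * g j s) Y"
proof -
  let ?c = "\<lambda>(j, s). \<beta> j * g j s"
  have "represents (\<lambda>z. \<Sum>k<K. \<beta> k * (case z of (j, s) \<Rightarrow> if j = k then g k s else 0)) (\<lambda>\<omega>. \<Sum>k<K. \<beta> k * X k \<omega>)" for K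
    by (intro represents_sum represents_cmult represents_wiener_integral X g)
  moreover have "(\<Sum>k<K. \<beta> k * (case z of (j, s) \<Rightarrow> if j = k then g k s else 0)) =
      (case z of (j, s) \<Rightarrow> if j < K then ?c (j, s) else 0)" for K z
    by (cases z) (simp add: if_distrib[of "\<lambda>x. _ * x"] cong: if_cong)
  ultimately have R: "represents (\<lambda>(j, s). if j < K then ?c (j, s) else 0) (\<lambda>\<omega>. \<Sum>k<K. \<beta> k * X k \<omega>)" for K
    by (simp only:)
  note lim = l2_tendsto_truncate[OF c]
  show "\<exists>Y. l2_sums P (\<lambda>k \<omega>. \<beta> k * X k \<omega>) Y"
    unfolding l2_sums_def by (rule represents_convergent[OF R lim])
  show "represents ?c Y" if "l2_sums P (\<lambda>k \<omega>. \<beta> k * X k \<omega>) Y"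
    using represents_limit[OF R lim] that unfolding l2_sums_def by blast
qed

end

section \<open>The spectral operators on eigenfunctions\<close>

text \<open>
  On a multiple of an eigenvector the spectral series is eventually constant. Equality almost
  everywhere is required of \<open>v\<close> so that two such operators can be composed.
\<close>

lemma spectral_op_eigenvector:
  assumes o: "orthonormal N e" and v: "v \<in> L2 N" and ve: "AE x in N. v x = c * e j x"
  shows "spectral_op N e lam G v \<in> L2 N" "AE x in N. spectral_op N e lam G v x = G (lam j) * c * e j x"
proof -
  have eL: "e k \<in> L2 N" for k using o by (rule L2_orthonormal)
  have i: "l2_inner N (e k) v = (if k = j then c else 0)" for k
  proof -
    have "l2_inner N (e k) v = l2_inner N (\<lambda>x. c * e j x) (e k)"
      unfolding l2_inner_commute[of N "e k"]
      using ve v eL L2_cmult[OF eL] by (intro l2_inner_cong_AE) (auto intro: L2_measurable)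
    then show ?thesis using o by (simp add: l2_inner_cmult_left orthonormal_def)
  qed
  let ?h = "\<lambda>x. G (lam j) * c * e j x"
  let ?s = "\<lambda>k x. G (lam k) * l2_inner N (e k) v * e k x"
  have part: "(\<Sum>k<n. ?s k x) = (if j < n then ?h x else 0)" for n x
    unfolding i by (simp add: if_distrib[of "\<lambda>y. _ * y * _"] cong: if_cong)
  have hL: "?h \<in> L2 N" by (intro L2_cmult eL)
  have "l2_sums N ?s ?h"
    unfolding l2_sums_def
  proof (rule l2_tendstoI)
    show "(\<lambda>x. \<Sum>k<n. ?s k x) \<in> L2 N" for n by (intro L2_sum L2_cmult eL)
    show "?h \<in> borel_measurable N" using hL by (rule L2_measurable)
    have "eventually (\<lambda>n. l2_sq N (\<lambda>x. (\<Sum>k<n. ?s k x) - ?h x) = 0) sequentially"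
      using eventually_gt_at_top[of j] by eventually_elim (simp add: part l2_sq_def)
    then show "(\<lambda>n. l2_sq N (\<lambda>x. (\<Sum>k<n. ?s k x) - ?h x)) \<longlonglongrightarrow> 0" by (rule tendsto_eventually)
  qed
  then have h: "l2_tendsto N (\<lambda>n x. \<Sum>k<n. ?s k x) ?h" by (simp add: l2_sums_def)
  have "l2_sums N ?s (spectral_op N e lam G v)"
    unfolding spectral_op_def by (rule someI[of "l2_sums N ?s" ?h]) fact
  then have S: "l2_tendsto N (\<lambda>n x. \<Sum>k<n. ?s k x) (spectral_op N e lam G v)"
    by (simp add: l2_sums_def)
  show "AE x in N. spectral_op N e lam G v x = ?h x" by (rule l2_tendsto_unique[OF S h])
  show "spectral_op N e lam G v \<in> L2 N" using S by (simp add: l2_tendsto_iff)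
qed

section \<open>Words, cells and codes\<close>

lemma word_map_Nil [simp]: "word_map \<psi> [] = id"
  by (simp add: word_map_def)

lemma word_map_Cons: "word_map \<psi> (i # w) = \<psi> i \<circ> word_map \<psi> w"
  by (simp add: word_map_def)

lemma word_map_append: "word_map \<psi> (u @ v) = word_map \<psi> u \<circ> word_map \<psi> v"
  by (induction u) (auto simp: word_map_Cons)

lemma word_ratio_append: "word_ratio r (u @ v) = word_ratio r u * word_ratio r v"
  by (simp add: word_ratio_def)

lemma words_0: "words M 0 = {[]}"
  by (auto simp: words_def)

lemma finite_words: "finite (words M n)"
  using finite_lists_length_eq[of "{1..M}" n] by (simp add: words_def conj_commute)

lemma words_append_bij: "bij_betw (\<lambda>(u, v). u @ v) (words M m \<times> words M n) (words M (m + n))"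
proof (rule bij_betwI[where g="\<lambda>w. (take m w, drop m w)"])
  show "(\<lambda>w. (take m w, drop m w)) \<in> words M (m + n) \<rightarrow> words M m \<times> words M n"
    by (auto simp: words_def dest: in_set_takeD in_set_dropD)
qed (auto simp: words_def subset_iff)

lemma energy_n_0: "energy_n M F \<psi> A r 0 f g = energy0 (vertices0 M F \<psi>) A f g"
  by (simp add: energy_n_def words_0 word_ratio_def)

text \<open>
  Self-similarity of the discrete energies, obtained by splitting each word after \<open>m\<close> letters.
\<close>

lemma energy_n_add:
  "energy_n M F \<psi> A r (m + n) f g =
     (\<Sum>u\<in>words M m. inverse (word_ratio r u) * energy_n M F \<psi> A r n (f \<circ> word_map \<psi> u) (g \<circ> word_map \<psi> u))"
proof -
  let ?E = "\<lambda>w. inverse (word_ratio r w) *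
      energy0 (vertices0 M F \<psi>) A (f \<circ> word_map \<psi> w) (g \<circ> word_map \<psi> w)"
  have "energy_n M F \<psi> A r (m + n) f g = (\<Sum>(u, v)\<in>words M m \<times> words M n. ?E (u @ v))"
    unfolding energy_n_def using sum.reindex_bij_betw[OF words_append_bij, of ?E M m n]
    by (simp add: case_prod_beta')
  also have "\<dots> = (\<Sum>u\<in>words M m. \<Sum>v\<in>words M n. ?E (u @ v))"
    by (simp add: sum.cartesian_product)
  finally show ?thesis
    by (simp add: energy_n_def sum_distrib_left word_map_append word_ratio_append mult.assoc o_assoc)
qed

text \<open>
  The chaining arguments below give a constant for each pair of points; over a finite set of pairs one
  constant serves for all.
\<close>

lemma uniform_const:
  fixes P :: "'s \<Rightarrow> 'f \<Rightarrow> real" and Q :: "'f \<Rightarrow> real"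
  assumes "finite S" and "\<And>s. s \<in> S \<Longrightarrow> \<exists>K\<ge>0. \<forall>f. P s f \<le> K * Q f" and Q: "\<And>f. Q f \<ge> 0"
  shows "\<exists>K\<ge>0. \<forall>s\<in>S. \<forall>f. P s f \<le> K * Q f"
  using assms(1,2)
proof (induction S rule: finite_induct)
  case (insert s S)
  have "\<exists>K\<ge>0. \<forall>t\<in>S. \<forall>f. P t f \<le> K * Q f" by (rule insert.IH) (simp add: insert.prems)
  then obtain K where K: "K \<ge> 0" "\<And>t f. t \<in> S \<Longrightarrow> P t f \<le> K * Q f" by blast
  have "\<exists>K\<ge>0. \<forall>f. P s f \<le> K * Q f" by (rule insert.prems) simp
  then obtain L where L: "L \<ge> 0" "\<And>f. P s f \<le> L * Q f" by blast
  have "P t f \<le> max K L * Q f" if "t \<in> insert s S" for t f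
  proof (cases "t = s")
    case True
    have "L * Q f \<le> max K L * Q f" by (intro mult_right_mono Q) simp
    then show ?thesis using L(2)[of f] True by simp
  next
    case False
    have "K * Q f \<le> max K L * Q f" by (intro mult_right_mono Q) simp
    then show ?thesis using K(2)[of t f] that False by simp
  qed
  then show ?case using K(1) by (intro exI[of _ "max K L"]) auto
qed auto

locale pcf_structure =
  fixes M :: nat and F :: "'a::metric_space set" and \<psi> :: "nat \<Rightarrow> 'a \<Rightarrow> 'a"
    and A :: "'a \<Rightarrow> 'a \<Rightarrow> real" and r :: "nat \<Rightarrow> real"
  assumes pcf: "connected_pcf_set M F \<psi>"
    and harmonic: "regular_harmonic_structure M F \<psi> A r"
    and nonempty: "F \<noteq> {}"
begin

abbreviation "V \<equiv> vertices0 M F \<psi>"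
abbreviation "E \<equiv> energy_n M F \<psi> A r"

lemma F_facts: "M \<ge> 2" "compact F" "connected F" "F = (\<Union>i\<in>{1..M}. \<psi> i ` F)" "finite V"
  using pcf by (auto simp: connected_pcf_set_def vertices0_def)

lemma psi_in: "i \<in> {1..M} \<Longrightarrow> x \<in> F \<Longrightarrow> \<psi> i x \<in> F"
  using F_facts(4) by blast

lemma F_split: "x \<in> F \<Longrightarrow> \<exists>i\<in>{1..M}. \<exists>y\<in>F. x = \<psi> i y"
  using F_facts(4) by blast

lemma uniform_contraction: "\<exists>c\<ge>0. c < 1 \<and> (\<forall>i\<in>{1..M}. c-lipschitz_on F (\<psi> i))"
proof -
  have "\<forall>i\<in>{1..M}. \<exists>c<1. c-lipschitz_on F (\<psi> i)" using pcf by (simp add: connected_pcf_set_def)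
  then obtain c where c: "\<And>i. i \<in> {1..M} \<Longrightarrow> c i < 1 \<and> (c i)-lipschitz_on F (\<psi> i)" by metis
  have ne: "{1..M} \<noteq> {}" using F_facts(1) by auto
  let ?c = "Max (c ` {1..M})"
  have le: "c i \<le> ?c" if "i \<in> {1..M}" for i using that by (intro Max_ge) auto
  have "?c < 1" using ne c by (subst Max_less_iff) auto
  moreover have "?c-lipschitz_on F (\<psi> i)" if "i \<in> {1..M}" for i
    using lipschitz_on_le[of "c i" F "\<psi> i" ?c] c[OF that] le[OF that] by blast
  moreover from this[of 1] have "?c \<ge> 0" using lipschitz_on_nonneg F_facts(1) by auto
  ultimately show ?thesis by blast
qed

definition rate :: real where
  "rate = (SOME c. c \<ge> 0 \<and> c < 1 \<and> (\<forall>i\<in>{1..M}. c-lipschitz_on F (\<psi> i)))"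

lemma rate: "rate \<ge> 0" "rate < 1" "i \<in> {1..M} \<Longrightarrow> rate-lipschitz_on F (\<psi> i)"
proof -
  have "\<exists>c. c \<ge> 0 \<and> c < 1 \<and> (\<forall>i\<in>{1..M}. c-lipschitz_on F (\<psi> i))"
    using uniform_contraction by blast
  from someI_ex[OF this] show "rate \<ge> 0" "rate < 1" "i \<in> {1..M} \<Longrightarrow> rate-lipschitz_on F (\<psi> i)"
    unfolding rate_def by auto
qed

lemma word_map_in: "set w \<subseteq> {1..M} \<Longrightarrow> x \<in> F \<Longrightarrow> word_map \<psi> w x \<in> F"
  by (induction w) (auto simp: word_map_Cons intro!: psi_in)

lemma word_map_dist:
  "set w \<subseteq> {1..M} \<Longrightarrow> x \<in> F \<Longrightarrow> y \<in> F \<Longrightarrow>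
   dist (word_map \<psi> w x) (word_map \<psi> w y) \<le> rate ^ length w * dist x y"
proof (induction w)
  case (Cons i w)
  have "dist (word_map \<psi> (i # w) x) (word_map \<psi> (i # w) y)
      \<le> rate * dist (word_map \<psi> w x) (word_map \<psi> w y)"
    using Cons.prems word_map_in[of w] lipschitz_onD[OF rate(3)[of i]] by (simp add: word_map_Cons)
  also have "\<dots> \<le> rate * (rate ^ length w * dist x y)"
    using Cons rate(1) by (intro mult_left_mono) auto
  finally show ?case by simp
qed simp

lemma word_map_continuous: "set w \<subseteq> {1..M} \<Longrightarrow> continuous_on F (word_map \<psi> w)"
proof -
  assume "set w \<subseteq> {1..M}"
  then have "(rate ^ length w)-lipschitz_on F (word_map \<psi> w)"
    using rate(1) by (intro lipschitz_onI word_map_dist) auto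
  then show ?thesis by (rule lipschitz_on_continuous_on)
qed

lemma cell_compact: "set w \<subseteq> {1..M} \<Longrightarrow> compact (cell F \<psi> w)"
  unfolding cell_def by (intro compact_continuous_image word_map_continuous F_facts)

lemma cell_subset: "set w \<subseteq> {1..M} \<Longrightarrow> cell F \<psi> w \<subseteq> F"
  by (auto simp: cell_def word_map_in)

text \<open>
  A code of \<open>z 0\<close>: the letters \<open>\<omega>\<close> together with the successive preimages \<open>z k\<close>, which are the points
  coded by the shifts of \<open>\<omega>\<close>.
\<close>

definition is_code :: "(nat \<Rightarrow> nat) \<Rightarrow> (nat \<Rightarrow> 'a) \<Rightarrow> bool" where
  "is_code \<omega> z \<longleftrightarrow> (\<forall>k. \<omega> k \<in> {1..M} \<and> z k \<in> F \<and> z k = \<psi> (\<omega> k) (z (Suc k)))"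

lemma is_codeD:
  assumes "is_code \<omega> z"
  shows "\<omega> k \<in> {1..M}" "z k \<in> F" "z k = \<psi> (\<omega> k) (z (Suc k))"
  using assms unfolding is_code_def by blast+

lemma code_exists:
  assumes "i \<in> {1..M}" "y \<in> F"
  shows "\<exists>\<omega> z. is_code \<omega> z \<and> \<omega> 0 = i \<and> z 0 = \<psi> i y \<and> z 1 = y"
proof -
  have "\<forall>x. \<exists>k y. x \<in> F \<longrightarrow> k \<in> {1..M} \<and> y \<in> F \<and> \<psi> k y = x" using F_split by blast
  then obtain j q where jq: "\<And>x. x \<in> F \<Longrightarrow> j x \<in> {1..M} \<and> q x \<in> F \<and> \<psi> (j x) (q x) = x"
    by metis
  define z where "z k = (case k of 0 \<Rightarrow> \<psi> i y | Suc k \<Rightarrow> (q ^^ k) y)" for k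
  define \<omega> where "\<omega> k = (case k of 0 \<Rightarrow> i | Suc k \<Rightarrow> j ((q ^^ k) y))" for k
  have "(q ^^ k) y \<in> F" for k by (induction k) (use assms jq in auto)
  then have q: "j ((q ^^ k) y) \<in> {1..M} \<and> (q ^^ k) y \<in> F \<and> (q ^^ k) y = \<psi> (j ((q ^^ k) y)) (q ((q ^^ k) y))" for k
    using jq[of "(q ^^ k) y"] by simp
  have "is_code \<omega> z"
    unfolding is_code_def
  proof
    fix k
    show "\<omega> k \<in> {1..M} \<and> z k \<in> F \<and> z k = \<psi> (\<omega> k) (z (Suc k))"
    proof (cases k)
      case 0
      then show ?thesis using assms psi_in by (simp add: z_def \<omega>_def)
    next
      case (Suc l)
      show ?thesis unfolding Suc z_def \<omega>_def using q[of l] by (simp only: nat.case funpow.simps o_apply)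
    qed
  qed
  then show ?thesis by (intro exI[of _ \<omega>] exI[of _ z]) (simp add: z_def \<omega>_def)
qed

lemma code_shift: "is_code \<omega> z \<Longrightarrow> is_code (\<lambda>k. \<omega> (k + n)) (\<lambda>k. z (k + n))"
proof -
  assume z: "is_code \<omega> z"
  show ?thesis
    unfolding is_code_def add_Suc by (intro allI conjI is_codeD[OF z])
qed

lemma code_letters: "is_code \<omega> z \<Longrightarrow> set (map \<omega> [0..<n]) \<subseteq> {1..M}"
  using is_codeD(1) by auto

lemma code_prefix: "is_code \<omega> z \<Longrightarrow> z 0 = word_map \<psi> (map \<omega> [0..<n]) (z n)"
proof (induction n)
  case (Suc n)
  have "z n = \<psi> (\<omega> n) (z (Suc n))" using is_codeD(3)[OF Suc.prems] .
  then show ?case using Suc.IH[OF Suc.prems] by (simp add: word_map_append word_map_Cons)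
qed simp

lemma F_bounded: "\<exists>D\<ge>0. \<forall>x\<in>F. \<forall>y\<in>F. dist x y \<le> D"
proof -
  have "bounded F" using F_facts(2) by (rule compact_imp_bounded)
  then obtain e where e: "\<forall>x\<in>F. \<forall>y\<in>F. dist x y \<le> e" unfolding bounded_two_points by blast
  then show ?thesis by (intro exI[of _ "max 0 e"]) (auto simp: le_max_iff_disj)
qed

text \<open>
  The cells along a code shrink to the coded point, whatever points are chosen in them.
\<close>

lemma code_tendsto:
  assumes z: "is_code \<omega> z" and y: "\<And>n. y n \<in> F"
  shows "(\<lambda>n. word_map \<psi> (map \<omega> [0..<n]) (y n)) \<longlonglongrightarrow> z 0"
proof -
  obtain D where D: "D \<ge> 0" "\<And>x y. x \<in> F \<Longrightarrow> y \<in> F \<Longrightarrow> dist x y \<le> D" using F_bounded by blast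
  have "dist (word_map \<psi> (map \<omega> [0..<n]) (y n)) (z 0) \<le> rate ^ n * D" for n
  proof -
    have zn: "z n \<in> F" using z by (rule is_codeD)
    have "dist (word_map \<psi> (map \<omega> [0..<n]) (y n)) (word_map \<psi> (map \<omega> [0..<n]) (z n))
        \<le> rate ^ n * dist (y n) (z n)"
      using word_map_dist[OF code_letters[OF z] y zn, of n] by simp
    also have "\<dots> \<le> rate ^ n * D" using rate(1) by (intro mult_left_mono D y zn) simp
    finally show ?thesis using code_prefix[OF z, of n] by simp
  qed
  moreover have "(\<lambda>n. rate ^ n * D) \<longlonglongrightarrow> 0"
    using rate(1,2) by (intro tendsto_mult_left_zero LIMSEQ_power_zero) simp
  ultimately have "(\<lambda>n. dist (word_map \<psi> (map \<omega> [0..<n]) (y n)) (z 0)) \<longlonglongrightarrow> 0"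
    by - (rule Lim_null_comparison[where g="\<lambda>n. rate ^ n * D"], simp_all)
  then show ?thesis by (rule iffD2[OF tendsto_dist_iff])
qed

lemma coding_map_eq:
  assumes z: "is_code \<omega> z"
  shows "coding_map F \<psi> \<omega> = z 0"
  unfolding coding_map_def
proof (rule the_equality)
  have "z 0 \<in> cell F \<psi> (map \<omega> [0..<n])" for n
    unfolding cell_def using code_prefix[OF z, of n] is_codeD(2)[OF z] by blast
  then show "z 0 \<in> (\<Inter>n. cell F \<psi> (map \<omega> [0..<n]))" by blast
next
  fix x assume "x \<in> (\<Inter>n. cell F \<psi> (map \<omega> [0..<n]))"
  then have "\<forall>n. \<exists>y. y \<in> F \<and> x = word_map \<psi> (map \<omega> [0..<n]) y" unfolding cell_def by blast
  from choice[OF this] obtain y where y: "\<And>n. y n \<in> F" "\<And>n. x = word_map \<psi> (map \<omega> [0..<n]) (y n)"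
    by blast
  have "(\<lambda>n. x) \<longlonglongrightarrow> z 0" using code_tendsto[where y=y, OF z y(1)] unfolding y(2)[symmetric] .
  then show "x = z 0" by (simp add: LIMSEQ_const_iff)
qed

lemma left_shift_iterate: "(left_shift ^^ n) \<omega> = (\<lambda>k. \<omega> (k + n))"
  by (induction n) (auto simp: left_shift_def)

lemma code_vertex:
  assumes z: "is_code \<omega> z" and crit: "z 0 \<in> critical_points M F \<psi>" and n: "n \<ge> 1"
  shows "z n \<in> V"
proof -
  have "\<omega> \<in> infinite_words M" using is_codeD(1)[OF z] unfolding infinite_words_def by blast
  then have "(left_shift ^^ n) \<omega> \<in> post_critical_set M F \<psi>"
    unfolding post_critical_set_def using n crit coding_map_eq[OF z] by force
  moreover have "coding_map F \<psi> ((left_shift ^^ n) \<omega>) = z n"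
    using coding_map_eq[OF code_shift[OF z, of n]] by (simp add: left_shift_iterate)
  ultimately show ?thesis unfolding vertices0_def by force
qed

text \<open>
  A common point of two distinct cells is critical, so its preimage \<open>q\<close> in either cell and the preimage \<open>q'\<close> of
  \<open>q\<close> are coded by shifts of a critical code. Both are therefore vertices: cells meet only in their
  vertices.
\<close>

lemma intersection_vertex:
  assumes ij: "i \<in> {1..M}" "j \<in> {1..M}" "i \<noteq> j" and x: "x \<in> \<psi> i ` F" "x \<in> \<psi> j ` F"
  shows "\<exists>q. q \<in> V \<and> q \<in> F \<and> x = \<psi> i q \<and> (\<exists>k\<in>{1..M}. \<exists>q'\<in>V. q = \<psi> k q')"
proof -
  obtain y where y: "y \<in> F" "x = \<psi> i y" using x by blast
  obtain \<omega> z where z: "is_code \<omega> z" "z 0 = \<psi> i y" "z 1 = y" using code_exists[OF ij(1) y(1)] by blast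
  have crit: "z 0 \<in> critical_points M F \<psi>"
    unfolding critical_points_def z(2) y(2)[symmetric] using ij x by blast
  have "z 1 \<in> V" "z (Suc 1) \<in> V" by (rule code_vertex[OF z(1) crit], simp)+
  moreover have "z 1 = \<psi> (\<omega> 1) (z (Suc 1))" "\<omega> 1 \<in> {1..M}"
    using is_codeD[OF z(1), of 1] by blast+
  ultimately show ?thesis using y z by blast
qed

definition touching :: "(nat \<times> nat) set" where
  "touching = {(i, j). i \<in> {1..M} \<and> j \<in> {1..M} \<and> i \<noteq> j \<and> \<psi> i ` F \<inter> \<psi> j ` F \<noteq> {}}"

text \<open>
  Otherwise the cells reachable from \<open>i\<close> and the remaining ones would split \<open>F\<close> into two disjoint closed
  sets.
\<close>

lemma touching_connected:
  assumes i: "i \<in> {1..M}" and j: "j \<in> {1..M}"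
  shows "(i, j) \<in> touching\<^sup>*"
proof -
  define S where "S = {k \<in> {1..M}. (i, k) \<in> touching\<^sup>*}"
  let ?A = "\<Union>k\<in>S. \<psi> k ` F" and ?B = "\<Union>k\<in>{1..M} - S. \<psi> k ` F"
  have cl: "closed (\<psi> k ` F)" if "k \<in> {1..M}" for k
    using that rate(3)[OF that] F_facts(2)
    by (intro compact_imp_closed compact_continuous_image) (auto intro: lipschitz_on_continuous_on)
  have "closed ?A" "closed ?B" using cl by (auto simp: S_def intro!: closed_UN)
  moreover have "F \<subseteq> ?A \<union> ?B"
  proof
    fix x assume "x \<in> F"
    then obtain k y where "k \<in> {1..M}" "y \<in> F" "x = \<psi> k y" using F_split by blast
    then show "x \<in> ?A \<union> ?B" by blast
  qed
  moreover have "?A \<inter> ?B = {}"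
  proof (rule ccontr)
    assume "?A \<inter> ?B \<noteq> {}"
    then obtain k l where kl: "k \<in> S" "l \<in> {1..M} - S" "\<psi> k ` F \<inter> \<psi> l ` F \<noteq> {}" by blast
    moreover from this have "k \<in> {1..M}" "(i, k) \<in> touching\<^sup>*" by (simp_all add: S_def)
    ultimately have "(k, l) \<in> touching" unfolding touching_def by blast
    with \<open>(i, k) \<in> touching\<^sup>*\<close> have "(i, l) \<in> touching\<^sup>*" by (rule rtrancl_into_rtrancl)
    then have "l \<in> S" using kl(2) by (simp add: S_def)
    then show False using kl by blast
  qed
  moreover have "?A \<inter> F \<noteq> {}"
  proof -
    have "i \<in> S" using i by (simp add: S_def)
    then show ?thesis using nonempty psi_in[OF i] by blast
  qed
  ultimately have "?B \<inter> F = {}"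
    using connected_closedD[OF F_facts(3), of ?A ?B] by blast
  then have "j \<in> S" using nonempty psi_in[OF j] j by blast
  then show ?thesis by (simp add: S_def)
qed

text \<open>
  Since \<open>M \<ge> 2\<close>, some two cells touch, which supplies a vertex of level \<open>0\<close> that is also a vertex of level
  \<open>1\<close>.
\<close>

lemma base_vertex: "\<exists>p. p \<in> V \<and> p \<in> F \<and> (\<exists>k\<in>{1..M}. \<exists>q\<in>V. p = \<psi> k q)"
proof -
  have "(1, 2) \<in> touching\<^sup>*" using F_facts(1) by (intro touching_connected) auto
  then obtain j where "(1, j) \<in> touching" by (cases rule: converse_rtranclE) auto
  then obtain x where "j \<in> {1..M}" "1 \<noteq> j" "1 \<in> {1..M}" "x \<in> \<psi> 1 ` F" "x \<in> \<psi> j ` F"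
    by (auto simp: touching_def)
  from intersection_vertex[OF this(3,1,2,4,5)] show ?thesis by blast
qed

end

section \<open>Oscillation bounds by the energy\<close>

context pcf_structure
begin

lemma harmonic_facts:
  shows r_bounds: "i \<in> {1..M} \<Longrightarrow> 0 < r i \<and> r i < 1"
    and A_sym: "x \<in> V \<Longrightarrow> y \<in> V \<Longrightarrow> A x y = A y x"
    and energy0_nonneg: "energy0 V A f f \<ge> 0"
    and A_nonneg: "x \<in> V \<Longrightarrow> y \<in> V \<Longrightarrow> x \<noteq> y \<Longrightarrow> A x y \<ge> 0"
    and A_kernel: "(\<forall>x\<in>V. (\<Sum>y\<in>V. A x y * f y) = 0) \<longleftrightarrow> (\<exists>c. \<forall>x\<in>V. f x = c)"
    and energy0_le_energy1: "energy0 V A f f \<le> E 1 f f"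
proof -
  note h = harmonic[unfolded regular_harmonic_structure_def Let_def]
  note h2 = h[THEN conjunct2]
  note h3 = h2[THEN conjunct2]
  note h4 = h3[THEN conjunct2]
  note h5 = h4[THEN conjunct2]
  note h6 = h5[THEN conjunct2]
  show "0 < r i \<and> r i < 1" if "i \<in> {1..M}" using bspec[OF h[THEN conjunct1] that] .
  show "A x y = A y x" if "x \<in> V" "y \<in> V" using bspec[OF bspec[OF h2[THEN conjunct1] that(1)] that(2)] .
  show "A x y \<ge> 0" if "x \<in> V" "y \<in> V" "x \<noteq> y"
    using mp[OF bspec[OF bspec[OF h4[THEN conjunct1] that(1)] that(2)] that(3)] .
  show "energy0 V A f f \<ge> 0" using spec[OF h3[THEN conjunct1], of f] by (simp add: energy0_def)
  show "(\<forall>x\<in>V. (\<Sum>y\<in>V. A x y * f y) = 0) \<longleftrightarrow> (\<exists>c. \<forall>x\<in>V. f x = c)"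
    using spec[OF h5[THEN conjunct1], of f] .
  have "(\<forall>x\<in>V. f x = f x) \<longrightarrow> energy0 V A f f \<le> E 1 f f"
    using spec[OF spec[OF h6, of f, THEN conjunct2], of f] .
  then show "energy0 V A f f \<le> E 1 f f" by simp
qed

lemma A_row_sum: "x \<in> V \<Longrightarrow> (\<Sum>y\<in>V. A x y) = 0"
  using A_kernel[of "\<lambda>_. 1"] by auto

lemma energy0_eq_differences:
  "energy0 V A f f = (\<Sum>x\<in>V. \<Sum>y\<in>V. A x y * (f x - f y)\<^sup>2) / 2"
proof -
  have 1: "(\<Sum>x\<in>V. \<Sum>y\<in>V. A x y * (f x)\<^sup>2) = 0"
    by (simp add: sum_distrib_right[symmetric] A_row_sum)
  have "(\<Sum>x\<in>V. \<Sum>y\<in>V. A x y * (f y)\<^sup>2) = (\<Sum>y\<in>V. \<Sum>x\<in>V. A y x * (f y)\<^sup>2)"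
    by (subst sum.swap) (simp add: A_sym cong: sum.cong)
  then have 2: "(\<Sum>x\<in>V. \<Sum>y\<in>V. A x y * (f y)\<^sup>2) = 0"
    by (simp add: sum_distrib_right[symmetric] A_row_sum)
  have "(\<Sum>x\<in>V. \<Sum>y\<in>V. A x y * (f x - f y)\<^sup>2)
      = (\<Sum>x\<in>V. \<Sum>y\<in>V. A x y * (f x)\<^sup>2 + A x y * (f y)\<^sup>2 - 2 * (f x * A x y * f y))"
    by (intro sum.cong refl) (simp add: power2_diff algebra_simps)
  also have "\<dots> = - 2 * (\<Sum>x\<in>V. \<Sum>y\<in>V. f x * A x y * f y)"
    unfolding sum.distrib sum_subtractf 1 2 sum_distrib_left[symmetric] by simp
  finally show ?thesis by (simp add: energy0_def)
qed

lemma energy0_edge: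
  assumes "x \<in> V" "y \<in> V" "x \<noteq> y"
  shows "A x y * (f x - f y)\<^sup>2 \<le> energy0 V A f f"
proof -
  let ?t = "\<lambda>(a, b). A a b * (f a - f b)\<^sup>2"
  have nn: "?t p \<ge> 0" if "p \<in> V \<times> V" for p
  proof (cases "fst p = snd p")
    case False
    then show ?thesis using that A_nonneg[of "fst p" "snd p"] by (auto simp: case_prod_beta')
  qed (auto simp: case_prod_beta')
  have "sum ?t {(x, y), (y, x)} \<le> sum ?t (V \<times> V)"
    using assms F_facts(5) nn by (intro sum_mono2) auto
  moreover have "sum ?t {(x, y), (y, x)} = 2 * (A x y * (f x - f y)\<^sup>2)"
    using assms A_sym[OF assms(1,2)] by (simp add: power2_commute)
  moreover have "sum ?t (V \<times> V) = (\<Sum>x\<in>V. \<Sum>y\<in>V. A x y * (f x - f y)\<^sup>2)"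
    by (simp add: sum.cartesian_product)
  ultimately show ?thesis using energy0_eq_differences[of f] by simp
qed

definition edges :: "('a \<times> 'a) set" where
  "edges = {(x, y). x \<in> V \<and> y \<in> V \<and> x \<noteq> y \<and> A x y > 0}"

text \<open>
  The indicator of a component of the graph with conductances \<open>A\<close> lies in the kernel of \<open>A\<close>, hence is
  constant.
\<close>

lemma edges_connected:
  assumes x: "x \<in> V" and y: "y \<in> V"
  shows "(x, y) \<in> edges\<^sup>*"
proof -
  define S where "S = {z \<in> V. (x, z) \<in> edges\<^sup>*}"
  define f :: "'a \<Rightarrow> real" where "f z = (if z \<in> S then 1 else 0)" for z
  have cross: "A z w = 0" if "z \<in> S" "w \<in> V - S" for z w
  proof (rule ccontr)
    assume "A z w \<noteq> 0"
    moreover have zw: "z \<in> V" "w \<in> V" "z \<noteq> w" using that by (auto simp: S_def)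
    ultimately have "(z, w) \<in> edges" using A_nonneg[OF zw] by (simp add: edges_def)
    moreover have "(x, z) \<in> edges\<^sup>*" using that by (simp add: S_def)
    ultimately have "(x, w) \<in> edges\<^sup>*" by (rule rtrancl_into_rtrancl[rotated])
    then show False using that by (simp add: S_def)
  qed
  have "\<forall>z\<in>V. (\<Sum>w\<in>V. A z w * f w) = 0"
  proof
    fix z assume z: "z \<in> V"
    show "(\<Sum>w\<in>V. A z w * f w) = 0"
    proof (cases "z \<in> S")
      case True
      have "(\<Sum>w\<in>V. A z w * f w) = (\<Sum>w\<in>V. A z w)"
        using cross[OF True] by (intro sum.cong refl) (auto simp: f_def)
      then show ?thesis using A_row_sum[OF z] by simp
    next
      case False
      have "A z w * f w = 0" if w: "w \<in> V" for w
        using cross[of w z] A_sym[OF z w] False z by (auto simp: f_def)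
      then show ?thesis by (intro sum.neutral) blast
    qed
  qed
  then obtain c where c: "\<And>z. z \<in> V \<Longrightarrow> f z = c" using A_kernel[of f] by blast
  have "x \<in> S" using x by (simp add: S_def)
  then have "f y = 1" using c[OF x] c[OF y] by (simp add: f_def)
  then show ?thesis by (auto simp: f_def S_def split: if_splits)
qed

text \<open>
  Chaining along the edges of positive conductance.
\<close>

lemma energy0_oscillation:
  "\<exists>K\<ge>0. \<forall>p\<in>V \<times> V. \<forall>f. \<bar>f (fst p) - f (snd p)\<bar> \<le> K * sqrt (energy0 V A f f)"
proof (rule uniform_const)
  show "finite (V \<times> V)" using F_facts(5) by simp
  show "sqrt (energy0 V A f f) \<ge> 0" for f using energy0_nonneg[of f] by simp
  fix p assume "p \<in> V \<times> V"
  then have "(fst p, snd p) \<in> edges\<^sup>*" by (intro edges_connected) auto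
  then show "\<exists>K\<ge>0. \<forall>f. \<bar>f (fst p) - f (snd p)\<bar> \<le> K * sqrt (energy0 V A f f)"
  proof (induction rule: rtrancl_induct)
    case base
    show ?case by (intro exI[of _ 0]) simp
  next
    case (step y z)
    obtain K where K: "K \<ge> 0" "\<And>f. \<bar>f (fst p) - f y\<bar> \<le> K * sqrt (energy0 V A f f)"
      using step.IH by blast
    have e: "y \<in> V" "z \<in> V" "y \<noteq> z" "A y z > 0" using step.hyps by (auto simp: edges_def)
    let ?L = "1 / sqrt (A y z)"
    have "\<bar>f y - f z\<bar> \<le> ?L * sqrt (energy0 V A f f)" for f
    proof -
      have "(f y - f z)\<^sup>2 \<le> energy0 V A f f / A y z"
        using energy0_edge[OF e(1-3), of f] e(4) by (simp add: field_simps)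
      then have "sqrt ((f y - f z)\<^sup>2) \<le> sqrt (energy0 V A f f / A y z)" by (rule real_sqrt_le_mono)
      then show ?thesis by (simp add: real_sqrt_divide)
    qed
    moreover have "\<bar>f (fst p) - f z\<bar> \<le> \<bar>f (fst p) - f y\<bar> + \<bar>f y - f z\<bar>" for f :: "'a \<Rightarrow> real" by simp
    ultimately have "\<bar>f (fst p) - f z\<bar> \<le> (K + ?L) * sqrt (energy0 V A f f)" for f
      using K(2)[of f] unfolding distrib_right by (smt (verit))
    moreover have "K + ?L \<ge> 0" using K(1) e(4) by simp
    ultimately show ?case by blast
  qed
qed

lemma word_ratio_pos: "set w \<subseteq> {1..M} \<Longrightarrow> 0 < word_ratio r w"
  using r_bounds by (induction w) (auto simp: word_ratio_def)

lemma word_ratio_le_1: "set w \<subseteq> {1..M} \<Longrightarrow> word_ratio r w \<le> 1"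
proof (induction w)
  case (Cons i w)
  then have "r i * word_ratio r w \<le> 1 * 1"
    using r_bounds[of i] word_ratio_pos[of w] by (intro mult_mono) auto
  then show ?case by (simp add: word_ratio_def)
qed (simp add: word_ratio_def)

lemma wordsD: "w \<in> words M m \<Longrightarrow> set w \<subseteq> {1..M} \<and> length w = m"
  by (simp add: words_def)

lemma energy_n_nonneg: "E n f f \<ge> 0"
  unfolding energy_n_def
  by (intro sum_nonneg mult_nonneg_nonneg energy0_nonneg) (auto dest!: wordsD word_ratio_pos intro: less_imp_le)

text \<open>Self-similarity: the part of the energy carried by one cell.\<close>

lemma energy_n_cell_le:
  assumes w: "w \<in> words M m"
  shows "E n (f \<circ> word_map \<psi> w) (f \<circ> word_map \<psi> w) \<le> word_ratio r w * E (m + n) f f"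
proof -
  have pos: "0 < word_ratio r u" if "u \<in> words M m" for u
    using word_ratio_pos wordsD[OF that] by simp
  have "inverse (word_ratio r w) * E n (f \<circ> word_map \<psi> w) (f \<circ> word_map \<psi> w) \<le> E (m + n) f f"
    unfolding energy_n_add
    using w pos finite_words energy_n_nonneg
    by (intro member_le_sum[where f="\<lambda>u. inverse (word_ratio r u) * E n (f \<circ> word_map \<psi> u) (f \<circ> word_map \<psi> u)"])
       (auto intro!: mult_nonneg_nonneg simp: less_imp_le)
  then show ?thesis using pos[OF w] by (simp add: field_simps)
qed

text \<open>
  The minimizing property of the harmonic structure, applied inside every cell of level \<open>n\<close>.
\<close>

lemma energy_n_mono: "E n f f \<le> E (Suc n) f f"
proof -
  have "E n f f = (\<Sum>u\<in>words M n. inverse (word_ratio r u) * energy0 V A (f \<circ> word_map \<psi> u) (f \<circ> word_map \<psi> u))"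
    by (simp add: energy_n_def)
  also have "\<dots> \<le> (\<Sum>u\<in>words M n. inverse (word_ratio r u) * E 1 (f \<circ> word_map \<psi> u) (f \<circ> word_map \<psi> u))"
    by (intro sum_mono mult_left_mono energy0_le_energy1)
       (auto dest!: wordsD word_ratio_pos intro: less_imp_le)
  also have "\<dots> = E (n + 1) f f" by (simp only: energy_n_add)
  finally show ?thesis by simp
qed

lemma energy_n_incseq: "incseq (\<lambda>n. E n f f)"
  by (intro incseq_SucI energy_n_mono)

lemma letter_word: "i \<in> {1..M} \<Longrightarrow> [i] \<in> words M 1"
  by (simp add: words_def)

lemma energy1_cell_le:
  assumes "i \<in> {1..M}"
  shows "energy0 V A (f \<circ> \<psi> i) (f \<circ> \<psi> i) \<le> E 1 f f"
proof -
  have "energy0 V A (f \<circ> \<psi> i) (f \<circ> \<psi> i) \<le> word_ratio r [i] * E 1 f f"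
    using energy_n_cell_le[OF letter_word[OF assms], of 0 f] by (simp add: energy_n_0 word_map_Cons)
  also have "\<dots> \<le> 1 * E 1 f f"
    using word_ratio_le_1[of "[i]"] assms by (intro mult_right_mono energy_n_nonneg) simp
  finally show ?thesis by simp
qed

text \<open>
  Within one cell this is the bound for \<open>energy0\<close>; different cells are joined through chains of touching
  cells, whose common points are vertices of both.
\<close>

lemma energy1_oscillation:
  "\<exists>K\<ge>0. \<forall>s\<in>({1..M} \<times> {1..M}) \<times> (V \<times> V). \<forall>f.
     \<bar>f (\<psi> (fst (fst s)) (fst (snd s))) - f (\<psi> (snd (fst s)) (snd (snd s)))\<bar> \<le> K * sqrt (E 1 f f)"
proof (rule uniform_const)
  show "finite (({1..M} \<times> {1..M}) \<times> (V \<times> V))" using F_facts(5) by simp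
  show "sqrt (E 1 f f) \<ge> 0" for f using energy_n_nonneg[of 1 f] by simp
  obtain K0 where K0: "K0 \<ge> 0"
    "\<And>p f. p \<in> V \<times> V \<Longrightarrow> \<bar>f (fst p) - f (snd p)\<bar> \<le> K0 * sqrt (energy0 V A f f)"
    using energy0_oscillation by blast
  have same: "\<bar>f (\<psi> i q) - f (\<psi> i q')\<bar> \<le> K0 * sqrt (E 1 f f)"
    if "i \<in> {1..M}" "q \<in> V" "q' \<in> V" for i q q' f
  proof -
    have "\<bar>f (\<psi> i q) - f (\<psi> i q')\<bar> \<le> K0 * sqrt (energy0 V A (f \<circ> \<psi> i) (f \<circ> \<psi> i))"
      using K0(2)[of "(q, q')" "f \<circ> \<psi> i"] that by simp
    also have "\<dots> \<le> K0 * sqrt (E 1 f f)"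
      using K0(1) energy1_cell_le[OF that(1)] by (intro mult_left_mono real_sqrt_le_mono)
    finally show ?thesis .
  qed
  fix s assume "s \<in> ({1..M} \<times> {1..M}) \<times> (V \<times> V)"
  then obtain i j q0 q1 where s: "s = ((i, j), (q0, q1))" "i \<in> {1..M}" "j \<in> {1..M}" "q0 \<in> V" "q1 \<in> V"
    by auto
  have "(i, j) \<in> touching\<^sup>*" using s by (intro touching_connected)
  then have "\<exists>K\<ge>0. \<forall>f. \<forall>q\<in>V. \<forall>q'\<in>V. \<bar>f (\<psi> i q) - f (\<psi> j q')\<bar> \<le> K * sqrt (E 1 f f)"
  proof (induction rule: rtrancl_induct)
    case base
    show ?case using K0(1) same[OF s(2)] by blast
  next
    case (step j k)
    obtain K where K: "K \<ge> 0" "\<And>f q q'. q \<in> V \<Longrightarrow> q' \<in> V \<Longrightarrow> \<bar>f (\<psi> i q) - f (\<psi> j q')\<bar> \<le> K * sqrt (E 1 f f)"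
      using step.IH by blast
    have jk: "j \<in> {1..M}" "k \<in> {1..M}" "j \<noteq> k" and "\<psi> j ` F \<inter> \<psi> k ` F \<noteq> {}"
      using step.hyps(2) unfolding touching_def by blast+
    then obtain x where x: "x \<in> \<psi> j ` F" "x \<in> \<psi> k ` F" by blast
    obtain a where a: "a \<in> V" "x = \<psi> j a" using intersection_vertex[OF jk x] by blast
    obtain b where b: "b \<in> V" "x = \<psi> k b"
      using intersection_vertex[OF jk(2,1) jk(3)[symmetric] x(2,1)] by blast
    have "\<bar>f (\<psi> i q) - f (\<psi> k q')\<bar> \<le> (K + K0) * sqrt (E 1 f f)" if "q \<in> V" "q' \<in> V" for f q q'
    proof -
      have "\<bar>f (\<psi> i q) - f x\<bar> \<le> K * sqrt (E 1 f f)" using K(2)[OF that(1) a(1), of f] a(2) by simp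
      moreover have "\<bar>f x - f (\<psi> k q')\<bar> \<le> K0 * sqrt (E 1 f f)"
        using same[OF jk(2) b(1) that(2), of f] b(2) by simp
      ultimately show ?thesis unfolding distrib_right by linarith
    qed
    then show ?case using K(1) K0(1) by (intro exI[of _ "K + K0"]) simp
  qed
  then show "\<exists>K\<ge>0. \<forall>f. \<bar>f (\<psi> (fst (fst s)) (fst (snd s))) - f (\<psi> (snd (fst s)) (snd (snd s)))\<bar> \<le> K * sqrt (E 1 f f)"
    using s by auto
qed

lemma ratio_bound: "\<exists>\<rho>\<ge>0. \<rho> < 1 \<and> (\<forall>w. set w \<subseteq> {1..M} \<longrightarrow> word_ratio r w \<le> (\<rho> ^ length w)\<^sup>2)"
proof -
  have ne: "{1..M} \<noteq> {}" using F_facts(1) by auto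
  let ?m = "Max (r ` {1..M})"
  have le: "r i \<le> ?m" if "i \<in> {1..M}" for i using that by (intro Max_ge) auto
  have m1: "?m < 1" using ne r_bounds by (subst Max_less_iff) auto
  have m0: "0 \<le> ?m" using order_trans[OF less_imp_le le[of 1], of 0] r_bounds[of 1] F_facts(1) by simp
  have "word_ratio r w \<le> ?m ^ length w" if "set w \<subseteq> {1..M}" for w
    using that
  proof (induction w)
    case (Cons i w)
    then have "r i * word_ratio r w \<le> ?m * ?m ^ length w"
      using m0 le word_ratio_pos[of w] by (intro mult_mono) auto
    then show ?case by (simp add: word_ratio_def)
  qed (simp add: word_ratio_def)
  moreover have "?m ^ n = (sqrt ?m ^ n)\<^sup>2" for n
    using m0 by (simp add: power_mult_distrib[symmetric] power2_eq_square)
  ultimately show ?thesis using m0 m1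
    by (intro exI[of _ "sqrt ?m"]) auto
qed

text \<open>
  Fix a boundary point \<open>p\<close> that also lies in \<open>F\<^sup>1\<close>. Along the code of \<open>x\<close> the images of \<open>p\<close> converge to
  \<open>x\<close>, and consecutive images are joined inside one cell of level \<open>m\<close>, at cost \<open>sqrt (r\<^sub>w B)\<close>. The costs
  are summable because all \<open>r\<^sub>i < 1\<close>, which is where regularity enters.
\<close>

lemma oscillation_from_base:
  "\<exists>K\<ge>0. \<exists>p\<in>F. \<forall>f B. continuous_on F f \<longrightarrow> (\<forall>n. E n f f \<le> B) \<longrightarrow> (\<forall>x\<in>F. \<bar>f p - f x\<bar> \<le> K * sqrt B)"
proof -
  obtain p k q where p: "p \<in> V" "p \<in> F" "k \<in> {1..M}" "q \<in> V" "p = \<psi> k q" using base_vertex by blast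
  obtain K where K: "K \<ge> 0" "\<And>s f. s \<in> ({1..M} \<times> {1..M}) \<times> (V \<times> V) \<Longrightarrow>
     \<bar>f (\<psi> (fst (fst s)) (fst (snd s))) - f (\<psi> (snd (fst s)) (snd (snd s)))\<bar> \<le> K * sqrt (E 1 f f)"
    using energy1_oscillation by blast
  obtain \<rho> where \<rho>: "\<rho> \<ge> 0" "\<rho> < 1" "\<And>w. set w \<subseteq> {1..M} \<Longrightarrow> word_ratio r w \<le> (\<rho> ^ length w)\<^sup>2"
    using ratio_bound by blast
  have step: "\<bar>f p - f (\<psi> i p)\<bar> \<le> K * sqrt (E 1 f f)" if "i \<in> {1..M}" for f i
    using K(2)[of "((k, i), (q, p))" f] p that by simp
  have "\<bar>f p - f x\<bar> \<le> K * (1 / (1 - \<rho>)) * sqrt B"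
    if f: "continuous_on F f" and B: "\<And>n. E n f f \<le> B" and x: "x \<in> F" for f B x
  proof -
    have B0: "B \<ge> 0" using B[of 0] energy_n_nonneg[of 0 f] by linarith
    obtain i y where iy: "i \<in> {1..M}" "y \<in> F" "x = \<psi> i y" using F_split[OF x] by blast
    obtain \<omega> z where z: "is_code \<omega> z" "z 0 = x" using code_exists[OF iy(1,2)] iy(3) by blast
    define v where "v m = map \<omega> [0..<m]" for m
    have v: "set (v m) \<subseteq> {1..M}" "length (v m) = m" "v m \<in> words M m" for m
      using code_letters[OF z(1), of m] by (simp_all add: v_def words_def)
    define y where "y m = word_map \<psi> (v m) p" for m
    have yF: "y m \<in> F" for m unfolding y_def by (rule word_map_in[OF v(1) p(2)])
    have "y \<longlonglongrightarrow> x"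
      using code_tendsto[OF z(1), of "\<lambda>_. p"] p(2) z(2) by (simp add: y_def[abs_def] v_def)
    then have lim: "(\<lambda>m. f (y m)) \<longlonglongrightarrow> f x"
      using f x yF by (auto simp: continuous_on_sequentially o_def)
    have incr: "\<bar>f (y m) - f (y (Suc m))\<bar> \<le> K * sqrt B * \<rho> ^ m" for m
    proof -
      let ?g = "f \<circ> word_map \<psi> (v m)"
      have "E 1 ?g ?g \<le> word_ratio r (v m) * B"
        using energy_n_cell_le[OF v(3)[of m], of 1 f] B[of "m + 1"] word_ratio_pos[OF v(1), of m]
        by (meson less_imp_le mult_left_mono order_trans)
      also have "\<dots> \<le> (\<rho> ^ m)\<^sup>2 * B"
        using \<rho>(3)[OF v(1), of m] B0 v(2)[of m] by (intro mult_right_mono) simp_all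
      finally have "sqrt (E 1 ?g ?g) \<le> sqrt ((\<rho> ^ m)\<^sup>2 * B)" by (rule real_sqrt_le_mono)
      also have "\<dots> = \<rho> ^ m * sqrt B" using \<rho>(1) by (simp add: real_sqrt_mult)
      finally have e: "sqrt (E 1 ?g ?g) \<le> \<rho> ^ m * sqrt B" .
      have "\<omega> m \<in> {1..M}" using is_codeD(1)[OF z(1)] .
      from step[OF this, of ?g] have "\<bar>?g p - ?g (\<psi> (\<omega> m) p)\<bar> \<le> K * sqrt (E 1 ?g ?g)" .
      also have "\<dots> \<le> K * (\<rho> ^ m * sqrt B)" using e K(1) by (rule mult_left_mono)
      finally show ?thesis
        by (simp add: y_def v_def word_map_append word_map_Cons mult.commute mult.left_commute)
    qed
    have "\<bar>f p - f (y m)\<bar> \<le> K * sqrt B * (\<Sum>k<m. \<rho> ^ k)" for m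
    proof (induction m)
      case 0
      then show ?case by (simp add: y_def v_def)
    next
      case (Suc m)
      then show ?case using incr[of m] by (simp add: distrib_left)
    qed
    moreover have "(\<Sum>k<m. \<rho> ^ k) \<le> 1 / (1 - \<rho>)" for m
    proof -
      have "(\<Sum>k<m. \<rho> ^ k) \<le> (\<Sum>k. \<rho> ^ k)"
        using \<rho> by (intro sum_le_suminf) (auto simp: summable_geometric)
      then show ?thesis using \<rho> by (simp add: suminf_geometric)
    qed
    then have "K * sqrt B * (\<Sum>k<m. \<rho> ^ k) \<le> K * sqrt B * (1 / (1 - \<rho>))" for m
      using K(1) B0 by (intro mult_left_mono) auto
    ultimately have "\<bar>f p - f (y m)\<bar> \<le> K * sqrt B * (1 / (1 - \<rho>))" for m
      using order_trans by blast
    moreover have "(\<lambda>m. \<bar>f p - f (y m)\<bar>) \<longlonglongrightarrow> \<bar>f p - f x\<bar>" by (intro tendsto_intros lim)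
    ultimately have "\<bar>f p - f x\<bar> \<le> K * sqrt B * (1 / (1 - \<rho>))"
      by (intro LIMSEQ_le_const2) auto
    then show ?thesis by (simp add: mult.commute mult.left_commute)
  qed
  moreover have "K * (1 / (1 - \<rho>)) \<ge> 0" using K(1) \<rho> by simp
  ultimately show ?thesis using p(2) by blast
qed

lemma oscillation:
  "\<exists>C>0. \<forall>f B. continuous_on F f \<longrightarrow> (\<forall>n. E n f f \<le> B) \<longrightarrow> (\<forall>x\<in>F. \<forall>y\<in>F. (f x - f y)\<^sup>2 \<le> C * B)"
proof -
  obtain K p where K: "K \<ge> 0" "p \<in> F"
    "\<And>f B x. continuous_on F f \<Longrightarrow> (\<And>n. E n f f \<le> B) \<Longrightarrow> x \<in> F \<Longrightarrow> \<bar>f p - f x\<bar> \<le> K * sqrt B"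
    using oscillation_from_base by blast
  have "(f x - f y)\<^sup>2 \<le> (4 * K\<^sup>2 + 1) * B"
    if f: "continuous_on F f" and B: "\<And>n. E n f f \<le> B" and xy: "x \<in> F" "y \<in> F" for f B x y
  proof -
    have B0: "B \<ge> 0" using B[of 0] energy_n_nonneg[of 0 f] by linarith
    have "\<bar>f x - f y\<bar> \<le> 2 * K * sqrt B"
      using K(3)[OF f B xy(1)] K(3)[OF f B xy(2)] by linarith
    then have "\<bar>f x - f y\<bar>\<^sup>2 \<le> (2 * K * sqrt B)\<^sup>2" by (intro power_mono) auto
    also have "\<dots> = 4 * K\<^sup>2 * B" using B0 by (simp add: power_mult_distrib)
    also have "\<dots> \<le> (4 * K\<^sup>2 + 1) * B" using B0 by (simp add: distrib_right)
    finally show ?thesis by simp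
  qed
  then show ?thesis by (intro exI[of _ "4 * K\<^sup>2 + 1"]) (auto intro: add_nonneg_pos)
qed

lemma cell_oscillation:
  "\<exists>C>0. \<forall>f B m w. continuous_on F f \<longrightarrow> (\<forall>n. E n f f \<le> B) \<longrightarrow> w \<in> words M m \<longrightarrow>
     (\<forall>x\<in>cell F \<psi> w. \<forall>y\<in>cell F \<psi> w. (f x - f y)\<^sup>2 \<le> C * (word_ratio r w * B))"
proof -
  obtain C where C: "C > 0"
    "\<And>f B x y. continuous_on F f \<Longrightarrow> (\<And>n. E n f f \<le> B) \<Longrightarrow> x \<in> F \<Longrightarrow> y \<in> F \<Longrightarrow> (f x - f y)\<^sup>2 \<le> C * B"
    using oscillation by blast
  have "(f x - f y)\<^sup>2 \<le> C * (word_ratio r w * B)"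
    if f: "continuous_on F f" and B: "\<And>n. E n f f \<le> B" and w: "w \<in> words M m"
      and xy: "x \<in> cell F \<psi> w" "y \<in> cell F \<psi> w" for f B m w x y
  proof -
    have sw: "set w \<subseteq> {1..M}" using wordsD[OF w] by blast
    obtain x' y' where x': "x' \<in> F" "x = word_map \<psi> w x'" and y': "y' \<in> F" "y = word_map \<psi> w y'"
      using xy unfolding cell_def by blast
    have "continuous_on F (f \<circ> word_map \<psi> w)"
    proof (rule continuous_on_compose[OF word_map_continuous[OF sw]])
      show "continuous_on (word_map \<psi> w ` F) f"
        using word_map_in[OF sw] by (intro continuous_on_subset[OF f]) blast
    qed
    moreover have "E n (f \<circ> word_map \<psi> w) (f \<circ> word_map \<psi> w) \<le> word_ratio r w * B" for n
      using energy_n_cell_le[OF w, of n f] B[of "m + n"] word_ratio_pos[OF sw]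
      by (meson less_imp_le mult_left_mono order_trans)
    ultimately have "((f \<circ> word_map \<psi> w) x' - (f \<circ> word_map \<psi> w) y')\<^sup>2 \<le> C * (word_ratio r w * B)"
      by (intro C(2) x' y')
    then show ?thesis using x' y' by simp
  qed
  then show ?thesis using C(1) by blast
qed

end

section \<open>The energy form on its domain\<close>

context pcf_structure
begin

abbreviation "Dom \<equiv> energy_domain M F \<psi> A r"
abbreviation "En \<equiv> energy M F \<psi> A r"

lemma energy_n_commute: "E n f g = E n g f"
proof -
  have "energy0 V A f g = energy0 V A g f" for f g
    unfolding energy0_def by (subst sum.swap) (simp add: A_sym mult.commute mult.left_commute cong: sum.cong)
  then show ?thesis unfolding energy_n_def by simp
qed

lemma energy_n_add_left: "E n (\<lambda>x. f x + g x) h = E n f h + E n g h"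
proof -
  have "energy0 V A (\<lambda>x. f x + g x) h = energy0 V A f h + energy0 V A g h" for f g h
    by (simp add: energy0_def distrib_right sum.distrib)
  then show ?thesis by (simp add: energy_n_def o_def distrib_left sum.distrib)
qed

lemma energy_n_cmult_left: "E n (\<lambda>x. c * f x) h = c * E n f h"
  by (simp add: energy_n_def energy0_def o_def sum_distrib_left mult.assoc mult.left_commute)

lemma energy_n_add_right: "E n h (\<lambda>x. f x + g x) = E n h f + E n h g"
  by (subst (1 2 3) energy_n_commute) (rule energy_n_add_left)

lemma energy_n_cmult_right: "E n h (\<lambda>x. c * f x) = c * E n h f"
  by (subst (1 2) energy_n_commute) (rule energy_n_cmult_left)

lemma energy_n_sum_left: "finite I \<Longrightarrow> E n (\<lambda>x. \<Sum>k\<in>I. c k * f k x) h = (\<Sum>k\<in>I. c k * E n (f k) h)"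
proof (induction I rule: finite_induct)
  case empty
  show ?case using energy_n_cmult_left[of n 0 "\<lambda>_. 0" h] by simp
next
  case (insert k I)
  then show ?case by (simp add: energy_n_add_left energy_n_cmult_left)
qed

lemma energy_domain_iff: "f \<in> Dom \<longleftrightarrow> continuous_on F f \<and> (\<exists>B. \<forall>n. E n f f \<le> B)"
proof -
  have "convergent (\<lambda>n. E n f f)" if B: "\<forall>n. E n f f \<le> B" for B
  proof -
    obtain L where "(\<lambda>n. E n f f) \<longlonglongrightarrow> L"
      using incseq_convergent[OF energy_n_incseq B] .
    then show ?thesis by (rule convergentI)
  qed
  moreover have "\<exists>B. \<forall>n. E n f f \<le> B" if "convergent (\<lambda>n. E n f f)"
    using incseq_le[OF energy_n_incseq[of f]] that unfolding convergent_def by blast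
  ultimately show ?thesis unfolding energy_domain_def by blast
qed

lemma energy_n_le_energy:
  assumes "f \<in> Dom"
  shows "E n f f \<le> En f f"
proof -
  have "(\<lambda>n. E n f f) \<longlonglongrightarrow> En f f"
    using assms by (simp add: energy_domain_def energy_def convergent_LIMSEQ_iff)
  from incseq_le[OF energy_n_incseq this] show ?thesis .
qed

lemma energy_domain_cmult: "f \<in> Dom \<Longrightarrow> (\<lambda>x. c * f x) \<in> Dom"
proof -
  assume "f \<in> Dom"
  then obtain B where f: "continuous_on F f" "\<And>n. E n f f \<le> B" unfolding energy_domain_iff by blast
  have "E n (\<lambda>x. c * f x) (\<lambda>x. c * f x) \<le> c * c * B" for n
    unfolding energy_n_cmult_left energy_n_cmult_right mult.assoc[symmetric]
    by (intro mult_left_mono f(2)) simp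
  then show ?thesis unfolding energy_domain_iff using f(1) by (blast intro: continuous_on_mult_left)
qed

lemma energy_domain_add: "f \<in> Dom \<Longrightarrow> g \<in> Dom \<Longrightarrow> (\<lambda>x. f x + g x) \<in> Dom"
proof -
  assume "f \<in> Dom" "g \<in> Dom"
  then obtain B C where f: "continuous_on F f" "\<And>n. E n f f \<le> B"
    and g: "continuous_on F g" "\<And>n. E n g g \<le> C" unfolding energy_domain_iff by blast
  have "E n (\<lambda>x. f x + g x) (\<lambda>x. f x + g x) \<le> 2 * B + 2 * C" for n
  proof -
    have "0 \<le> E n (\<lambda>x. f x + -1 * g x) (\<lambda>x. f x + -1 * g x)" by (rule energy_n_nonneg)
    also have "\<dots> = E n f f - 2 * E n f g + E n g g"
      unfolding energy_n_add_left energy_n_add_right energy_n_cmult_left energy_n_cmult_right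
      using energy_n_commute[of n f g] by simp
    finally have "2 * E n f g \<le> E n f f + E n g g" by simp
    moreover have "E n (\<lambda>x. f x + g x) (\<lambda>x. f x + g x) = E n f f + 2 * E n f g + E n g g"
      unfolding energy_n_add_left energy_n_add_right using energy_n_commute[of n f g] by simp
    ultimately show ?thesis using f(2)[of n] g(2)[of n] by simp
  qed
  then show ?thesis unfolding energy_domain_iff using f(1) g(1) by (blast intro: continuous_on_add)
qed

text \<open>
  Polarization; the energies of \<open>f\<close>, \<open>g\<close> and \<open>f + g\<close> converge by membership in the domain.
\<close>

lemma energy_tendsto:
  assumes f: "f \<in> Dom" and g: "g \<in> Dom"
  shows "(\<lambda>n. E n f g) \<longlonglongrightarrow> En f g"
proof -
  have lim: "(\<lambda>n. E n h h) \<longlonglongrightarrow> En h h" if "h \<in> Dom" for h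
    using that by (simp add: energy_domain_def energy_def convergent_LIMSEQ_iff)
  let ?s = "\<lambda>x. f x + g x"
  have "(\<lambda>n. (E n ?s ?s - E n f f - E n g g) / 2) \<longlonglongrightarrow> (En ?s ?s - En f f - En g g) / 2"
    by (intro tendsto_intros lim f g energy_domain_add) simp
  moreover have "(E n ?s ?s - E n f f - E n g g) / 2 = E n f g" for n
    unfolding energy_n_add_left energy_n_add_right using energy_n_commute[of n f g] by simp
  ultimately have "convergent (\<lambda>n. E n f g)" unfolding convergent_def by auto
  then show ?thesis by (simp add: energy_def convergent_LIMSEQ_iff)
qed

lemma form_domain_subset: "form_domain b M F \<psi> A r \<subseteq> Dom"
  by (auto simp: form_domain_def split: boundary_condition.splits)

lemma form_domain_sum:
  fixes K :: nat
  assumes "\<And>k. f k \<in> form_domain b M F \<psi> A r"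
  shows "(\<lambda>x. \<Sum>k<K. c k * f k x) \<in> form_domain b M F \<psi> A r"
proof -
  have "(\<lambda>x. \<Sum>k<K. c k * f k x) \<in> Dom"
  proof (induction K)
    case 0
    show ?case using energy_domain_cmult[of "f 0" 0] assms[of 0] form_domain_subset[of b] by auto
  next
    case (Suc K)
    have "f K \<in> Dom" using assms form_domain_subset by blast
    then show ?case using energy_domain_add[OF Suc energy_domain_cmult[of "f K" "c K"]] by simp
  qed
  then show ?thesis using assms by (cases b) (simp_all add: form_domain_def)
qed

text \<open>
  Duality for the resolvent: a functional bounded with respect to \<open>\<E>\<^sub>1 = \<E> + \<parallel>\<cdot>\<parallel>\<^sup>2\<close> has
  square-summable coefficients against the weights \<open>1 / (1 + \<lambda>\<^sub>k)\<close>. The test function with coefficients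
  \<open>a\<^sub>k / (1 + \<lambda>\<^sub>k)\<close> is extremal.
\<close>

lemma eigenbasis_coefficient_bound:
  assumes eb: "eigenbasis b M F \<psi> A r \<mu> \<phi> lam" and C: "C \<ge> 0"
    and bound: "\<And>c K. (\<Sum>k<K. c k * a k)\<^sup>2 \<le> C *
      (En (\<lambda>x. \<Sum>k<K. c k * \<phi> k x) (\<lambda>x. \<Sum>k<K. c k * \<phi> k x)
       + l2_inner \<mu> (\<lambda>x. \<Sum>k<K. c k * \<phi> k x) (\<lambda>x. \<Sum>k<K. c k * \<phi> k x))"
  shows "(\<Sum>k<K. (a k)\<^sup>2 / (1 + lam k)) \<le> C"
proof -
  have o: "orthonormal \<mu> \<phi>" using eb by (simp add: eigenbasis_def complete_orthonormal_def)
  have nl: "neg_laplacian b M F \<psi> A r \<mu> (\<phi> k) (\<lambda>x. lam k * \<phi> k x)" for k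
    using eb by (simp add: eigenbasis_def)
  have fd: "\<phi> k \<in> form_domain b M F \<psi> A r" for k using nl[of k] by (simp add: neg_laplacian_def)
  have dom: "\<phi> k \<in> Dom" for k using fd form_domain_subset by blast
  have lam: "lam k \<ge> 0" for k
    using eb incseqD[of lam 0 k] by (simp add: eigenbasis_def)
  define c where "c k = a k / (1 + lam k)" for k
  define g where "g x = (\<Sum>k<K. c k * \<phi> k x)" for x
  have gfd: "g \<in> form_domain b M F \<psi> A r" unfolding g_def by (rule form_domain_sum[OF fd])
  then have gdom: "g \<in> Dom" using form_domain_subset by blast
  have coef: "l2_inner \<mu> (\<phi> k) g = c k" if "k < K" for k
    using l2_inner_orthonormal_coeff[OF o, of "{..<K}" c k] that
    unfolding g_def l2_inner_commute[of \<mu> "\<phi> k"] by simp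
  have gg: "l2_inner \<mu> g g = (\<Sum>k<K. c k * c k)"
    unfolding g_def using l2_inner_orthonormal_sum[OF o, of "{..<K}" "{..<K}" c c] by simp
  have "(\<lambda>n. E n g g) \<longlonglongrightarrow> (\<Sum>k<K. c k * En (\<phi> k) g)"
  proof -
    have "E n g g = (\<Sum>k<K. c k * E n (\<phi> k) g)" for n
      using energy_n_sum_left[of "{..<K}" n c \<phi> g] by (simp add: g_def[abs_def])
    then show ?thesis by (simp only:) (intro tendsto_intros energy_tendsto dom gdom)
  qed
  then have "En g g = (\<Sum>k<K. c k * En (\<phi> k) g)"
    using LIMSEQ_unique energy_tendsto[OF gdom gdom] by blast
  also have "\<dots> = (\<Sum>k<K. c k * (lam k * c k))"
    using nl gfd coef by (intro sum.cong refl) (simp add: neg_laplacian_def l2_inner_cmult_left)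
  finally have "En g g + l2_inner \<mu> g g = (\<Sum>k<K. c k * (lam k * c k) + c k * c k)"
    by (simp add: gg sum.distrib)
  also have "\<dots> = (\<Sum>k<K. (a k)\<^sup>2 / (1 + lam k))"
  proof (intro sum.cong refl)
    fix k
    have "1 + lam k \<noteq> 0" using lam[of k] by simp
    then have "c k * (1 + lam k) = a k" by (simp add: c_def)
    have "c k * (lam k * c k) + c k * c k = c k * (c k * (1 + lam k))" by (simp add: algebra_simps)
    also have "\<dots> = (a k)\<^sup>2 / (1 + lam k)"
      unfolding \<open>c k * (1 + lam k) = a k\<close> by (simp add: c_def power2_eq_square)
    finally show "c k * (lam k * c k) + c k * c k = (a k)\<^sup>2 / (1 + lam k)" .
  qed
  finally have energy: "En g g + l2_inner \<mu> g g = (\<Sum>k<K. (a k)\<^sup>2 / (1 + lam k))" (is "_ = ?S") .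
  have "(\<Sum>k<K. c k * a k) = ?S" by (simp add: c_def power2_eq_square)
  then have "?S\<^sup>2 \<le> C * ?S" using bound[of c K] energy by (simp add: g_def[abs_def])
  then have "?S * ?S \<le> C * ?S" by (simp add: power2_eq_square)
  moreover have "?S \<ge> 0" using lam by (intro sum_nonneg) (simp add: add_nonneg_nonneg)
  ultimately show ?thesis using C by (cases "?S = 0") (auto simp: mult_le_cancel_right)
qed

end

section \<open>Averages over small neighbourhoods\<close>

context pcf_structure
begin

lemma cut_wordsD:
  assumes "w \<in> cut_words M r n"
  shows "\<exists>m. w \<in> words M m" "word_ratio r w \<le> 2 powr (- real n)"
proof -
  have "[] \<in> words M 0" by (simp add: words_0)
  then show "\<exists>m. w \<in> words M m"
    using assms by (cases "n = 0") (auto simp: cut_words_def all_words_def)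
  show "word_ratio r w \<le> 2 powr (- real n)"
    using assms by (cases "n = 0") (auto simp: cut_words_def word_ratio_def)
qed

text \<open>
  Along a code of \<open>x\<close> the ratios decrease to \<open>0\<close>, and the first prefix with ratio at most \<open>2\<^sup>-\<^sup>n\<close>
  belongs to the partition.
\<close>

lemma cut_word_exists:
  assumes x: "x \<in> F"
  shows "\<exists>w\<in>cut_words M r n. x \<in> cell F \<psi> w"
proof (cases "n = 0")
  case True
  then show ?thesis using x by (simp add: cut_words_def cell_def)
next
  case False
  obtain i y where iy: "i \<in> {1..M}" "y \<in> F" "x = \<psi> i y" using F_split[OF x] by blast
  obtain \<omega> z where z: "is_code \<omega> z" "z 0 = x" using code_exists[OF iy(1,2)] iy(3) by blast
  define u where "u m = map \<omega> [0..<m]" for m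
  have u: "set (u m) \<subseteq> {1..M}" "length (u m) = m" for m
    using code_letters[OF z(1), of m] by (simp_all add: u_def)
  obtain \<rho> where \<rho>: "\<rho> \<ge> 0" "\<rho> < 1" "\<And>w. set w \<subseteq> {1..M} \<Longrightarrow> word_ratio r w \<le> (\<rho> ^ length w)\<^sup>2"
    using ratio_bound by blast
  have "(\<lambda>m. (\<rho> ^ m)\<^sup>2) \<longlonglongrightarrow> 0\<^sup>2"
    using \<rho> by (intro tendsto_power LIMSEQ_power_zero) simp
  then have "eventually (\<lambda>m. (\<rho> ^ m)\<^sup>2 < 2 powr (- real n)) sequentially"
    by (rule order_tendstoD) simp
  then obtain m where "(\<rho> ^ m)\<^sup>2 < 2 powr (- real n)" unfolding eventually_sequentially by blast
  then have ex: "\<exists>m. word_ratio r (u m) \<le> 2 powr (- real n)"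
    using \<rho>(3)[OF u(1), of m] u(2)[of m] by (intro exI[of _ m]) simp
  define k where "k = (LEAST m. word_ratio r (u m) \<le> 2 powr (- real n))"
  have k: "word_ratio r (u k) \<le> 2 powr (- real n)" unfolding k_def using ex by (rule LeastI_ex)
  have "(2::real) powr (- real n) < 2 powr 0" using False by (intro powr_less_mono) auto
  then have "k \<noteq> 0" using k by (intro notI) (simp add: u_def word_ratio_def)
  then obtain l where l: "k = Suc l" by (cases k) auto
  have "\<not> word_ratio r (u l) \<le> 2 powr (- real n)"
    using not_less_Least[of l "\<lambda>m. word_ratio r (u m) \<le> 2 powr (- real n)"] l by (simp add: k_def)
  moreover have "butlast (u k) = u l" by (simp add: u_def l)
  moreover have "u k \<in> all_words M" using u[of k] by (auto simp: all_words_def words_def)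
  moreover have "u k \<noteq> []" by (simp add: u_def l)
  ultimately have "u k \<in> cut_words M r n" using False k by (simp add: cut_words_def)
  moreover have "x \<in> cell F \<psi> (u k)"
    unfolding cell_def u_def using code_prefix[OF z(1), of k] is_codeD(2)[OF z(1), of k] z(2) by blast
  ultimately show ?thesis by blast
qed

lemma self_similar_measureD:
  assumes "self_similar_measure M F \<psi> r d \<mu>"
  shows "prob_space \<mu>" "space \<mu> = F" "sets \<mu> = sets (restrict_space borel F)"
    "w \<in> words M m \<Longrightarrow> measure \<mu> (cell F \<psi> w) > 0"
    "w \<in> words M m \<Longrightarrow> cell F \<psi> w \<in> sets \<mu>"
proof -
  show 1: "prob_space \<mu>" and 2: "sets \<mu> = sets (restrict_space borel F)"
    using assms by (simp_all add: self_similar_measure_def)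
  show "space \<mu> = F" using sets_eq_imp_space_eq[OF 2] by (simp add: space_restrict_space)
  assume w: "w \<in> words M m"
  then have "w \<in> all_words M" by (auto simp: all_words_def)
  then have "measure \<mu> (cell F \<psi> w) = word_ratio r w powr d"
    using assms by (simp add: self_similar_measure_def)
  then show "measure \<mu> (cell F \<psi> w) > 0" using word_ratio_pos[of w] wordsD[OF w] by auto
  have "cell F \<psi> w \<in> sets borel" using cell_compact wordsD[OF w] by (intro borel_compact) simp
  then show "cell F \<psi> w \<in> sets \<mu>"
    unfolding 2 sets_restrict_space using cell_subset wordsD[OF w] by (intro image_eqI[of _ _ "cell F \<psi> w"]) auto
qed

lemma cell_nbhd_measure:
  assumes \<mu>: "self_similar_measure M F \<psi> r d \<mu>" and x: "x \<in> F"
  shows "cell_nbhd M F \<psi> r n x \<in> sets \<mu>" "measure \<mu> (cell_nbhd M F \<psi> r n x) > 0"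
proof -
  interpret prob_space \<mu> by (rule self_similar_measureD(1)[OF \<mu>])
  have eq: "cell_nbhd M F \<psi> r n x = (\<Union>w\<in>{w \<in> cut_words M r n. x \<in> cell F \<psi> w}. cell F \<psi> w)"
    unfolding cell_nbhd_def by blast
  show D: "cell_nbhd M F \<psi> r n x \<in> sets \<mu>"
    unfolding eq
  proof (rule sets.countable_UN')
    show "(\<lambda>w. cell F \<psi> w) ` {w \<in> cut_words M r n. x \<in> cell F \<psi> w} \<subseteq> sets \<mu>"
      using cut_wordsD(1) self_similar_measureD(5)[OF \<mu>] by blast
  qed simp
  obtain w m where w: "w \<in> cut_words M r n" "x \<in> cell F \<psi> w" "w \<in> words M m"
    using cut_word_exists[OF x] cut_wordsD(1) by blast
  have "0 < measure \<mu> (cell F \<psi> w)" by (rule self_similar_measureD(4)[OF \<mu> w(3)])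
  also have "\<dots> \<le> measure \<mu> (cell_nbhd M F \<psi> r n x)"
    using w by (intro finite_measure_mono D) (auto simp: cell_nbhd_def)
  finally show "measure \<mu> (cell_nbhd M F \<psi> r n x) > 0" .
qed

lemma approx_delta_L2:
  assumes \<mu>: "self_similar_measure M F \<psi> r d \<mu>" and x: "x \<in> F"
  shows "approx_delta M F \<psi> r \<mu> n x \<in> L2 \<mu>"
    "(\<integral>y. approx_delta M F \<psi> r \<mu> n x y \<partial>\<mu>) = 1"
proof -
  interpret prob_space \<mu> by (rule self_similar_measureD(1)[OF \<mu>])
  let ?D = "cell_nbhd M F \<psi> r n x"
  note D = cell_nbhd_measure[OF \<mu> x, of n]
  have ind: "(\<lambda>y. indicator ?D y :: real) \<in> L2 \<mu>"
  proof -
    have "integrable \<mu> (indicator ?D :: _ \<Rightarrow> real)"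
      using D(1) by (intro integrable_real_indicator) (simp_all add: emeasure_eq_measure)
    moreover have "(indicator ?D y :: real)\<^sup>2 = indicator ?D y" for y by (simp split: split_indicator)
    ultimately show ?thesis using D(1) by (simp add: L2_iff)
  qed
  show "approx_delta M F \<psi> r \<mu> n x \<in> L2 \<mu>"
    unfolding approx_delta_def by (intro L2_cmult ind)
  have "?D \<inter> space \<mu> = ?D" using sets.sets_into_space[OF D(1)] by blast
  then show "(\<integral>y. approx_delta M F \<psi> r \<mu> n x y \<partial>\<mu>) = 1"
    unfolding approx_delta_def using D by simp
qed

text \<open>
  Every point of the neighbourhood shares with \<open>x\<close> a cell \<open>F\<^sub>w\<close> with \<open>r\<^sub>w \<le> 2\<^sup>-\<^sup>n\<close>, so the oscillation bound
  applies on the whole neighbourhood.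
\<close>

lemma average_bound:
  assumes \<mu>: "self_similar_measure M F \<psi> r d \<mu>"
  shows "\<exists>C>0. \<forall>g\<in>Dom. g \<in> L2 \<mu> \<longrightarrow> (\<forall>x\<in>F. \<forall>n.
     (l2_inner \<mu> g (approx_delta M F \<psi> r \<mu> n x) - g x)\<^sup>2 \<le> C * 2 powr (- real n) * En g g)"
proof -
  interpret prob_space \<mu> by (rule self_similar_measureD(1)[OF \<mu>])
  obtain C where C: "C > 0" "\<And>f B m w x y. continuous_on F f \<Longrightarrow> (\<And>n. E n f f \<le> B) \<Longrightarrow> w \<in> words M m \<Longrightarrow>
     x \<in> cell F \<psi> w \<Longrightarrow> y \<in> cell F \<psi> w \<Longrightarrow> (f x - f y)\<^sup>2 \<le> C * (word_ratio r w * B)"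
    using cell_oscillation by blast
  have "(l2_inner \<mu> g (approx_delta M F \<psi> r \<mu> n x) - g x)\<^sup>2 \<le> C * 2 powr (- real n) * En g g"
    if g: "g \<in> Dom" and gL: "g \<in> L2 \<mu>" and x: "x \<in> F" for g x n
  proof -
    let ?D = "cell_nbhd M F \<psi> r n x" and ?f = "approx_delta M F \<psi> r \<mu> n x"
    let ?s = "C * 2 powr (- real n) * En g g"
    have En0: "En g g \<ge> 0" using energy_n_le_energy[OF g, of 0] energy_n_nonneg[of 0 g] by linarith
    then have s0: "?s \<ge> 0" using C(1) by simp
    have cont: "continuous_on F g" using g by (simp add: energy_domain_def)
    have osc: "\<bar>g y - g x\<bar> \<le> sqrt ?s" if y: "y \<in> ?D" for y
    proof -
      obtain w m where w: "w \<in> cut_words M r n" "x \<in> cell F \<psi> w" "y \<in> cell F \<psi> w" "w \<in> words M m"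
        using y cut_wordsD(1) unfolding cell_nbhd_def by blast
      have "(g y - g x)\<^sup>2 \<le> C * (word_ratio r w * En g g)"
        by (rule C(2)[OF cont energy_n_le_energy[OF g] w(4,3,2)])
      also have "\<dots> \<le> C * (2 powr (- real n) * En g g)"
        using C(1) En0 cut_wordsD(2)[OF w(1)] by (intro mult_left_mono mult_right_mono) auto
      finally show ?thesis by (intro real_le_rsqrt) (simp add: mult.assoc)
    qed
    have fL: "?f \<in> L2 \<mu>" and f1: "(\<integral>y. ?f y \<partial>\<mu>) = 1" by (rule approx_delta_L2[OF \<mu> x])+
    have fi: "integrable \<mu> ?f" by (rule l1_le_l2(1)[OF fL])
    have gfi: "integrable \<mu> (\<lambda>y. g y * ?f y)" by (rule L2_integrable_mult[OF gL fL])
    have f0: "?f y \<ge> 0" for y by (simp add: approx_delta_def)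
    have "l2_inner \<mu> g ?f - g x = (\<integral>y. g y * ?f y - g x * ?f y \<partial>\<mu>)"
      using gfi fi f1 by (simp add: l2_inner_def)
    also have "\<bar>\<dots>\<bar> \<le> (\<integral>y. \<bar>g y * ?f y - g x * ?f y\<bar> \<partial>\<mu>)" by (rule integral_abs_bound)
    also have "\<dots> \<le> (\<integral>y. sqrt ?s * ?f y \<partial>\<mu>)"
    proof (rule integral_mono)
      show "integrable \<mu> (\<lambda>y. \<bar>g y * ?f y - g x * ?f y\<bar>)" using gfi fi by simp
      show "integrable \<mu> (\<lambda>y. sqrt ?s * ?f y)" using fi by simp
      fix y
      show "\<bar>g y * ?f y - g x * ?f y\<bar> \<le> sqrt ?s * ?f y"
      proof (cases "y \<in> ?D")
        case True
        have "\<bar>g y * ?f y - g x * ?f y\<bar> = \<bar>g y - g x\<bar> * ?f y"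
          using f0[of y] by (simp add: left_diff_distrib[symmetric] abs_mult)
        then show ?thesis using osc[OF True] f0[of y] by (simp add: mult_right_mono)
      next
        case False
        then show ?thesis by (simp add: approx_delta_def)
      qed
    qed
    also have "\<dots> = sqrt ?s" using f1 by simp
    finally have "\<bar>l2_inner \<mu> g ?f - g x\<bar> \<le> sqrt ?s" .
    then have "\<bar>l2_inner \<mu> g ?f - g x\<bar>\<^sup>2 \<le> (sqrt ?s)\<^sup>2" by (intro power_mono) auto
    then show ?thesis using s0 by simp
  qed
  then show ?thesis using C(1) by blast
qed

text \<open>
  Compare \<open>g x\<close> with \<open>g y\<close> and average over \<open>y\<close>.
\<close>

lemma point_bound:
  assumes \<mu>: "self_similar_measure M F \<psi> r d \<mu>"
  shows "\<exists>C>0. \<forall>g\<in>Dom. g \<in> L2 \<mu> \<longrightarrow> (\<forall>x\<in>F. (g x)\<^sup>2 \<le> C * (En g g + l2_inner \<mu> g g))"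
proof -
  interpret prob_space \<mu> by (rule self_similar_measureD(1)[OF \<mu>])
  obtain C where C: "C > 0" "\<And>f B x y. continuous_on F f \<Longrightarrow> (\<And>n. E n f f \<le> B) \<Longrightarrow>
     x \<in> F \<Longrightarrow> y \<in> F \<Longrightarrow> (f x - f y)\<^sup>2 \<le> C * B"
    using oscillation by blast
  have "(g x)\<^sup>2 \<le> (2 * C + 2) * (En g g + l2_inner \<mu> g g)"
    if g: "g \<in> Dom" and gL: "g \<in> L2 \<mu>" and x: "x \<in> F" for g x
  proof -
    have En0: "En g g \<ge> 0" using energy_n_le_energy[OF g, of 0] energy_n_nonneg[of 0 g] by linarith
    have cont: "continuous_on F g" using g by (simp add: energy_domain_def)
    have "(g x)\<^sup>2 \<le> 2 * C * En g g + 2 * (g y)\<^sup>2" if "y \<in> F" for y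
    proof -
      have "(g x - g y)\<^sup>2 \<le> C * En g g" by (rule C(2)[OF cont energy_n_le_energy[OF g] x that])
      moreover have "0 \<le> (g x - 2 * g y)\<^sup>2" by simp
      ultimately show ?thesis by (simp add: power2_eq_square algebra_simps)
    qed
    then have "(\<integral>y. (g x)\<^sup>2 \<partial>\<mu>) \<le> (\<integral>y. 2 * C * En g g + 2 * (g y)\<^sup>2 \<partial>\<mu>)"
      using gL self_similar_measureD(2)[OF \<mu>] by (intro integral_mono) (auto simp: L2_iff)
    also have "\<dots> = 2 * C * En g g + 2 * l2_inner \<mu> g g"
      using gL by (simp add: L2_iff l2_inner_def power2_eq_square prob_space)
    finally have "(g x)\<^sup>2 \<le> 2 * C * En g g + 2 * l2_inner \<mu> g g" by (simp add: prob_space)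
    also have "\<dots> \<le> (2 * C + 2) * (En g g + l2_inner \<mu> g g)"
      using C(1) En0 l2_inner_nonneg[of \<mu> g] by (simp add: distrib_left distrib_right)
    finally show ?thesis .
  qed
  then show ?thesis using C(1) by (intro exI[of _ "2 * C + 2"]) auto
qed

lemma eigenfunction_bounds:
  assumes \<mu>: "self_similar_measure M F \<psi> r d \<mu>" and eb: "eigenbasis b M F \<psi> A r \<mu> \<phi> lam"
  shows "\<exists>C>0. (\<forall>x\<in>F. \<forall>K. (\<Sum>k<K. (\<phi> k x)\<^sup>2 / (1 + lam k)) \<le> C) \<and>
    (\<forall>x\<in>F. \<forall>n K. (\<Sum>k<K. (l2_inner \<mu> (\<phi> k) (approx_delta M F \<psi> r \<mu> n x) - \<phi> k x)\<^sup>2 / (1 + lam k))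
       \<le> C * 2 powr (- real n))"
proof -
  obtain C1 where C1: "C1 > 0" "\<And>g x. g \<in> Dom \<Longrightarrow> g \<in> L2 \<mu> \<Longrightarrow> x \<in> F \<Longrightarrow>
      (g x)\<^sup>2 \<le> C1 * (En g g + l2_inner \<mu> g g)"
    using point_bound[OF \<mu>] by blast
  obtain C2 where C2: "C2 > 0" "\<And>g x n. g \<in> Dom \<Longrightarrow> g \<in> L2 \<mu> \<Longrightarrow> x \<in> F \<Longrightarrow>
      (l2_inner \<mu> g (approx_delta M F \<psi> r \<mu> n x) - g x)\<^sup>2 \<le> C2 * 2 powr (- real n) * En g g"
    using average_bound[OF \<mu>] by blast
  have L: "\<phi> k \<in> L2 \<mu>" for k
    using eb by (simp add: eigenbasis_def complete_orthonormal_def orthonormal_def)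
  have fd: "\<phi> k \<in> form_domain b M F \<psi> A r" for k
    using eb by (simp add: eigenbasis_def neg_laplacian_def)
  have sumD: "(\<lambda>x. \<Sum>k<K. c k * \<phi> k x) \<in> Dom" for c and K :: nat
    using form_domain_sum[where f=\<phi>, OF fd] form_domain_subset by blast
  have sumL: "(\<lambda>x. \<Sum>k<K. c k * \<phi> k x) \<in> L2 \<mu>" for c and K :: nat
    by (intro L2_sum L2_cmult L)
  have 1: "(\<Sum>k<K. (\<phi> k x)\<^sup>2 / (1 + lam k)) \<le> C1" if x: "x \<in> F" for x K
  proof (rule eigenbasis_coefficient_bound[OF eb])
    show "C1 \<ge> 0" using C1(1) by simp
    fix c and K :: nat
    show "(\<Sum>k<K. c k * \<phi> k x)\<^sup>2 \<le> C1 *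
      (En (\<lambda>x. \<Sum>k<K. c k * \<phi> k x) (\<lambda>x. \<Sum>k<K. c k * \<phi> k x)
       + l2_inner \<mu> (\<lambda>x. \<Sum>k<K. c k * \<phi> k x) (\<lambda>x. \<Sum>k<K. c k * \<phi> k x))"
      by (rule C1(2)[OF sumD sumL x])
  qed
  have 2: "(\<Sum>k<K. (l2_inner \<mu> (\<phi> k) (approx_delta M F \<psi> r \<mu> n x) - \<phi> k x)\<^sup>2 / (1 + lam k))
      \<le> C2 * 2 powr (- real n)" if x: "x \<in> F" for x n K
  proof (rule eigenbasis_coefficient_bound[OF eb])
    show "C2 * 2 powr (- real n) \<ge> 0" using C2(1) by simp
    fix c and K :: nat
    let ?f = "approx_delta M F \<psi> r \<mu> n x" and ?g = "\<lambda>x. \<Sum>k<K. c k * \<phi> k x"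
    have "(\<Sum>k<K. c k * (l2_inner \<mu> (\<phi> k) ?f - \<phi> k x)) = l2_inner \<mu> ?g ?f - ?g x"
      using approx_delta_L2(1)[OF \<mu> x, of n]
      by (simp add: l2_inner_sum_left L2_cmult L l2_inner_cmult_left right_diff_distrib sum_subtractf)
    then have "(\<Sum>k<K. c k * (l2_inner \<mu> (\<phi> k) ?f - \<phi> k x))\<^sup>2 \<le> C2 * 2 powr (- real n) * En ?g ?g"
      using C2(2)[OF sumD[where K=K and c=c] sumL x, of n] by (simp only:)
    also have "\<dots> \<le> C2 * 2 powr (- real n) * (En ?g ?g + l2_inner \<mu> ?g ?g)"
      using C2(1) l2_inner_nonneg[of \<mu> ?g] by (intro mult_left_mono) auto
    finally show "(\<Sum>k<K. c k * (l2_inner \<mu> (\<phi> k) ?f - \<phi> k x))\<^sup>2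
      \<le> C2 * 2 powr (- real n) * (En ?g ?g + l2_inner \<mu> ?g ?g)" .
  qed
  have "C1 \<le> max C1 C2" and C: "C2 * 2 powr (- real n) \<le> max C1 C2 * 2 powr (- real n)" for n
    by (auto intro: mult_right_mono)
  then show ?thesis
    using order_trans[OF 1] order_trans[OF 2 C] C1(1) by (intro exI[of _ "max C1 C2"]) auto
qed

end

section \<open>The variance of the point evaluations\<close>

text \<open>
  The factor \<open>exp (2 t)\<close> comes from replacing \<open>\<lambda>\<close> by \<open>\<lambda> + 1\<close>, which makes the bound uniform also for the
  eigenvalue \<open>0\<close>.
\<close>

lemma heat_factor_bound:
  fixes l t :: real
  assumes l: "l \<ge> 0" and t: "t \<ge> 0"
  shows "(\<integral>\<^sup>+s\<in>{0..t}. ennreal ((exp (- l * (t - s)))\<^sup>2) \<partial>lborel) \<le> ennreal (exp (2 * t) / (2 * (1 + l)))"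
proof -
  let ?f = "\<lambda>s. exp (2 * t) * exp (- (2 * (1 + l)) * (t - s))"
  let ?G = "\<lambda>s. exp (2 * t) * exp (- (2 * (1 + l)) * (t - s)) / (2 * (1 + l))"
  have "(\<integral>\<^sup>+s\<in>{0..t}. ennreal ((exp (- l * (t - s)))\<^sup>2) \<partial>lborel) \<le> (\<integral>\<^sup>+s\<in>{0..t}. ennreal (?f s) \<partial>lborel)"
  proof (rule nn_integral_mono)
    fix s :: real
    have "(exp (- l * (t - s)))\<^sup>2 \<le> ?f s" if "s \<in> {0..t}"
    proof -
      have "(exp (- l * (t - s)))\<^sup>2 = exp (- 2 * l * (t - s))"
        by (simp add: power2_eq_square exp_add[symmetric])
      also have "\<dots> \<le> exp (2 * t + - (2 * (1 + l)) * (t - s))"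
        using that by (simp add: algebra_simps)
      finally show ?thesis by (simp only: exp_add)
    qed
    then show "ennreal ((exp (- l * (t - s)))\<^sup>2) * indicator {0..t} s \<le> ennreal (?f s) * indicator {0..t} s"
      by (auto split: split_indicator intro: ennreal_leI)
  qed
  also have "\<dots> = ennreal (?G t - ?G 0)"
  proof (rule nn_integral_FTC_Icc)
    fix s :: real
    have "((\<lambda>s. c * exp (- k * (t - s)) / k) has_real_derivative c * exp (- k * (t - s))) (at s)"
      if "k \<noteq> 0" for c k :: real
      using that by (auto intro!: derivative_eq_intros)
    moreover have "2 * (1 + l) \<noteq> 0" using l by simp
    ultimately show "(?G has_real_derivative ?f s) (at s)" .
  qed (use t in auto)
  also have "\<dots> \<le> ennreal (exp (2 * t) / (2 * (1 + l)))"
    using l by (intro ennreal_leI) simp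
  finally show ?thesis .
qed

text \<open>
  Here \<open>\<beta> j\<close> is the value of a functional on the \<open>j\<close>th eigenfunction: a point evaluation for the series
  of \<open>u(t, x)\<close>, and the difference of an average and a point evaluation for the error.
\<close>

lemma variance_bound:
  assumes lam: "\<And>k. lam k \<ge> 0" and t: "t \<ge> 0" and C: "C \<ge> 0" and \<alpha>: "\<alpha> \<ge> 0"
    and \<beta>: "\<And>K. (\<Sum>k<K. (\<beta> k)\<^sup>2 / (1 + lam k)) \<le> C"
  shows "l2_sq (coord_space t) (\<lambda>(j, s). (1 + lam j) powr (- \<alpha> / 2) * \<beta> j * exp (- lam j * (t - s)))
      \<le> ennreal (exp (2 * t) / 2 * C)"
proof -
  let ?a = "\<lambda>j. (1 + lam j) powr (- \<alpha> / 2)"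
  let ?e = "\<lambda>j s. exp (- lam j * (t - s))"
  have a: "0 \<le> ?a j" "?a j \<le> 1" for j
    using lam[of j] \<alpha> powr_mono[of "- \<alpha> / 2" 0 "1 + lam j"] by auto
  have summand: "(\<integral>\<^sup>+s\<in>{0..t}. ennreal ((?a j * \<beta> j * ?e j s)\<^sup>2) \<partial>lborel)
      \<le> ennreal (exp (2 * t) / 2 * ((\<beta> j)\<^sup>2 / (1 + lam j)))" for j
  proof -
    have h: "ennreal ((p * q)\<^sup>2) = ennreal (p\<^sup>2) * ennreal (q\<^sup>2)" for p q :: real
      by (simp add: power_mult_distrib ennreal_mult)
    have "(\<integral>\<^sup>+s\<in>{0..t}. ennreal ((?a j * \<beta> j * ?e j s)\<^sup>2) \<partial>lborel)
        = (\<integral>\<^sup>+s. ennreal ((?a j * \<beta> j)\<^sup>2) * (ennreal ((?e j s)\<^sup>2) * indicator {0..t} s) \<partial>lborel)"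
      by (intro nn_integral_cong) (simp only: h[of "?a j * \<beta> j"] mult.assoc[of "ennreal _"])
    also have "\<dots> = ennreal ((?a j * \<beta> j)\<^sup>2) * (\<integral>\<^sup>+s\<in>{0..t}. ennreal ((?e j s)\<^sup>2) \<partial>lborel)"
      by (intro nn_integral_cmult) measurable
    also have "\<dots> \<le> ennreal ((?a j * \<beta> j)\<^sup>2) * ennreal (exp (2 * t) / (2 * (1 + lam j)))"
      by (intro mult_left_mono heat_factor_bound lam t) simp
    also have "\<dots> = ennreal ((?a j * \<beta> j)\<^sup>2 * (exp (2 * t) / (2 * (1 + lam j))))"
      using lam[of j] by (intro ennreal_mult[symmetric]) simp_all
    also have "\<dots> \<le> ennreal ((\<beta> j)\<^sup>2 * (exp (2 * t) / (2 * (1 + lam j))))"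
    proof (intro ennreal_leI mult_right_mono)
      have "(?a j)\<^sup>2 \<le> 1" using a[of j] by (simp add: power_le_one)
      then show "(?a j * \<beta> j)\<^sup>2 \<le> (\<beta> j)\<^sup>2"
        unfolding power_mult_distrib by (rule mult_left_le_one_le[rotated 2]) simp_all
    qed (use lam[of j] in simp)
    finally show ?thesis by (simp add: mult.commute)
  qed
  have "l2_sq (coord_space t) (\<lambda>(j, s). ?a j * \<beta> j * ?e j s)
      = (\<Sum>j. \<integral>\<^sup>+s\<in>{0..t}. ennreal ((?a j * \<beta> j * ?e j s)\<^sup>2) \<partial>lborel)"
    by (subst l2_sq_coord_space(1)) auto
  also have "\<dots> \<le> (\<Sum>j. ennreal (exp (2 * t) / 2 * ((\<beta> j)\<^sup>2 / (1 + lam j))))"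
    by (intro suminf_le summand) auto
  also have "\<dots> \<le> ennreal (exp (2 * t) / 2 * C)"
  proof (rule suminf_le_const)
    fix K
    have "(\<Sum>j<K. ennreal (exp (2 * t) / 2 * ((\<beta> j)\<^sup>2 / (1 + lam j))))
        = ennreal (exp (2 * t) / 2 * (\<Sum>j<K. (\<beta> j)\<^sup>2 / (1 + lam j)))"
      unfolding sum_distrib_left using lam by (intro sum_ennreal) simp
    also have "\<dots> \<le> ennreal (exp (2 * t) / 2 * C)"
      by (intro ennreal_leI mult_left_mono \<beta>) simp
    finally show "(\<Sum>j<K. ennreal (exp (2 * t) / 2 * ((\<beta> j)\<^sup>2 / (1 + lam j)))) \<le> ennreal (exp (2 * t) / 2 * C)" .
  qed simp
  finally show ?thesis .
qed

section \<open>The point values of the solution and their approximation\<close>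

theorem theorem4p8:
  fixes M :: nat and F :: "'a::metric_space set" and \<psi> :: "nat \<Rightarrow> 'a \<Rightarrow> 'a"
    and A :: "'a \<Rightarrow> 'a \<Rightarrow> real" and r :: "nat \<Rightarrow> real" and d\<^sub>H :: real and \<mu> :: "'a measure"
    and b :: boundary_condition and \<alpha> :: real
    and \<phi> :: "nat \<Rightarrow> 'a \<Rightarrow> real" and lam :: "nat \<Rightarrow> real"
    and P :: "'w measure" and Ft :: "real \<Rightarrow> 'w measure"
    and W :: "real \<Rightarrow> ('a \<Rightarrow> real) \<Rightarrow> 'w \<Rightarrow> real"
    and X :: "nat \<Rightarrow> real \<Rightarrow> 'w \<Rightarrow> real"
    and u :: "real \<Rightarrow> 'w \<Rightarrow> 'a \<Rightarrow> real"
  assumes "connected_pcf_set M F \<psi>"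
    and "regular_harmonic_structure M F \<psi> A r"
    and "d\<^sub>H > 0" and "(\<Sum>i\<in>{1..M}. r i powr d\<^sub>H) = 1"
    and "self_similar_measure M F \<psi> r d\<^sub>H \<mu>"
    and "eigenbasis b M F \<psi> A r \<mu> \<phi> lam"
    and "filtered_prob_space P Ft"
    and "cylindrical_wiener P Ft \<mu> W"
    and "\<And>k t. t \<ge> 0 \<Longrightarrow>
           has_wiener_integral P (\<lambda>s. W s (\<phi> k)) t (\<lambda>s. exp (- lam k * (t - s))) (X k t)"
    and "\<alpha> \<ge> 0"
    and "mild_solution P Ft \<mu> \<phi> lam \<alpha> W u"
  shows "(\<forall>t\<ge>0. \<forall>x\<in>F.
            (\<exists>Y. is_point_value P \<phi> lam \<alpha> X t x Y) \<and>
            (\<forall>Y Z. is_point_value P \<phi> lam \<alpha> X t x Y \<and> is_point_value P \<phi> lam \<alpha> X t x Z \<longrightarrow> (AE \<omega> in P. Y \<omega> = Z \<omega>)) \<and>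
            (\<forall>Y. is_point_value P \<phi> lam \<alpha> X t x Y \<longrightarrow> centred_gaussian P Y)) \<and>
         (\<exists>c\<^sub>8>0. \<forall>x\<in>F. \<forall>t\<ge>0. \<forall>n. \<forall>Y. is_point_value P \<phi> lam \<alpha> X t x Y \<longrightarrow>
            integrable P (\<lambda>\<omega>. (l2_inner \<mu> (u t \<omega>) (approx_delta M F \<psi> r \<mu> n x) - Y \<omega>)\<^sup>2) \<and>
            prob_space.expectation P
              (\<lambda>\<omega>. (l2_inner \<mu> (u t \<omega>) (approx_delta M F \<psi> r \<mu> n x) - Y \<omega>)\<^sup>2)
              \<le> c\<^sub>8 * exp (2 * t) * 2 powr (- real n))"
proof -
  interpret N: prob_space \<mu> using assms(5) by (simp add: self_similar_measure_def)
  have "space \<mu> = space (restrict_space borel F)"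
    using assms(5) by (intro sets_eq_imp_space_eq) (simp add: self_similar_measure_def)
  then have F: "F \<noteq> {}" using N.not_empty by (simp add: space_restrict_space)
  interpret pcf_structure M F \<psi> A r by (rule pcf_structure.intro[OF assms(1,2) F])
  have prob: "prob_space P" by (rule filtered_prob_spaceD(1)[OF assms(7)])
  have basis: "complete_orthonormal \<mu> \<phi>" using assms(6) by (simp add: eigenbasis_def)
  have lam: "lam k \<ge> 0" for k
    using assms(6) incseqD[of lam 0 k] by (simp add: eigenbasis_def)
  have setting: "wiener_setting P \<mu> Ft W \<phi> t" if "t \<ge> 0" for t
    by (intro wiener_setting.intro wiener_setting_axioms.intro prob N.prob_space_axioms assms(7,8) basis that)
  obtain C where C: "C > 0"
    and point: "\<And>x K. x \<in> F \<Longrightarrow> (\<Sum>k<K. (\<phi> k x)\<^sup>2 / (1 + lam k)) \<le> C"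
    and avg: "\<And>x n K. x \<in> F \<Longrightarrow> (\<Sum>k<K. (l2_inner \<mu> (\<phi> k) (approx_delta M F \<psi> r \<mu> n x) - \<phi> k x)\<^sup>2 / (1 + lam k))
       \<le> C * 2 powr (- real n)"
    using eigenfunction_bounds[OF assms(5,6)] by blast
  define a where "a j = (1 + lam j) powr (- \<alpha> / 2)" for j
  define g where "g t j s = exp (- lam j * (t - s))" for t s :: real and j :: nat
  have gm: "g t j \<in> borel_measurable borel" for t j unfolding g_def by measurable
  have var: "l2_sq (coord_space t) (\<lambda>(j, s). a j * \<beta> j * g t j s) \<le> ennreal (exp (2 * t) / 2 * B)"
    if "t \<ge> 0" "B \<ge> 0" "\<And>K. (\<Sum>k<K. (\<beta> k)\<^sup>2 / (1 + lam k)) \<le> B" for t B \<beta>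
    unfolding a_def g_def by (rule variance_bound[OF lam that(1,2) assms(10) that(3)])
  have X: "has_wiener_integral P (\<lambda>s. W s (\<phi> k)) t (g t k) (X k t)" if "t \<ge> 0" for t k
    unfolding g_def by (rule assms(9)[OF that])
  have cL: "(\<lambda>(j, s). a j * \<phi> j x * g t j s) \<in> L2 (coord_space t)" if t: "t \<ge> 0" and x: "x \<in> F" for t x
  proof -
    have "(\<lambda>(j, s). a j * \<phi> j x * g t j s) \<in> borel_measurable (coord_space t)"
      using gm by (intro coord_space_measurable) simp
    moreover have "l2_sq (coord_space t) (\<lambda>(j, s). a j * \<phi> j x * g t j s) < \<infinity>"
      using var[of t C "\<lambda>j. \<phi> j x", OF t _ point[OF x]] C by (simp add: order_le_less_trans)
    ultimately show ?thesis by (simp add: L2_def)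
  qed
  have pv: "is_point_value P \<phi> lam \<alpha> X t x Y \<longleftrightarrow> l2_sums P (\<lambda>k \<omega>. (a k * \<phi> k x) * X k t \<omega>) Y" for t x Y
    unfolding is_point_value_def a_def by (simp add: mult.assoc mult.commute mult.left_commute)
  have rep: "wiener_setting.represents P \<mu> W \<phi> t (\<lambda>(j, s). a j * \<phi> j x * g t j s) Y"
    if "t \<ge> 0" "x \<in> F" "is_point_value P \<phi> lam \<alpha> X t x Y" for t x Y
    by (rule wiener_setting.series_represents(2)[OF setting X gm cL])
       (use that pv in simp_all)
  show ?thesis
  proof (intro conjI exI[of _ "C / 2"] allI impI ballI)
    fix t :: real and x assume t: "t \<ge> 0" and x: "x \<in> F"
    show "\<exists>Y. is_point_value P \<phi> lam \<alpha> X t x Y"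
      unfolding pv by (rule wiener_setting.series_represents(1)[OF setting[OF t] X[OF t] gm cL[OF t x]])
    show "AE \<omega> in P. Y \<omega> = Z \<omega>"
      if "is_point_value P \<phi> lam \<alpha> X t x Y \<and> is_point_value P \<phi> lam \<alpha> X t x Z" for Y Z
      using that unfolding is_point_value_def l2_sums_def by (blast intro: l2_tendsto_unique)
    show "centred_gaussian P Y" if "is_point_value P \<phi> lam \<alpha> X t x Y" for Y
      using wiener_setting.represents_gaussian(1)[OF setting[OF t] rep[OF t x that]]
      unfolding centred_gaussian_def by blast
  next
    show "C / 2 > 0" using C by simp
  next
    fix x t n Y assume x: "x \<in> F" and t: "0 \<le> (t :: real)" and Y: "is_point_value P \<phi> lam \<alpha> X t x Y"
    interpret S: wiener_setting P \<mu> Ft W \<phi> t by (rule setting[OF t])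
    let ?f = "approx_delta M F \<psi> r \<mu> n x"
    let ?Z = "\<lambda>\<omega>. l2_inner \<mu> (u t \<omega>) ?f - Y \<omega>"
    let ?b = "\<lambda>j. l2_inner \<mu> (\<phi> j) ?f - \<phi> j x"
    let ?c = "\<lambda>(j, s). a j * ?b j * g t j s"
    have fL: "?f \<in> L2 \<mu>" by (rule approx_delta_L2(1)[OF assms(5) x])
    have "has_stochastic_integral P \<mu> \<phi> W t
        (\<lambda>s. semigroup_op \<mu> \<phi> lam (t - s) \<circ> bessel_op \<mu> \<phi> lam \<alpha>) (u t)"
      using assms(11) t by (simp add: mild_solution_def)
    then have "S.represents (\<lambda>(j, s). (g t j s * a j) * l2_inner \<mu> (\<phi> j) ?f) (\<lambda>\<omega>. l2_inner \<mu> (u t \<omega>) ?f)"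
    proof (rule S.represents_stochastic_integral[OF _ fL])
      show "(\<lambda>s. g t j s * a j) \<in> borel_measurable borel" for j using gm by simp
      fix j s
      have "AE y in \<mu>. \<phi> j y = 1 * \<phi> j y" by simp
      note B = spectral_op_eigenvector[OF S.ortho S.eL this, of lam "\<lambda>l. (1 + l) powr (- \<alpha> / 2)"]
      have "AE y in \<mu>. bessel_op \<mu> \<phi> lam \<alpha> (\<phi> j) y = a j * \<phi> j y"
        using B(2) by (simp add: bessel_op_def a_def)
      from spectral_op_eigenvector(2)[OF S.ortho _ this, of lam "\<lambda>l. exp (- l * (t - s))"] B(1)
      show "AE y in \<mu>. (semigroup_op \<mu> \<phi> lam (t - s) \<circ> bessel_op \<mu> \<phi> lam \<alpha>) (\<phi> j) y = g t j s * a j * \<phi> j y"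
        by (simp add: semigroup_op_def bessel_op_def g_def)
    qed
    from S.represents_diff[OF this rep[OF t x Y]]
    have "S.represents (\<lambda>z. (case z of (j, s) \<Rightarrow> (g t j s * a j) * l2_inner \<mu> (\<phi> j) ?f)
        - (case z of (j, s) \<Rightarrow> a j * \<phi> j x * g t j s)) ?Z" .
    moreover have "(case z of (j, s) \<Rightarrow> (g t j s * a j) * l2_inner \<mu> (\<phi> j) ?f)
        - (case z of (j, s) \<Rightarrow> a j * \<phi> j x * g t j s) = ?c z" for z
      by (cases z) (simp add: algebra_simps)
    ultimately have R: "S.represents ?c ?Z" by (simp only:)
    have ZL: "?Z \<in> L2 P" and c: "?c \<in> L2 (coord_space t)" using S.represents_L2[OF R] by blast+
    have "ennreal (l2_inner P ?Z ?Z) = l2_sq (coord_space t) ?c"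
      unfolding S.represents_gaussian(2)[OF R] by (rule l2_sq_eq[OF c, symmetric])
    also have "\<dots> \<le> ennreal (exp (2 * t) / 2 * (C * 2 powr (- real n)))"
      using C by (intro var t avg x) simp
    finally have "l2_inner P ?Z ?Z \<le> exp (2 * t) / 2 * (C * 2 powr (- real n))"
      using C by (subst (asm) ennreal_le_iff) auto
    then show "prob_space.expectation P (\<lambda>\<omega>. (?Z \<omega>)\<^sup>2) \<le> C / 2 * exp (2 * t) * 2 powr (- real n)"
      by (simp add: l2_inner_def power2_eq_square mult.commute mult.left_commute)
    show "integrable P (\<lambda>\<omega>. (?Z \<omega>)\<^sup>2)" using ZL by (simp add: L2_iff)
  qed
qed

end
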